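(* The variety of $^\star$-involutive semilinear idempotent residuated lattices has the strong amalgamation property, and hence the ES property.
   Context: A residuated lattice is an algebra $(A,\wedge,\vee,\cdot,\backslash,/,1)$ such that $(A,\wedge,\vee)$ is a lattice, $(A,\cdot,1)$ is a monoid, and $y\le x\backslash z \iff x\cdot y\le z\iff x\le z/y$ for all $x,y,z$. It is idempotent if it satisfies $x\cdot x=x$, and semilinear if it is a subdirect product of totally ordered residuated lattices. Define $x^r:=x\backslash 1$, $x^\ell:=1/x$, $x^\star:=x^\ell\wedge x^r$. A semilinear idempotent residuated lattice is $^\star$-involutive if it satisfies $x^{\star\star}=x$. A class $\mathcal K$ of similar algebras has the strong amalgamation property if for all $\mathbf A,\mathbf B,\mathbf C\in\mathcal K$ and embeddings $f_B\colon\mathbf A\to\mathbf B$, $f_C\colon\mathbf A\to\mathbf C$ there are $\mathbf D\in\mathcal K$ and embeddings $g_B\colon\mathbf B\to\mathbf D$, $g_C\colon\mathbf C\to\mathbf D$ with $g_B\circ f_B=g_C\circ f_C$ and $(g_B\circ f_B)[A]=g_B[B]\cap g_C[C]$. $\mathcal K$ has the ES property (epimorphism surjectivity) if every homomorphism between members of $\mathcal K$ that is an epimorphism in $\mathcal K$ (right-cancellable with respect to homomorphisms into members of $\mathcal K$) is surjective. *)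

theory Defs
  imports "HOL-Algebra.Group"
begin

record 'a reslat = "'a monoid" +
  meet_rl :: "['a, 'a] \<Rightarrow> 'a" (infixl "\<curlywedge>\<index>" 65)
  join_rl :: "['a, 'a] \<Rightarrow> 'a" (infixl "\<curlyvee>\<index>" 65)
  ldiv :: "['a, 'a] \<Rightarrow> 'a" (infixl "\<setminus>\<index>" 70)
  rdiv :: "['a, 'a] \<Rightarrow> 'a" (infixl "\<oslash>\<index>" 70)

definition le_rl :: "('a, 'b) reslat_scheme \<Rightarrow> 'a \<Rightarrow> 'a \<Rightarrow> bool" (infixl "\<preceq>\<index>" 50)
  where "x \<preceq>\<^bsub>L\<^esub> y \<longleftrightarrow> x \<curlywedge>\<^bsub>L\<^esub> y = x"

locale residuated_lattice = monoid L for L (structure) +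
  assumes meet_closed: "\<lbrakk>x \<in> carrier L; y \<in> carrier L\<rbrakk> \<Longrightarrow> x \<curlywedge> y \<in> carrier L"
    and join_closed: "\<lbrakk>x \<in> carrier L; y \<in> carrier L\<rbrakk> \<Longrightarrow> x \<curlyvee> y \<in> carrier L"
    and ldiv_closed: "\<lbrakk>x \<in> carrier L; y \<in> carrier L\<rbrakk> \<Longrightarrow> x \<setminus> y \<in> carrier L"
    and rdiv_closed: "\<lbrakk>x \<in> carrier L; y \<in> carrier L\<rbrakk> \<Longrightarrow> x \<oslash> y \<in> carrier L"
    and meet_comm: "\<lbrakk>x \<in> carrier L; y \<in> carrier L\<rbrakk> \<Longrightarrow> x \<curlywedge> y = y \<curlywedge> x"
    and join_comm: "\<lbrakk>x \<in> carrier L; y \<in> carrier L\<rbrakk> \<Longrightarrow> x \<curlyvee> y = y \<curlyvee> x"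
    and meet_assoc: "\<lbrakk>x \<in> carrier L; y \<in> carrier L; z \<in> carrier L\<rbrakk>
      \<Longrightarrow> (x \<curlywedge> y) \<curlywedge> z = x \<curlywedge> (y \<curlywedge> z)"
    and join_assoc: "\<lbrakk>x \<in> carrier L; y \<in> carrier L; z \<in> carrier L\<rbrakk>
      \<Longrightarrow> (x \<curlyvee> y) \<curlyvee> z = x \<curlyvee> (y \<curlyvee> z)"
    and meet_join_absorb: "\<lbrakk>x \<in> carrier L; y \<in> carrier L\<rbrakk> \<Longrightarrow> x \<curlywedge> (x \<curlyvee> y) = x"
    and join_meet_absorb: "\<lbrakk>x \<in> carrier L; y \<in> carrier L\<rbrakk> \<Longrightarrow> x \<curlyvee> (x \<curlywedge> y) = x"
    and ldiv_residual: "\<lbrakk>x \<in> carrier L; y \<in> carrier L; z \<in> carrier L\<rbrakk>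
      \<Longrightarrow> y \<preceq> x \<setminus> z \<longleftrightarrow> x \<otimes> y \<preceq> z"
    and rdiv_residual: "\<lbrakk>x \<in> carrier L; y \<in> carrier L; z \<in> carrier L\<rbrakk>
      \<Longrightarrow> x \<otimes> y \<preceq> z \<longleftrightarrow> x \<preceq> z \<oslash> y"

definition totally_ordered_rl :: "('a, 'b) reslat_scheme \<Rightarrow> bool"
  where "totally_ordered_rl L \<longleftrightarrow> residuated_lattice L \<and>
    (\<forall>x \<in> carrier L. \<forall>y \<in> carrier L. x \<preceq>\<^bsub>L\<^esub> y \<or> y \<preceq>\<^bsub>L\<^esub> x)"

definition hom_rl :: "('a, 'c) reslat_scheme \<Rightarrow> ('b, 'd) reslat_scheme \<Rightarrow> ('a \<Rightarrow> 'b) set"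
  where "hom_rl A B = {h \<in> hom A B. h \<one>\<^bsub>A\<^esub> = \<one>\<^bsub>B\<^esub> \<and>
    (\<forall>x \<in> carrier A. \<forall>y \<in> carrier A.
      h (x \<curlywedge>\<^bsub>A\<^esub> y) = h x \<curlywedge>\<^bsub>B\<^esub> h y \<and>
      h (x \<curlyvee>\<^bsub>A\<^esub> y) = h x \<curlyvee>\<^bsub>B\<^esub> h y \<and>
      h (x \<setminus>\<^bsub>A\<^esub> y) = h x \<setminus>\<^bsub>B\<^esub> h y \<and>
      h (x \<oslash>\<^bsub>A\<^esub> y) = h x \<oslash>\<^bsub>B\<^esub> h y)}"

definition emb_rl :: "('a, 'c) reslat_scheme \<Rightarrow> ('b, 'd) reslat_scheme \<Rightarrow> ('a \<Rightarrow> 'b) set"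
  where "emb_rl A B = {h \<in> hom_rl A B. inj_on h (carrier A)}"

definition product_rl :: "'i set \<Rightarrow> ('i \<Rightarrow> ('a, 'b) reslat_scheme) \<Rightarrow> ('i \<Rightarrow> 'a) reslat"
  where "product_rl I F =
    \<lparr>carrier = (\<Pi>\<^sub>E i \<in> I. carrier (F i)),
     monoid.mult = (\<lambda>f g. \<lambda>i \<in> I. f i \<otimes>\<^bsub>F i\<^esub> g i),
     one = (\<lambda>i \<in> I. \<one>\<^bsub>F i\<^esub>),
     meet_rl = (\<lambda>f g. \<lambda>i \<in> I. f i \<curlywedge>\<^bsub>F i\<^esub> g i),
     join_rl = (\<lambda>f g. \<lambda>i \<in> I. f i \<curlyvee>\<^bsub>F i\<^esub> g i),
     ldiv = (\<lambda>f g. \<lambda>i \<in> I. f i \<setminus>\<^bsub>F i\<^esub> g i),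
     rdiv = (\<lambda>f g. \<lambda>i \<in> I. f i \<oslash>\<^bsub>F i\<^esub> g i)\<rparr>"

definition subdirect_emb ::
    "('u, 'c) reslat_scheme \<Rightarrow> 'i set \<Rightarrow> ('i \<Rightarrow> ('a, 'b) reslat_scheme) \<Rightarrow> ('u \<Rightarrow> 'i \<Rightarrow> 'a) \<Rightarrow> bool"
  where "subdirect_emb A I F e \<longleftrightarrow> e \<in> emb_rl A (product_rl I F) \<and>
    (\<forall>i \<in> I. (\<lambda>x. e x i) ` carrier A = carrier (F i))"

(* HOL cannot quantify over the types of the index set and of the factors. The types chosen
   here lose nothing: one index per pair of distinct elements suffices, and every factor,
   being a homomorphic image of A, has an isomorphic copy inside the type of A.
   See semilinear_rlI below. *)
definition semilinear_rl :: "'u reslat \<Rightarrow> bool"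
  where "semilinear_rl A \<longleftrightarrow> residuated_lattice A \<and>
    (\<exists>(I :: ('u \<times> 'u) set) (F :: 'u \<times> 'u \<Rightarrow> 'u reslat) e.
      (\<forall>i \<in> I. totally_ordered_rl (F i)) \<and> subdirect_emb A I F e)"

definition idempotent_rl :: "('a, 'b) reslat_scheme \<Rightarrow> bool"
  where "idempotent_rl L \<longleftrightarrow> residuated_lattice L \<and> (\<forall>x \<in> carrier L. x \<otimes>\<^bsub>L\<^esub> x = x)"

definition rneg_rl :: "('a, 'b) reslat_scheme \<Rightarrow> 'a \<Rightarrow> 'a"
  where "rneg_rl L x = x \<setminus>\<^bsub>L\<^esub> \<one>\<^bsub>L\<^esub>"

definition lneg_rl :: "('a, 'b) reslat_scheme \<Rightarrow> 'a \<Rightarrow> 'a"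
  where "lneg_rl L x = \<one>\<^bsub>L\<^esub> \<oslash>\<^bsub>L\<^esub> x"

definition star_rl :: "('a, 'b) reslat_scheme \<Rightarrow> 'a \<Rightarrow> 'a"
  where "star_rl L x = lneg_rl L x \<curlywedge>\<^bsub>L\<^esub> rneg_rl L x"

definition star_involutive_rl :: "'u reslat set"
  where "star_involutive_rl = {A. semilinear_rl A \<and> idempotent_rl A \<and>
    (\<forall>x \<in> carrier A. star_rl A (star_rl A x) = x)}"

(* In the next three definitions, a class of algebras is represented by its members whose
   carrier is a subset of the type 'u. For a class closed under subalgebras and isomorphic
   copies and an infinite 'u, letting D range over 'u only is no restriction: D can be replaced
   by the subalgebra generated by the images of the given maps, and that subalgebra is no larger
   than 'u. Finite types 'u must be excluded where these notions are used. *)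
definition strong_amalgamation_property :: "'u reslat set \<Rightarrow> bool"
  where "strong_amalgamation_property K \<longleftrightarrow>
    (\<forall>A \<in> K. \<forall>B \<in> K. \<forall>C \<in> K. \<forall>fB \<in> emb_rl A B. \<forall>fC \<in> emb_rl A C.
      \<exists>D \<in> K. \<exists>gB \<in> emb_rl B D. \<exists>gC \<in> emb_rl C D.
        (\<forall>a \<in> carrier A. gB (fB a) = gC (fC a)) \<and>
        (gB \<circ> fB) ` carrier A = gB ` carrier B \<inter> gC ` carrier C)"

definition epimorphism_in :: "'u reslat set \<Rightarrow> 'u reslat \<Rightarrow> 'u reslat \<Rightarrow> ('u \<Rightarrow> 'u) \<Rightarrow> bool"
  where "epimorphism_in K A B h \<longleftrightarrow> h \<in> hom_rl A B \<and>
    (\<forall>D \<in> K. \<forall>g1 \<in> hom_rl B D. \<forall>g2 \<in> hom_rl B D.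
      (\<forall>a \<in> carrier A. g1 (h a) = g2 (h a)) \<longrightarrow> (\<forall>b \<in> carrier B. g1 b = g2 b))"

definition ES_property :: "'u reslat set \<Rightarrow> bool"
  where "ES_property K \<longleftrightarrow>
    (\<forall>A \<in> K. \<forall>B \<in> K. \<forall>h. epimorphism_in K A B h \<longrightarrow> h ` carrier A = carrier B)"

lemma totally_ordered_rl_transport:
  fixes C :: "'a reslat" and s :: "'a \<Rightarrow> 'u" and q :: "'u \<Rightarrow> 'a"
  assumes C: "totally_ordered_rl C" and qs: "\<And>b. b \<in> carrier C \<Longrightarrow> q (s b) = b"
  defines "D \<equiv> \<lparr>carrier = s ` carrier C,
     monoid.mult = (\<lambda>x y. s (q x \<otimes>\<^bsub>C\<^esub> q y)), one = s \<one>\<^bsub>C\<^esub>,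
     meet_rl = (\<lambda>x y. s (q x \<curlywedge>\<^bsub>C\<^esub> q y)), join_rl = (\<lambda>x y. s (q x \<curlyvee>\<^bsub>C\<^esub> q y)),
     ldiv = (\<lambda>x y. s (q x \<setminus>\<^bsub>C\<^esub> q y)), rdiv = (\<lambda>x y. s (q x \<oslash>\<^bsub>C\<^esub> q y))\<rparr>"
  shows "totally_ordered_rl D"
proof -
  interpret C: residuated_lattice C using C by (simp add: totally_ordered_rl_def)
  have s_eq: "s x = s y \<longleftrightarrow> x = y" if "x \<in> carrier C" "y \<in> carrier C" for x y
    using qs that by metis
  note cl = C.meet_closed C.join_closed C.ldiv_closed C.rdiv_closed
  have le: "s x \<preceq>\<^bsub>D\<^esub> s y \<longleftrightarrow> x \<preceq>\<^bsub>C\<^esub> y" if "x \<in> carrier C" "y \<in> carrier C" for x y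
    using that by (simp add: le_rl_def D_def qs s_eq cl)
  have "residuated_lattice D"
  proof
    fix x y z
    assume "x \<in> carrier D" "y \<in> carrier D" "z \<in> carrier D"
    then obtain a b c where abc: "a \<in> carrier C" "b \<in> carrier C" "c \<in> carrier C"
      and eq: "x = s a" "y = s b" "z = s c"
      by (auto simp: D_def)
    have ops: "s a \<setminus>\<^bsub>D\<^esub> s c = s (a \<setminus>\<^bsub>C\<^esub> c)" "s a \<otimes>\<^bsub>D\<^esub> s b = s (a \<otimes>\<^bsub>C\<^esub> b)"
      "s c \<oslash>\<^bsub>D\<^esub> s b = s (c \<oslash>\<^bsub>C\<^esub> b)"
      using abc by (simp_all add: D_def qs)
    show "(y \<preceq>\<^bsub>D\<^esub> x \<setminus>\<^bsub>D\<^esub> z) = (x \<otimes>\<^bsub>D\<^esub> y \<preceq>\<^bsub>D\<^esub> z)"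
      unfolding eq ops using abc by (simp add: le cl C.ldiv_residual)
    show "(x \<otimes>\<^bsub>D\<^esub> y \<preceq>\<^bsub>D\<^esub> z) = (x \<preceq>\<^bsub>D\<^esub> z \<oslash>\<^bsub>D\<^esub> y)"
      unfolding eq ops using abc by (simp add: le cl C.rdiv_residual)
  qed (auto simp: D_def qs cl C.m_assoc C.meet_assoc C.join_assoc
         C.meet_join_absorb C.join_meet_absorb
         intro!: arg_cong[of _ _ s] intro: C.meet_comm C.join_comm)
  moreover have "x \<preceq>\<^bsub>D\<^esub> y \<or> y \<preceq>\<^bsub>D\<^esub> x" if xy: "x \<in> carrier D" "y \<in> carrier D" for x y
  proof -
    obtain a b where "a \<in> carrier C" "b \<in> carrier C" "x = s a" "y = s b"
      using xy by (auto simp: D_def)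
    then show ?thesis using C le by (auto simp: totally_ordered_rl_def)
  qed
  ultimately show ?thesis by (simp add: totally_ordered_rl_def)
qed

lemma semilinear_rlI:
  fixes A :: "'u reslat" and I :: "'i set" and F :: "'i \<Rightarrow> 'a reslat"
  assumes A: "residuated_lattice A"
    and chains: "\<And>i. i \<in> I \<Longrightarrow> totally_ordered_rl (F i)"
    and e: "subdirect_emb A I F e"
  shows "semilinear_rl A"
proof -
  interpret A: residuated_lattice A by (rule A)
  define J where "J = {(x, y). x \<in> carrier A \<and> y \<in> carrier A \<and> x \<noteq> y}"
  have eh: "e \<in> hom_rl A (product_rl I F)" and inj: "inj_on e (carrier A)"
    and onto: "\<And>i. i \<in> I \<Longrightarrow> (\<lambda>x. e x i) ` carrier A = carrier (F i)"
    using e by (auto simp: subdirect_emb_def emb_rl_def)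
  have PiE: "e x \<in> (\<Pi>\<^sub>E i \<in> I. carrier (F i))" if "x \<in> carrier A" for x
    using eh that by (auto simp: hom_rl_def hom_def product_rl_def)
  have "\<forall>p \<in> J. \<exists>i \<in> I. e (fst p) i \<noteq> e (snd p) i"
  proof
    fix p assume "p \<in> J"
    then have p: "fst p \<in> carrier A" "snd p \<in> carrier A" "fst p \<noteq> snd p" by (auto simp: J_def)
    show "\<exists>i \<in> I. e (fst p) i \<noteq> e (snd p) i"
      using PiE_ext[OF PiE[OF p(1)] PiE[OF p(2)]] inj p by (meson inj_onD)
  qed
  then obtain k where k: "\<And>p. p \<in> J \<Longrightarrow> k p \<in> I"
    "\<And>p. p \<in> J \<Longrightarrow> e (fst p) (k p) \<noteq> e (snd p) (k p)" by metis
  define q where "q p = (\<lambda>x. e x (k p))" for p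
  define s where "s p = inv_into (carrier A) (q p)" for p
  have q_onto: "q p ` carrier A = carrier (F (k p))" if "p \<in> J" for p
    unfolding q_def using onto k(1) that by auto
  have qs: "q p (s p b) = b" if "p \<in> J" "b \<in> carrier (F (k p))" for p b
    unfolding s_def using that by (simp add: f_inv_into_f q_onto)
  define G where "G p = (let C = F (k p); s = s p; q = q p in
    \<lparr>carrier = s ` carrier C,
     monoid.mult = (\<lambda>x y. s (q x \<otimes>\<^bsub>C\<^esub> q y)), one = s \<one>\<^bsub>C\<^esub>,
     meet_rl = (\<lambda>x y. s (q x \<curlywedge>\<^bsub>C\<^esub> q y)), join_rl = (\<lambda>x y. s (q x \<curlyvee>\<^bsub>C\<^esub> q y)),
     ldiv = (\<lambda>x y. s (q x \<setminus>\<^bsub>C\<^esub> q y)), rdiv = (\<lambda>x y. s (q x \<oslash>\<^bsub>C\<^esub> q y))\<rparr>)" for p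
  have G: "totally_ordered_rl (G p)" if "p \<in> J" for p
    unfolding G_def Let_def by (rule totally_ordered_rl_transport) (use chains k qs that in auto)
  define d where "d x = (\<lambda>p \<in> J. s p (q p x))" for x
  have q_cl: "q p x \<in> carrier (F (k p))" if "p \<in> J" "x \<in> carrier A" for p x
    using q_onto that by blast
  have q_hom: "q p (x \<otimes>\<^bsub>A\<^esub> y) = q p x \<otimes>\<^bsub>F (k p)\<^esub> q p y"
      "q p (x \<curlywedge>\<^bsub>A\<^esub> y) = q p x \<curlywedge>\<^bsub>F (k p)\<^esub> q p y"
      "q p (x \<curlyvee>\<^bsub>A\<^esub> y) = q p x \<curlyvee>\<^bsub>F (k p)\<^esub> q p y"
      "q p (x \<setminus>\<^bsub>A\<^esub> y) = q p x \<setminus>\<^bsub>F (k p)\<^esub> q p y"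
      "q p (x \<oslash>\<^bsub>A\<^esub> y) = q p x \<oslash>\<^bsub>F (k p)\<^esub> q p y"
      if "p \<in> J" "x \<in> carrier A" "y \<in> carrier A" for p x y
    using eh that k(1) by (auto simp: q_def hom_rl_def hom_def product_rl_def)
  have q_one: "q p \<one>\<^bsub>A\<^esub> = \<one>\<^bsub>F (k p)\<^esub>" if "p \<in> J" for p
    using eh that k(1) by (auto simp: q_def hom_rl_def product_rl_def)
  have "d \<in> hom_rl A (product_rl J G)"
    by (auto simp: hom_rl_def hom_def product_rl_def d_def G_def Let_def q_cl q_hom q_one qs
        intro!: restrict_ext)
  moreover have "inj_on d (carrier A)"
  proof (rule inj_onI, rule ccontr)
    fix x y assume xy: "x \<in> carrier A" "y \<in> carrier A" "d x = d y" "x \<noteq> y"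
    then have J: "(x, y) \<in> J" by (simp add: J_def)
    then have "s (x, y) (q (x, y) x) = s (x, y) (q (x, y) y)"
      using fun_cong[OF xy(3), of "(x, y)"] by (simp add: d_def)
    then have "q (x, y) x = q (x, y) y" using qs q_cl J xy by metis
    then show False using k(2)[OF J] by (simp add: q_def)
  qed
  moreover have "(\<lambda>x. d x p) ` carrier A = carrier (G p)" if "p \<in> J" for p
    using that by (simp add: d_def G_def Let_def q_onto[symmetric] image_image)
  ultimately have "subdirect_emb A J G d" by (simp add: subdirect_emb_def emb_rl_def)
  with A G show ?thesis unfolding semilinear_rl_def by blast
qed

end

(* A star-involutive idempotent residuated chain is determined by its order, its unit and the two
   negations 1/x and x \ 1: the product of x and y is their minimum if it is at most 1 and their
   maximum otherwise, and 1/x and x \ 1 differ by at most one cover. Two such chains over a common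
   subchain A are amalgamated by interleaving them inside each cut of A, in one order above 1 and in
   the opposite order below 1, keeping the negations.

   Quotients of a semilinear algebra that are chains correspond to prime filters of the negative
   cone closed under the unary term delta x = (1/x v x \ 1)*. Closure under this single term makes a
   filter normal, so the filter generated in B by a filter of a subalgebra A induces on A the filter
   one started with, and every prime filter of A lies under prime filters of B and of C. Amalgamating
   the quotients B/P and C/Q for all pairs (P, Q) with the same restriction to A embeds B and C
   jointly in a product of chains.

   The amalgam is strong: if b and c are identified for all pairs, then by a Zorn argument b agrees
   with one of finitely many elements of A in each coordinate, and two of these elements a1, a2 can be
   patched to the single element p a1 v q a2 of A, where p, q are negative elements of A that equal 1
   wherever b = a1, respectively b = a2, and whose meet is below the equivalence of a1 and a2.
   The ES property follows by amalgamating two copies of B over the image of an epimorphism. *)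
theory Submission
  imports Defs
begin

section \<open>Skeletons of star-involutive chains\<close>

text \<open>Star-involution is what keeps the two chains apart. Up to equivalence every element is a
  negation of each of its negations (\<open>recover_from_r\<close> and its mirror image), so an
  element outside A has both negations outside A. As negation swaps the sides of 1 and reverses the
  order, the interleaving above 1 dictates the opposite one below. An element of C strictly between
  the two negations of such a b would have to follow one and precede the other inside one gap of A,
  which the fixed order forbids. Case distinctions of chains do not survive subdirect products. They
  are encoded as identities: joins equal to 1 in the negative cone, which a prime filter splits into
  two cases, and inequalities between terms in \<open>imp_rl\<close> and \<open>delta_rl\<close>,
  all checked coordinatewise. For strongness, the obstacle is that the element of A agreeing with b
  varies with the coordinate. Here c is the link: distinct primes of B over one prime of A can be
  paired with the same prime of C, so the local choices for b are all compared through c.\<close>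

text \<open>Here \<open>l x\<close> and \<open>r x\<close> stand for \<open>1/x\<close> and \<open>x \ 1\<close>. The cover axioms say that nothing lies strictly
  between them. The order is only assumed to be a total preorder, so that the quotient by a prime
  filter need not be formed before amalgamating.\<close>

locale preskeleton =
  fixes X :: "'a set" and leq :: "'a \<Rightarrow> 'a \<Rightarrow> bool" and e :: 'a and l r :: "'a \<Rightarrow> 'a"
  assumes total: "\<lbrakk>x \<in> X; y \<in> X\<rbrakk> \<Longrightarrow> leq x y \<or> leq y x"
    and trans: "\<lbrakk>x \<in> X; y \<in> X; z \<in> X; leq x y; leq y z\<rbrakk> \<Longrightarrow> leq x z"
    and e_closed: "e \<in> X"
    and l_closed: "x \<in> X \<Longrightarrow> l x \<in> X"
    and r_closed: "x \<in> X \<Longrightarrow> r x \<in> X"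
    and galois: "\<lbrakk>x \<in> X; y \<in> X\<rbrakk> \<Longrightarrow> leq x (l y) \<longleftrightarrow> leq y (r x)"
    and unit_l: "leq e (l e)" "leq (l e) e"
    and unit_r: "leq e (r e)" "leq (r e) e"
    and cover_l: "\<lbrakk>x \<in> X; y \<in> X\<rbrakk> \<Longrightarrow> leq y (r x) \<or> leq (l x) y"
    and cover_r: "\<lbrakk>x \<in> X; y \<in> X\<rbrakk> \<Longrightarrow> leq y (l x) \<or> leq (r x) y"
    and star_star: "\<lbrakk>x \<in> X; st = (\<lambda>u. if leq (l u) (r u) then l u else r u)\<rbrakk>
      \<Longrightarrow> leq (st (st x)) x \<and> leq x (st (st x))"
begin

lemma refl: "x \<in> X \<Longrightarrow> leq x x"
  using total by blast

lemma le_l_r: "x \<in> X \<Longrightarrow> leq x (l (r x))"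
  using galois[of x "r x"] r_closed refl by simp

lemma le_r_l: "x \<in> X \<Longrightarrow> leq x (r (l x))"
  using galois[of "l x" x] l_closed refl by simp

lemma l_antimono: "\<lbrakk>x \<in> X; y \<in> X; leq x y\<rbrakk> \<Longrightarrow> leq (l y) (l x)"
  using galois[of "l y" x] trans[of x y "r (l y)"] le_r_l[of y] l_closed r_closed by simp

lemma r_antimono: "\<lbrakk>x \<in> X; y \<in> X; leq x y\<rbrakk> \<Longrightarrow> leq (r y) (r x)"
  using galois[of x "r y"] trans[of x y "l (r y)"] le_l_r[of y] l_closed r_closed by simp

lemma le_e_iff_l: "x \<in> X \<Longrightarrow> leq x e \<longleftrightarrow> leq e (r x)"
  using galois[of x e] trans[of x e "l e"] trans[of x "l e" e] unit_l e_closed l_closed by blast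

lemma le_e_iff_r: "x \<in> X \<Longrightarrow> leq x e \<longleftrightarrow> leq e (l x)"
  using galois[of e x] trans[of x e "r e"] trans[of x "r e" e] unit_r e_closed r_closed by blast

lemma e_le_l: "\<lbrakk>x \<in> X; leq e x\<rbrakk> \<Longrightarrow> leq (l x) e"
  using trans[of "l x" "l e" e] l_antimono[of e x] unit_l e_closed l_closed by blast

lemma e_le_r: "\<lbrakk>x \<in> X; leq e x\<rbrakk> \<Longrightarrow> leq (r x) e"
  using trans[of "r x" "r e" e] r_antimono[of e x] unit_r e_closed r_closed by blast

text \<open>In a preorder the minimum of the two negations is determined only up to equivalence. Any
  choice \<open>s\<close> is equivalent to the one in the axiom, and since the latter is antitone
  the double applications are equivalent too. This carries the star axiom to the mirrored skeleton
  and to the quotient.\<close>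

lemma star_star_of_min:
  assumes s: "\<And>u. u \<in> X \<Longrightarrow> s u \<in> X" "\<And>u. u \<in> X \<Longrightarrow> leq (s u) (l u)" "\<And>u. u \<in> X \<Longrightarrow> leq (s u) (r u)"
      "\<And>u. u \<in> X \<Longrightarrow> leq (l u) (s u) \<or> leq (r u) (s u)"
    and x: "x \<in> X"
  shows "leq (s (s x)) x \<and> leq x (s (s x))"
proof -
  define st where "st u = (if leq (l u) (r u) then l u else r u)" for u
  have st_cl: "st u \<in> X" if "u \<in> X" for u using that l_closed r_closed by (simp add: st_def)
  have st_min: "leq (st u) (l u)" "leq (st u) (r u)" if "u \<in> X" for u
    using that total[of "l u" "r u"] l_closed r_closed refl by (auto simp: st_def)
  have eq: "leq (st u) (s u)" "leq (s u) (st u)" if "u \<in> X" for u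
  proof -
    show "leq (st u) (s u)"
      using that s(4)[OF that] st_min[OF that] st_cl[OF that] s(1)[OF that] l_closed r_closed
        trans[of "st u" "l u" "s u"] trans[of "st u" "r u" "s u"] by auto
    show "leq (s u) (st u)" using s(2,3) that by (simp add: st_def)
  qed
  have mono: "leq (st v) (st u)" if "u \<in> X" "v \<in> X" "leq u v" for u v
    using that trans[of "st v" "l v" "l u"] trans[of "st v" "r v" "r u"] st_cl l_closed r_closed
      st_min l_antimono r_antimono by (auto simp: st_def[of u])
  have "leq (s (s x)) (st (st x)) \<and> leq (st (st x)) (s (s x))"
    using x st_cl s(1) eq mono[of "s x" "st x"] mono[of "st x" "s x"] eq[of "s x"]
      trans[of "s (s x)" "st (s x)" "st (st x)"] trans[of "st (st x)" "st (s x)" "s (s x)"]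
    by simp
  moreover have "leq (st (st x)) x \<and> leq x (st (st x))"
    using star_star[OF x] unfolding st_def[abs_def] by blast
  ultimately show ?thesis
    using x st_cl s(1) trans[of "s (s x)" "st (st x)" x] trans[of x "st (st x)" "s (s x)"]
    by simp
qed

text \<open>Left-right symmetry, used to obtain each fact about \<open>l\<close> from the one about
  \<open>r\<close>. The axioms come in mirrored pairs, except that the star axiom breaks ties in
  favour of \<open>l\<close>.\<close>

lemma swapped: "preskeleton X leq e r l"
proof
  fix x and st :: "'a \<Rightarrow> 'a"
  assume x: "x \<in> X" and st: "st = (\<lambda>u. if leq (r u) (l u) then r u else l u)"
  show "leq (st (st x)) x \<and> leq x (st (st x))"
    by (rule star_star_of_min[OF _ _ _ _ x])
      (use total l_closed r_closed refl in \<open>auto simp: st\<close>)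
next
  show "\<And>x y z. \<lbrakk>x \<in> X; y \<in> X; z \<in> X; leq x y; leq y z\<rbrakk> \<Longrightarrow> leq x z"
    by (rule trans)
  show "\<And>x y. \<lbrakk>x \<in> X; y \<in> X\<rbrakk> \<Longrightarrow> leq y (l x) \<or> leq (r x) y" by (rule cover_r)
  show "\<And>x y. \<lbrakk>x \<in> X; y \<in> X\<rbrakk> \<Longrightarrow> leq y (r x) \<or> leq (l x) y" by (rule cover_l)
qed (simp_all add: total e_closed l_closed r_closed galois unit_l unit_r)

text \<open>If \<open>r x\<close> is the smaller negation, it is the star of \<open>x\<close> and
  star-involution recovers \<open>x\<close> from it. Otherwise the cover axiom takes over.
  Consequently \<open>x\<close> belongs to every subskeleton containing \<open>r x\<close>.\<close>

lemma recover_from_r: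
  assumes x: "x \<in> X"
  shows "(leq (l (r x)) x \<and> leq x (l (r x))) \<or> (leq (r (r x)) x \<and> leq x (r (r x)))"
proof (cases "leq (r x) (l x)")
  case True
  define st where "st u = (if leq (l u) (r u) then l u else r u)" for u
  have st: "leq (st (st x)) x \<and> leq x (st (st x))"
    using star_star[OF x] unfolding st_def[abs_def] by blast
  show ?thesis
  proof (cases "leq (l x) (r x)")
    case lr: True
    have "leq (l (r x)) (l (l x))" "leq (l (l x)) (l (r x))" "leq (r (r x)) (r (l x))" "leq (r (l x)) (r (r x))"
      using True lr x l_closed r_closed l_antimono r_antimono by blast+
    moreover have "st (st x) = l (l x) \<or> st (st x) = r (l x)"
      using lr by (auto simp: st_def)
    moreover note cl = x l_closed[OF l_closed[OF x]] r_closed[OF l_closed[OF x]]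
      l_closed[OF r_closed[OF x]] r_closed[OF r_closed[OF x]]
    ultimately show ?thesis
      using st trans[of "l (r x)" "l (l x)" x] trans[of x "l (l x)" "l (r x)"]
        trans[of "r (r x)" "r (l x)" x] trans[of x "r (l x)" "r (r x)"]
      by (elim disjE) simp_all
  next
    case False
    then have "st (st x) = l (r x) \<or> st (st x) = r (r x)" by (auto simp: st_def)
    then show ?thesis using st by metis
  qed
next
  \<comment> \<open>Now \<open>l x\<close> is strictly below \<open>r x\<close>, so the star of
    \<open>x\<close> says nothing about \<open>r x\<close>. The cover axiom at \<open>r x\<close> is
    used instead; its other alternative is excluded by \<open>galois\<close>.\<close>
  case False
  have "leq x (l (r x))" using x r_closed galois refl by blast
  moreover have "\<not> leq x (r (r x))" using False x r_closed galois by blast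
  then have "leq (l (r x)) x" using cover_l[of "r x" x] x r_closed by blast
  ultimately show ?thesis by blast
qed

lemma recover_equiv:
  assumes b: "b \<in> X" and p: "p \<in> X" "leq (r b) p" "leq p (r b)"
  shows "leq b (l p) \<and> leq (l p) b \<or> leq b (r p) \<and> leq (r p) b"
proof -
  note cl = b p(1) r_closed[OF b]
  have "leq (l p) (l (r b))" "leq (l (r b)) (l p)" "leq (r p) (r (r b))" "leq (r (r b)) (r p)"
    using p cl l_antimono r_antimono by auto
  then show ?thesis
    using recover_from_r[OF b] cl l_closed r_closed
      trans[of b "l (r b)" "l p"] trans[of "l p" "l (r b)" b]
      trans[of b "r (r b)" "r p"] trans[of "r p" "r (r b)" b]
    by auto
qed

end

locale skeleton = preskeleton +
  assumes antisym: "\<lbrakk>x \<in> X; y \<in> X; leq x y; leq y x\<rbrakk> \<Longrightarrow> x = y"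

text \<open>The formulas are forced: \<open>mult_eq\<close>, \<open>ldiv_eq\<close> and
  \<open>rdiv_eq\<close> hold in every star-involutive chain. The test \<open>leq x (l y)\<close>
  expresses that the product of \<open>x\<close> and \<open>y\<close> is at most 1.\<close>

definition chain_rl :: "'a set \<Rightarrow> ('a \<Rightarrow> 'a \<Rightarrow> bool) \<Rightarrow> 'a \<Rightarrow> ('a \<Rightarrow> 'a) \<Rightarrow> ('a \<Rightarrow> 'a) \<Rightarrow> 'a reslat"
  where "chain_rl X leq e l r =
    (let mn = (\<lambda>x y. if leq x y then x else y); mx = (\<lambda>x y. if leq x y then y else x) in
    \<lparr>carrier = X,
     monoid.mult = (\<lambda>x y. if leq x (l y) then mn x y else mx x y),
     one = e, meet_rl = mn, join_rl = mx,
     ldiv = (\<lambda>x z. if leq x z then mx (r x) z else mn (r x) z),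
     rdiv = (\<lambda>z y. if leq y z then mx (l y) z else mn (l y) z)\<rparr>)"

definition star_chain :: "('a, 'b) reslat_scheme \<Rightarrow> bool"
  where "star_chain L \<longleftrightarrow> totally_ordered_rl L \<and> idempotent_rl L \<and>
    (\<forall>x \<in> carrier L. star_rl L (star_rl L x) = x)"

text \<open>\<open>N x y\<close> stands for "the product is at most 1". Factors on the same side of
  \<open>e\<close> multiply by minimum or maximum, factors on opposite sides by absorption.
  Monotonicity of \<open>N\<close> and the order axioms settle six of the eight sign patterns. When
  only the middle factor has the other sign, the outer two might behave differently towards it from
  the left and from the right; \<open>u1\<close> and \<open>u2\<close> exclude that two distinct
  elements do so in the same way.\<close>

lemma conservative_assoc:
  fixes leq N :: "'a \<Rightarrow> 'a \<Rightarrow> bool"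
  assumes total: "\<And>x y. x \<in> S \<Longrightarrow> y \<in> S \<Longrightarrow> leq x y \<or> leq y x"
    and trans: "\<And>x y z. x \<in> S \<Longrightarrow> y \<in> S \<Longrightarrow> z \<in> S \<Longrightarrow> leq x y \<Longrightarrow> leq y z \<Longrightarrow> leq x z"
    and antisym: "\<And>x y. x \<in> S \<Longrightarrow> y \<in> S \<Longrightarrow> leq x y \<Longrightarrow> leq y x \<Longrightarrow> x = y"
    and e: "e \<in> S" "\<And>x. x \<in> S \<Longrightarrow> N x e \<longleftrightarrow> leq x e" "\<And>x. x \<in> S \<Longrightarrow> N e x \<longleftrightarrow> leq x e"
    and N1: "\<And>x y z. x \<in> S \<Longrightarrow> y \<in> S \<Longrightarrow> z \<in> S \<Longrightarrow> leq x y \<Longrightarrow> N y z \<Longrightarrow> N x z"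
    and N2: "\<And>x y z. x \<in> S \<Longrightarrow> y \<in> S \<Longrightarrow> z \<in> S \<Longrightarrow> leq x y \<Longrightarrow> N z y \<Longrightarrow> N z x"
    and u1: "\<And>x y z. x \<in> S \<Longrightarrow> y \<in> S \<Longrightarrow> z \<in> S \<Longrightarrow> N y x \<Longrightarrow> \<not> N x y \<Longrightarrow> N z x \<Longrightarrow> \<not> N x z \<Longrightarrow> y = z"
    and u2: "\<And>x y z. x \<in> S \<Longrightarrow> y \<in> S \<Longrightarrow> z \<in> S \<Longrightarrow> N x y \<Longrightarrow> \<not> N y x \<Longrightarrow> N x z \<Longrightarrow> \<not> N z x \<Longrightarrow> y = z"
    and xyz: "x \<in> S" "y \<in> S" "z \<in> S"
  defines "m \<equiv> \<lambda>x y. if N x y then if leq x y then x else y else if leq x y then y else x"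
  shows "m (m x y) z = m x (m y z)"
proof -
  have nn: "m u v = (if leq u v then u else v)" if "u \<in> S" "v \<in> S" "leq u e" "leq v e" for u v
    using N1[of u e v] e that by (simp add: m_def)
  have pp: "m u v = (if leq u v then v else u)" if "u \<in> S" "v \<in> S" "leq e u" "leq e v" for u v
    using N1[of e u v] N2[of e v u] e that antisym[of u v] antisym[of u e] antisym[of v e]
    by (auto simp: m_def)
  have np: "m u v = (if N u v then u else v)" if "u \<in> S" "v \<in> S" "leq u e" "leq e v" for u v
    using trans[of u e v] antisym[of u v] e that by (auto simp: m_def)
  have pn: "m v u = (if N v u then u else v)" if "u \<in> S" "v \<in> S" "leq u e" "leq e v" for u v
    using trans[of u e v] antisym[of u v] e that by (auto simp: m_def)
  consider "leq x e" "leq y e" "leq z e" | "leq x e" "leq y e" "leq e z" | "leq x e" "leq e y" "leq z e"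
    | "leq x e" "leq e y" "leq e z" | "leq e x" "leq y e" "leq z e" | "leq e x" "leq y e" "leq e z"
    | "leq e x" "leq e y" "leq z e" | "leq e x" "leq e y" "leq e z"
    using total e xyz by metis
  then show ?thesis
  proof cases
    case 1
    then show ?thesis
      using xyz nn[of x y] nn[of y z] nn[of x z] total[of x y] total[of y z] total[of x z] antisym[of x y] antisym[of y z] antisym[of x z]
      trans[of x y z] trans[of z y x] trans[of y x z] trans[of x z y] trans[of y z x] trans[of z x y]
      by (smt (verit))
  next
    case 2
    then show ?thesis
      using xyz nn[of x y] np[of x z] np[of y z] total[of x y] N1[of x y z] N1[of y x z]
      by (smt (verit))
  next
    case 3
    then show ?thesis
      using xyz np[of x y] pn[of z y] nn[of x z] total[of x z] N1[of x z y] N1[of z x y] N2[of x z y] N2[of z x y]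
      u1[of y x z] u2[of y x z] antisym[of x z]
      by (smt (verit))
  next
    case 4
    then show ?thesis
      using xyz np[of x y] np[of x z] pp[of y z] total[of y z] N2[of y z x] N2[of z y x]
      by (smt (verit))
  next
    case 5
    then show ?thesis
      using xyz pn[of y x] pn[of z x] nn[of y z] total[of y z] N2[of y z x] N2[of z y x]
      by (smt (verit))
  next
    case 6
    then show ?thesis
      using xyz pn[of y x] np[of y z] pp[of x z] total[of x z] N1[of x z y] N1[of z x y] N2[of x z y] N2[of z x y]
      u1[of y x z] u2[of y x z] antisym[of x z]
      by (smt (verit))
  next
    case 7
    then show ?thesis
      using xyz pp[of x y] pn[of z x] pn[of z y] total[of x y] N1[of x y z] N1[of y x z]
      by (smt (verit))
  next
    case 8
    then show ?thesis
      using xyz pp[of x y] pp[of y z] pp[of x z] total[of x y] total[of y z] total[of x z] antisym[of x y] antisym[of y z] antisym[of x z]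
      trans[of x y z] trans[of z y x] trans[of y x z] trans[of x z y] trans[of y z x] trans[of z x y]
      by (smt (verit))
  qed
qed

section \<open>Residuated lattices and star-involutive chains\<close>

text \<open>The opposite algebra interchanges the two residuals and the two negations, so
  \<open>cover_r\<close> and \<open>rdiv_eq\<close> are read off from \<open>cover_l\<close> and
  \<open>ldiv_eq\<close>.\<close>

definition op_rl :: "('a, 'b) reslat_scheme \<Rightarrow> 'a reslat"
  where "op_rl L = \<lparr>carrier = carrier L, monoid.mult = (\<lambda>x y. y \<otimes>\<^bsub>L\<^esub> x), one = \<one>\<^bsub>L\<^esub>,
    meet_rl = meet_rl L, join_rl = join_rl L, ldiv = (\<lambda>x y. y \<oslash>\<^bsub>L\<^esub> x), rdiv = (\<lambda>x y. y \<setminus>\<^bsub>L\<^esub> x)\<rparr>"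

lemma op_rl_simps:
  "carrier (op_rl L) = carrier L" "\<one>\<^bsub>op_rl L\<^esub> = \<one>\<^bsub>L\<^esub>" "x \<otimes>\<^bsub>op_rl L\<^esub> y = y \<otimes>\<^bsub>L\<^esub> x"
  "x \<curlywedge>\<^bsub>op_rl L\<^esub> y = x \<curlywedge>\<^bsub>L\<^esub> y" "x \<curlyvee>\<^bsub>op_rl L\<^esub> y = x \<curlyvee>\<^bsub>L\<^esub> y"
  "x \<setminus>\<^bsub>op_rl L\<^esub> y = y \<oslash>\<^bsub>L\<^esub> x" "y \<oslash>\<^bsub>op_rl L\<^esub> x = x \<setminus>\<^bsub>L\<^esub> y"
  "x \<preceq>\<^bsub>op_rl L\<^esub> y \<longleftrightarrow> x \<preceq>\<^bsub>L\<^esub> y" "lneg_rl (op_rl L) x = rneg_rl L x" "rneg_rl (op_rl L) x = lneg_rl L x"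
  by (simp_all add: op_rl_def le_rl_def lneg_rl_def rneg_rl_def)

section \<open>Order calculus in residuated lattices\<close>

context residuated_lattice
begin

lemma meet_idem: "x \<in> carrier L \<Longrightarrow> x \<curlywedge> x = x"
  using meet_join_absorb[of x "x \<curlywedge> x"] join_meet_absorb[of x x] meet_closed by simp

lemma le_refl: "x \<in> carrier L \<Longrightarrow> x \<preceq> x"
  by (simp add: le_rl_def meet_idem)

lemma le_antisym: "\<lbrakk>x \<in> carrier L; y \<in> carrier L; x \<preceq> y; y \<preceq> x\<rbrakk> \<Longrightarrow> x = y"
  using meet_comm[of x y] by (simp add: le_rl_def)

lemma le_trans: "\<lbrakk>x \<in> carrier L; y \<in> carrier L; z \<in> carrier L; x \<preceq> y; y \<preceq> z\<rbrakk> \<Longrightarrow> x \<preceq> z"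
  using meet_assoc[of x y z] by (simp add: le_rl_def)

lemma le_iff_join: "\<lbrakk>x \<in> carrier L; y \<in> carrier L\<rbrakk> \<Longrightarrow> x \<preceq> y \<longleftrightarrow> x \<curlyvee> y = y"
  using meet_join_absorb[of x y] join_meet_absorb[of y x] join_comm[of x y] meet_comm[of x y]
  by (auto simp: le_rl_def)

lemma meet_le1: "\<lbrakk>x \<in> carrier L; y \<in> carrier L\<rbrakk> \<Longrightarrow> x \<curlywedge> y \<preceq> x"
  using meet_assoc[of x x y] meet_comm[of "x \<curlywedge> y" x] meet_closed by (simp add: le_rl_def meet_idem)

lemma meet_le2: "\<lbrakk>x \<in> carrier L; y \<in> carrier L\<rbrakk> \<Longrightarrow> x \<curlywedge> y \<preceq> y"
  using meet_le1[of y x] meet_comm[of x y] by simp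

lemma le_meet: "\<lbrakk>x \<in> carrier L; y \<in> carrier L; z \<in> carrier L; z \<preceq> x; z \<preceq> y\<rbrakk> \<Longrightarrow> z \<preceq> x \<curlywedge> y"
  using meet_assoc[of z x y] by (simp add: le_rl_def)

lemma le_join1: "\<lbrakk>x \<in> carrier L; y \<in> carrier L\<rbrakk> \<Longrightarrow> x \<preceq> x \<curlyvee> y"
  by (simp add: le_rl_def meet_join_absorb)

lemma le_join2: "\<lbrakk>x \<in> carrier L; y \<in> carrier L\<rbrakk> \<Longrightarrow> y \<preceq> x \<curlyvee> y"
  using le_join1[of y x] join_comm[of x y] by simp

lemma join_le: "\<lbrakk>x \<in> carrier L; y \<in> carrier L; z \<in> carrier L; x \<preceq> z; y \<preceq> z\<rbrakk> \<Longrightarrow> x \<curlyvee> y \<preceq> z"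
  using join_assoc[of x y z] by (simp add: le_iff_join join_closed)

lemma le_meet_iff:
  "\<lbrakk>x \<in> carrier L; y \<in> carrier L; z \<in> carrier L\<rbrakk> \<Longrightarrow> z \<preceq> x \<curlywedge> y \<longleftrightarrow> z \<preceq> x \<and> z \<preceq> y"
  using le_meet[of x y z] le_trans[of z "x \<curlywedge> y" x] le_trans[of z "x \<curlywedge> y" y]
    meet_le1[of x y] meet_le2[of x y] meet_closed[of x y]
  by auto

lemma join_le_iff:
  "\<lbrakk>x \<in> carrier L; y \<in> carrier L; z \<in> carrier L\<rbrakk> \<Longrightarrow> x \<curlyvee> y \<preceq> z \<longleftrightarrow> x \<preceq> z \<and> y \<preceq> z"
  using join_le[of x y z] le_trans[of x "x \<curlyvee> y" z] le_trans[of y "x \<curlyvee> y" z]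
    le_join1[of x y] le_join2[of x y] join_closed[of x y]
  by auto

lemma le_absorb:
  assumes "x \<in> carrier L" "y \<in> carrier L" "x \<preceq> y"
  shows "x \<curlywedge> y = x" "y \<curlywedge> x = x" "x \<curlyvee> y = y" "y \<curlyvee> x = y"
  using assms le_iff_join[of x y] meet_comm[of x y] join_comm[of x y] by (simp_all add: le_rl_def)

lemma meet_mono: "\<lbrakk>x \<in> carrier L; y \<in> carrier L; x' \<in> carrier L; y' \<in> carrier L; x \<preceq> x'; y \<preceq> y'\<rbrakk>
    \<Longrightarrow> x \<curlywedge> y \<preceq> x' \<curlywedge> y'"
  using le_trans[of "x \<curlywedge> y" x x'] le_trans[of "x \<curlywedge> y" y y'] meet_le1[of x y] meet_le2[of x y]
    meet_closed[of x y]
  by (simp add: le_meet_iff)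

lemma join_mono: "\<lbrakk>x \<in> carrier L; y \<in> carrier L; x' \<in> carrier L; y' \<in> carrier L; x \<preceq> x'; y \<preceq> y'\<rbrakk>
    \<Longrightarrow> x \<curlyvee> y \<preceq> x' \<curlyvee> y'"
  using le_trans[of x x' "x' \<curlyvee> y'"] le_trans[of y y' "x' \<curlyvee> y'"] le_join1[of x' y'] le_join2[of x' y']
    join_closed[of x' y']
  by (simp add: join_le_iff)

lemma mult_mono_left:
  assumes "x \<in> carrier L" "y \<in> carrier L" "z \<in> carrier L" "x \<preceq> y"
  shows "x \<otimes> z \<preceq> y \<otimes> z"
proof -
  have "y \<preceq> (y \<otimes> z) \<oslash> z" using rdiv_residual[of y z "y \<otimes> z"] assms le_refl by simp
  then have "x \<preceq> (y \<otimes> z) \<oslash> z" using le_trans[of x y] assms rdiv_closed by simp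
  then show ?thesis using rdiv_residual[of x z "y \<otimes> z"] assms by simp
qed

lemma mult_mono_right:
  assumes "x \<in> carrier L" "y \<in> carrier L" "z \<in> carrier L" "x \<preceq> y"
  shows "z \<otimes> x \<preceq> z \<otimes> y"
proof -
  have "y \<preceq> z \<setminus> (z \<otimes> y)" using ldiv_residual[of z y "z \<otimes> y"] assms le_refl by simp
  then have "x \<preceq> z \<setminus> (z \<otimes> y)" using le_trans[of x y] assms ldiv_closed by simp
  then show ?thesis using ldiv_residual[of z x "z \<otimes> y"] assms by simp
qed

text \<open>Reduces an identity for residuals to a comparison of lower sets, where residuation
  applies.\<close>

lemma eq_iff_lower:
  assumes "x \<in> carrier L" "y \<in> carrier L" "\<And>z. z \<in> carrier L \<Longrightarrow> z \<preceq> x \<longleftrightarrow> z \<preceq> y"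
  shows "x = y"
  using assms(1,2) assms(3)[of x] assms(3)[of y] le_antisym[of x y] le_refl[of x] le_refl[of y] by simp

lemma lneg_closed: "x \<in> carrier L \<Longrightarrow> lneg_rl L x \<in> carrier L"
  by (simp add: lneg_rl_def rdiv_closed)

lemma rneg_closed: "x \<in> carrier L \<Longrightarrow> rneg_rl L x \<in> carrier L"
  by (simp add: rneg_rl_def ldiv_closed)

lemma star_closed: "x \<in> carrier L \<Longrightarrow> star_rl L x \<in> carrier L"
  by (simp add: star_rl_def lneg_closed rneg_closed meet_closed)

lemma le_lneg: "\<lbrakk>x \<in> carrier L; y \<in> carrier L\<rbrakk> \<Longrightarrow> x \<preceq> lneg_rl L y \<longleftrightarrow> x \<otimes> y \<preceq> \<one>"
  by (simp add: lneg_rl_def rdiv_residual)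

lemma le_rneg: "\<lbrakk>x \<in> carrier L; y \<in> carrier L\<rbrakk> \<Longrightarrow> y \<preceq> rneg_rl L x \<longleftrightarrow> x \<otimes> y \<preceq> \<one>"
  by (simp add: rneg_rl_def ldiv_residual)

lemma lneg_one: "lneg_rl L \<one> = \<one>"
  by (rule eq_iff_lower) (simp_all add: lneg_closed le_lneg)

lemma rneg_one: "rneg_rl L \<one> = \<one>"
  by (rule eq_iff_lower) (simp_all add: rneg_closed le_rneg)

lemma op_residuated: "residuated_lattice (op_rl L)"
proof
  show "(y \<preceq>\<^bsub>op_rl L\<^esub> x \<setminus>\<^bsub>op_rl L\<^esub> z) = (x \<otimes>\<^bsub>op_rl L\<^esub> y \<preceq>\<^bsub>op_rl L\<^esub> z)"
    "(x \<otimes>\<^bsub>op_rl L\<^esub> y \<preceq>\<^bsub>op_rl L\<^esub> z) = (x \<preceq>\<^bsub>op_rl L\<^esub> z \<oslash>\<^bsub>op_rl L\<^esub> y)"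
    if "x \<in> carrier (op_rl L)" "y \<in> carrier (op_rl L)" "z \<in> carrier (op_rl L)" for x y z
    using that by (simp_all add: op_rl_simps rdiv_residual ldiv_residual)
qed (simp_all add: op_rl_simps m_assoc meet_closed join_closed ldiv_closed rdiv_closed
    meet_assoc join_assoc meet_join_absorb join_meet_absorb, simp_all add: meet_comm join_comm)

end

section \<open>Star-involutive idempotent residuated chains\<close>

locale star_chain_rl = residuated_lattice +
  assumes star_chain: "star_chain L"
begin

lemma le_total: "\<lbrakk>x \<in> carrier L; y \<in> carrier L\<rbrakk> \<Longrightarrow> x \<preceq> y \<or> y \<preceq> x"
  using star_chain by (simp add: star_chain_def totally_ordered_rl_def)

lemma mult_idem: "x \<in> carrier L \<Longrightarrow> x \<otimes> x = x"
  using star_chain by (simp add: star_chain_def idempotent_rl_def)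

lemma star_star: "x \<in> carrier L \<Longrightarrow> star_rl L (star_rl L x) = x"
  using star_chain by (simp add: star_chain_def)

lemma meet_min: "\<lbrakk>x \<in> carrier L; y \<in> carrier L\<rbrakk> \<Longrightarrow> x \<curlywedge> y = (if x \<preceq> y then x else y)"
  using le_total[of x y] meet_comm[of x y] by (auto simp: le_rl_def)

lemma join_max: "\<lbrakk>x \<in> carrier L; y \<in> carrier L\<rbrakk> \<Longrightarrow> x \<curlyvee> y = (if x \<preceq> y then y else x)"
  using le_total[of x y] join_comm[of x y] le_iff_join[of x y] le_iff_join[of y x] by auto

text \<open>Multiply \<open>x \<otimes> y\<close> by \<open>x\<close> on the left: the result is at
  most \<open>x\<close> because the product is at most 1, and idempotence collapses it to the
  product again; likewise for \<open>y\<close> on the right. Conversely, the meet is its own square,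
  which monotonicity bounds by the product.\<close>

lemma mult_le_one:
  assumes "x \<in> carrier L" "y \<in> carrier L" "x \<otimes> y \<preceq> \<one>"
  shows "x \<otimes> y = x \<curlywedge> y"
proof (rule le_antisym)
  have "x \<otimes> (x \<otimes> y) \<preceq> x" "(x \<otimes> y) \<otimes> y \<preceq> y"
    using mult_mono_right[of "x \<otimes> y" \<one> x] mult_mono_left[of "x \<otimes> y" \<one> y] assms by auto
  moreover have "x \<otimes> (x \<otimes> y) = x \<otimes> y" "(x \<otimes> y) \<otimes> y = x \<otimes> y"
    using m_assoc[of x x y] m_assoc[of x y y] assms mult_idem by auto
  ultimately show "x \<otimes> y \<preceq> x \<curlywedge> y" using assms le_meet by simp
  have "(x \<curlywedge> y) \<otimes> (x \<curlywedge> y) \<preceq> x \<otimes> (x \<curlywedge> y)" "x \<otimes> (x \<curlywedge> y) \<preceq> x \<otimes> y"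
    using assms mult_mono_left mult_mono_right meet_le1 meet_le2 meet_closed by simp_all
  then show "x \<curlywedge> y \<preceq> x \<otimes> y"
    using le_trans[of "x \<curlywedge> y" "x \<otimes> (x \<curlywedge> y)" "x \<otimes> y"] mult_idem assms meet_closed by simp
qed (use assms meet_closed in auto)

lemma one_le_mult:
  assumes "x \<in> carrier L" "y \<in> carrier L" "\<one> \<preceq> x \<otimes> y"
  shows "x \<otimes> y = x \<curlyvee> y"
proof (rule le_antisym)
  have "x \<preceq> x \<otimes> (x \<otimes> y)" "y \<preceq> (x \<otimes> y) \<otimes> y"
    using mult_mono_right[of \<one> "x \<otimes> y" x] mult_mono_left[of \<one> "x \<otimes> y" y] assms by auto
  moreover have "x \<otimes> (x \<otimes> y) = x \<otimes> y" "(x \<otimes> y) \<otimes> y = x \<otimes> y"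
    using m_assoc[of x x y] m_assoc[of x y y] assms mult_idem by auto
  ultimately show "x \<curlyvee> y \<preceq> x \<otimes> y" using assms join_le by simp
  have "x \<otimes> (x \<curlyvee> y) \<preceq> (x \<curlyvee> y) \<otimes> (x \<curlyvee> y)" "x \<otimes> y \<preceq> x \<otimes> (x \<curlyvee> y)"
    using assms mult_mono_left mult_mono_right le_join1 le_join2 join_closed by simp_all
  then show "x \<otimes> y \<preceq> x \<curlyvee> y"
    using le_trans[of "x \<otimes> y" "x \<otimes> (x \<curlyvee> y)" "x \<curlyvee> y"] mult_idem assms join_closed by simp
qed (use assms join_closed in auto)

lemma mult_eq: "\<lbrakk>x \<in> carrier L; y \<in> carrier L\<rbrakk>
    \<Longrightarrow> x \<otimes> y = (if x \<preceq> lneg_rl L y then x \<curlywedge> y else x \<curlyvee> y)"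
  using mult_le_one one_le_mult le_total[of "x \<otimes> y" \<one>] by (auto simp: le_lneg)

lemma galois: "\<lbrakk>x \<in> carrier L; y \<in> carrier L\<rbrakk> \<Longrightarrow> x \<preceq> lneg_rl L y \<longleftrightarrow> y \<preceq> rneg_rl L x"
  by (simp add: le_lneg le_rneg)

text \<open>By residuation one asks for which \<open>y\<close> the product of \<open>x\<close> and
  \<open>y\<close> is below \<open>z\<close>. In a chain a meet is below \<open>z\<close> if one
  factor is, a join if both are; which of the two the product is depends only on whether
  \<open>y\<close> is below the right negation of \<open>x\<close>.\<close>

lemma ldiv_eq:
  assumes "x \<in> carrier L" "z \<in> carrier L"
  shows "x \<setminus> z = (if x \<preceq> z then rneg_rl L x \<curlyvee> z else rneg_rl L x \<curlywedge> z)"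
proof (rule eq_iff_lower)
  fix y assume y: "y \<in> carrier L"
  have "y \<preceq> x \<setminus> z \<longleftrightarrow> (if x \<preceq> lneg_rl L y then x \<curlywedge> y else x \<curlyvee> y) \<preceq> z"
    using assms y by (simp add: ldiv_residual mult_eq)
  also have "\<dots> \<longleftrightarrow> (if y \<preceq> rneg_rl L x then x \<preceq> z \<or> y \<preceq> z else x \<preceq> z \<and> y \<preceq> z)"
    using assms y le_total[of x y] le_trans[of x y z] le_trans[of y x z]
    by (auto simp: galois meet_min join_le_iff)
  also have "\<dots> \<longleftrightarrow> y \<preceq> (if x \<preceq> z then rneg_rl L x \<curlyvee> z else rneg_rl L x \<curlywedge> z)"
    using assms y rneg_closed[of x] le_total[of "rneg_rl L x" z] le_trans[of y "rneg_rl L x" z]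
      le_trans[of y z "rneg_rl L x"]
    by (auto simp: join_max le_meet_iff)
  finally show "y \<preceq> x \<setminus> z \<longleftrightarrow> y \<preceq> (if x \<preceq> z then rneg_rl L x \<curlyvee> z else rneg_rl L x \<curlywedge> z)" .
qed (use assms rneg_closed ldiv_closed join_closed meet_closed in auto)

lemma one_or_less: "x \<in> carrier L \<Longrightarrow> x \<preceq> \<one> \<and> \<one> \<preceq> lneg_rl L x \<and> \<one> \<preceq> rneg_rl L x
    \<or> \<one> \<preceq> x \<and> lneg_rl L x \<preceq> \<one> \<and> rneg_rl L x \<preceq> \<one>"
  using le_total[of x \<one>] le_lneg[of \<one> x] le_rneg[of x \<one>] le_trans[of "lneg_rl L x" "lneg_rl L x \<otimes> x" \<one>]
    le_trans[of "rneg_rl L x" "x \<otimes> rneg_rl L x" \<one>]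
    mult_mono_right[of \<one> x "lneg_rl L x"] mult_mono_left[of \<one> x "rneg_rl L x"]
    le_lneg[of "lneg_rl L x" x] le_rneg[of x "rneg_rl L x"] lneg_closed rneg_closed le_refl
  by auto

text \<open>If \<open>y\<close> and \<open>l = 1/x\<close> both satisfy \<open>x y \<ge> 1 \<ge> y x\<close>, they are absorbed by \<open>x\<close> on one side
  and absorb it on the other, so that \<open>y l = y (x l) = (y x) l\<close> forces \<open>y = l\<close>.\<close>
lemma cover_l:
  assumes x: "x \<in> carrier L" and y: "y \<in> carrier L"
  shows "y \<preceq> rneg_rl L x \<or> lneg_rl L x \<preceq> y"
proof (rule ccontr)
  define u where "u = lneg_rl L x"
  assume "\<not> ?thesis"
  then have nr: "\<not> y \<preceq> rneg_rl L x" and nl: "\<not> u \<preceq> y" by (auto simp: u_def)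
  have u: "u \<in> carrier L" "u \<preceq> u" using x lneg_closed le_refl by (simp_all add: u_def)
  have yu: "y \<preceq> u" using nl le_total u y by blast
  have nu: "\<not> u \<preceq> rneg_rl L x" using nr le_trans[OF y u(1) _ yu] rneg_closed x by blast
  have vx: "v \<otimes> x = v \<curlywedge> x" "x \<otimes> v = x \<curlyvee> v"
    if "v \<in> carrier L" "v \<preceq> u" "\<not> v \<preceq> rneg_rl L x" for v
    using that x galois[of x v] by (auto simp: mult_eq u_def)
  note yx = vx[OF y yu nr] and ux = vx[OF u nu]
  show False
    using one_or_less[OF x]
  proof
    assume neg: "x \<preceq> \<one> \<and> \<one> \<preceq> lneg_rl L x \<and> \<one> \<preceq> rneg_rl L x"
    then have y1: "\<one> \<preceq> y" using nr le_total[of "rneg_rl L x" y] le_trans[of \<one> "rneg_rl L x" y] x y rneg_closed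
      by auto
    have ord: "x \<preceq> y" "x \<preceq> u" using neg y1 le_trans[of x \<one>] x y u(1) by (auto simp: u_def)
    then have e: "y \<otimes> x = x" "x \<otimes> y = y" "u \<otimes> x = x" "x \<otimes> u = u"
      using yx ux le_absorb[OF _ _ ord(1)] le_absorb[OF _ _ ord(2)] x y u(1) by simp_all
    have "y \<otimes> u = u" "u \<otimes> y = y"
      using m_assoc[of y x u] m_assoc[of u x y] e x y u(1) by simp_all
    moreover have "u \<otimes> y = u \<curlyvee> y" "y \<otimes> u = y \<curlyvee> u"
      using one_le_mult[of u y] one_le_mult[of y u] neg y1 calculation u y by (auto simp: u_def)
    ultimately show False using join_comm u y nl by auto
  next
    assume pos: "\<one> \<preceq> x \<and> lneg_rl L x \<preceq> \<one> \<and> rneg_rl L x \<preceq> \<one>"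
    then have y1: "y \<preceq> \<one>" using yu le_trans[of y u \<one>] x y u(1) by (auto simp: u_def)
    have ord: "y \<preceq> x" "u \<preceq> x" using pos y1 le_trans[of _ \<one> x] x y u(1) by (auto simp: u_def)
    then have e: "y \<otimes> x = y" "x \<otimes> y = x" "u \<otimes> x = u" "x \<otimes> u = x"
      using yx ux le_absorb[OF _ _ ord(1)] le_absorb[OF _ _ ord(2)] x y u(1) by simp_all
    have "y \<otimes> u = y" "u \<otimes> y = u"
      using m_assoc[of y x u] m_assoc[of u x y] e x y u(1) by simp_all
    moreover have "u \<otimes> y = u \<curlywedge> y" "y \<otimes> u = y \<curlywedge> u"
      using mult_le_one[of u y] mult_le_one[of y u] pos y1 calculation u y by (auto simp: u_def)
    ultimately show False using meet_comm u y nl by auto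
  qed
qed

lemma op_chain: "star_chain_rl (op_rl L)"
proof -
  interpret op: residuated_lattice "op_rl L" by (rule op_residuated)
  have "star_rl (op_rl L) x = star_rl L x" if "x \<in> carrier L" for x
    using that by (simp add: star_rl_def op_rl_simps meet_comm lneg_closed rneg_closed)
  then show ?thesis
    using op_residuated le_total mult_idem star_star star_closed
    by (simp add: star_chain_rl_def star_chain_rl_axioms_def star_chain_def totally_ordered_rl_def
        idempotent_rl_def op_rl_simps)
qed

lemmas cover_r = star_chain_rl.cover_l[OF op_chain, unfolded op_rl_simps]
  and rdiv_eq = star_chain_rl.ldiv_eq[OF op_chain, unfolded op_rl_simps]

end

section \<open>The chain of a skeleton\<close>

context preskeleton
begin

text \<open>Chosen representatives instead of equivalence classes keep the quotient inside the type
  \<open>'a\<close>.\<close>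

definition rep :: "'a \<Rightarrow> 'a"
  where "rep x = (SOME y. y \<in> X \<and> leq x y \<and> leq y x)"

lemma rep: assumes "x \<in> X" shows "rep x \<in> X" "leq x (rep x)" "leq (rep x) x"
proof -
  have "rep x \<in> X \<and> leq x (rep x) \<and> leq (rep x) x"
    unfolding rep_def by (rule someI[of _ x]) (use assms refl in auto)
  then show "rep x \<in> X" "leq x (rep x)" "leq (rep x) x" by auto
qed

lemma leq_rep_right: "\<lbrakk>x \<in> X; y \<in> X\<rbrakk> \<Longrightarrow> leq x (rep y) \<longleftrightarrow> leq x y"
  using rep[of y] trans[of x y "rep y"] trans[of x "rep y" y] by blast

lemma leq_rep_left: "\<lbrakk>x \<in> X; y \<in> X\<rbrakk> \<Longrightarrow> leq (rep x) y \<longleftrightarrow> leq x y"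
  using rep[of x] trans[of x "rep x" y] trans[of "rep x" x y] by blast

lemma rep_eq_iff: assumes "x \<in> X" "y \<in> X" shows "rep x = rep y \<longleftrightarrow> leq x y \<and> leq y x"
proof
  assume "rep x = rep y"
  then show "leq x y \<and> leq y x"
    using rep[of x] rep[of y] assms leq_rep_right leq_rep_left by metis
next
  assume xy: "leq x y \<and> leq y x"
  have "leq x z \<and> leq z x \<longleftrightarrow> leq y z \<and> leq z y" if "z \<in> X" for z
    using assms that xy trans[of x y z] trans[of z y x] trans[of y x z] trans[of z x y] by blast
  then show "rep x = rep y" unfolding rep_def by metis
qed

lemma rep_l: "x \<in> X \<Longrightarrow> rep (l (rep x)) = rep (l x)"
  using rep[of x] l_antimono[of x "rep x"] l_antimono[of "rep x" x] l_closed rep_eq_iff by simp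

lemma rep_r: "x \<in> X \<Longrightarrow> rep (r (rep x)) = rep (r x)"
  using rep[of x] r_antimono[of x "rep x"] r_antimono[of "rep x" x] r_closed rep_eq_iff by simp

lemma quotient: "skeleton (rep ` X) leq (rep e) (\<lambda>x. rep (l x)) (\<lambda>x. rep (r x))"
proof
  fix x st
  assume "x \<in> rep ` X"
    and st: "st = (\<lambda>u. if leq (rep (l u)) (rep (r u)) then rep (l u) else rep (r u))"
  then have "x \<in> X" using rep by auto
  then show "leq (st (st x)) x \<and> leq x (st (st x))"
    by (rule star_star_of_min[rotated 4])
      (use total l_closed r_closed rep refl in \<open>auto simp: st leq_rep_left leq_rep_right\<close>)
next
  fix x y assume "x \<in> rep ` X" "y \<in> rep ` X"
  then have xy: "x \<in> X" "y \<in> X" using rep by auto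
  show "leq y (rep (r x)) \<or> leq (rep (l x)) y" "leq y (rep (l x)) \<or> leq (rep (r x)) y"
    using xy cover_l cover_r l_closed r_closed by (simp_all add: leq_rep_left leq_rep_right)
  show "leq x (rep (l y)) \<longleftrightarrow> leq y (rep (r x))"
    using xy galois l_closed r_closed by (simp add: leq_rep_right)
next
  fix x y z assume "x \<in> rep ` X" "y \<in> rep ` X" "z \<in> rep ` X" "leq x y" "leq y z"
  then show "leq x z" using trans[of x y z] rep by auto
next
  fix x y assume "x \<in> rep ` X" "y \<in> rep ` X" "leq x y" "leq y x"
  then show "x = y" using rep_eq_iff by (auto simp: rep leq_rep_left leq_rep_right)
qed (use total rep e_closed l_closed r_closed rep_l rep_r unit_l unit_r
    in \<open>auto simp: leq_rep_left leq_rep_right\<close>)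

end

context skeleton
begin

abbreviation C :: "'a reslat" where "C \<equiv> chain_rl X leq e l r"

lemma chain_simps:
  "carrier C = X" "one C = e"
  "x \<curlywedge>\<^bsub>C\<^esub> y = (if leq x y then x else y)"
  "x \<curlyvee>\<^bsub>C\<^esub> y = (if leq x y then y else x)"
  "x \<otimes>\<^bsub>C\<^esub> y = (if leq x (l y) then if leq x y then x else y else if leq x y then y else x)"
  "x \<setminus>\<^bsub>C\<^esub> y = (if leq x y then if leq (r x) y then y else r x else if leq (r x) y then r x else y)"
  "y \<oslash>\<^bsub>C\<^esub> x = (if leq x y then if leq (l x) y then y else l x else if leq (l x) y then l x else y)"
  by (simp_all add: chain_rl_def Let_def)

lemma chain_le: "\<lbrakk>x \<in> X; y \<in> X\<rbrakk> \<Longrightarrow> x \<preceq>\<^bsub>C\<^esub> y \<longleftrightarrow> leq x y"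
  using refl by (auto simp: le_rl_def chain_simps)

lemma l_e: "l e = e" and r_e: "r e = e"
  using antisym unit_l unit_r e_closed l_closed r_closed by blast+

text \<open>The cover axioms supply the uniqueness conditions: if the product of \<open>y\<close>
  and \<open>x\<close> is at most \<open>e\<close> but that of \<open>x\<close> and \<open>y\<close>
  is not, then \<open>y\<close> is below \<open>l x\<close> and not below \<open>r x\<close>, which
  forces \<open>y = l x\<close>.\<close>

lemma chain_assoc: "\<lbrakk>x \<in> X; y \<in> X; z \<in> X\<rbrakk> \<Longrightarrow> (x \<otimes>\<^bsub>C\<^esub> y) \<otimes>\<^bsub>C\<^esub> z = x \<otimes>\<^bsub>C\<^esub> (y \<otimes>\<^bsub>C\<^esub> z)"
  unfolding chain_simps
proof (rule conservative_assoc[where S = X and e = e and N = "\<lambda>x y. leq x (l y)"])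
  show "leq x (l y)" if "x \<in> X" "z \<in> X" "y \<in> X" "leq x z" "leq z (l y)" for x y z
    using that trans[of x z "l y"] l_closed by simp
  show "leq y (l x)" if "x \<in> X" "z \<in> X" "y \<in> X" "leq x z" "leq y (l z)" for x y z
    using that trans[of x z "r y"] r_closed galois by simp
  show "leq e (l x) \<longleftrightarrow> leq x e" if "x \<in> X" for x using that le_e_iff_r by simp
  show "leq x (l e) \<longleftrightarrow> leq x e" for x by (simp add: l_e)
  show "y = z" if "x \<in> X" "y \<in> X" "z \<in> X" "leq y (l x)" "\<not> leq x (l y)" "leq z (l x)" "\<not> leq x (l z)" for x y z
    using that cover_l[of x y] cover_l[of x z] galois[of x y] galois[of x z] antisym[of y "l x"]
      antisym[of z "l x"] l_closed[of x] by simp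
  show "y = z" if "x \<in> X" "y \<in> X" "z \<in> X" "leq x (l y)" "\<not> leq y (l x)" "leq x (l z)" "\<not> leq z (l x)" for x y z
    using that cover_r[of x y] cover_r[of x z] galois[of x y] galois[of x z] antisym[of y "r x"]
      antisym[of z "r x"] r_closed[of x] by simp
  show "leq x z" if "x \<in> X" "y \<in> X" "z \<in> X" "leq x y" "leq y z" for x y z
    using that by (rule trans)
qed (use total e_closed antisym in simp_all)

lemma chain_residuated: "residuated_lattice C"
proof
  fix x y z assume "x \<in> carrier C" "y \<in> carrier C" "z \<in> carrier C"
  then have x: "x \<in> X" and y: "y \<in> X" and z: "z \<in> X" by (auto simp: chain_simps(1))
  have cl: "l v \<in> X" "r v \<in> X" if "v \<in> X" for v using that l_closed r_closed by auto
  show "(x \<otimes>\<^bsub>C\<^esub> y) \<otimes>\<^bsub>C\<^esub> z = x \<otimes>\<^bsub>C\<^esub> (y \<otimes>\<^bsub>C\<^esub> z)" using chain_assoc x y z by simp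
  show "(x \<curlywedge>\<^bsub>C\<^esub> y) \<curlywedge>\<^bsub>C\<^esub> z = x \<curlywedge>\<^bsub>C\<^esub> (y \<curlywedge>\<^bsub>C\<^esub> z)"
    using x y z total[of x y] total[of y z] total[of x z] antisym[of x y] antisym[of y z] antisym[of x z]
      trans[of x y z] trans[of z y x] trans[of y x z] trans[of x z y] trans[of y z x] trans[of z x y]
    unfolding chain_simps by (smt (verit))
  show "(x \<curlyvee>\<^bsub>C\<^esub> y) \<curlyvee>\<^bsub>C\<^esub> z = x \<curlyvee>\<^bsub>C\<^esub> (y \<curlyvee>\<^bsub>C\<^esub> z)"
    using x y z total[of x y] total[of y z] total[of x z] antisym[of x y] antisym[of y z] antisym[of x z]
      trans[of x y z] trans[of z y x] trans[of y x z] trans[of x z y] trans[of y z x] trans[of z x y]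
    unfolding chain_simps by (smt (verit))
  have "leq y (x \<setminus>\<^bsub>C\<^esub> z) \<longleftrightarrow> leq (x \<otimes>\<^bsub>C\<^esub> y) z"
    using x y z cl[OF x] galois[of x y] total[of x y] total[of y z] total[of x z] total[of "r x" z]
      trans[of x y z] trans[of y x z] trans[of y "r x" z] trans[of y z "r x"]
    unfolding chain_simps by (smt (verit))
  moreover have "leq x (z \<oslash>\<^bsub>C\<^esub> y) \<longleftrightarrow> leq (x \<otimes>\<^bsub>C\<^esub> y) z"
    using x y z cl[OF y] total[of x y] total[of y z] total[of x z] total[of "l y" z]
      trans[of x y z] trans[of y x z] trans[of x "l y" z] trans[of x z "l y"]
    unfolding chain_simps by (smt (verit))
  moreover have "x \<otimes>\<^bsub>C\<^esub> y \<in> X" "x \<setminus>\<^bsub>C\<^esub> z \<in> X" "z \<oslash>\<^bsub>C\<^esub> y \<in> X"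
    using x y z cl by (auto simp: chain_simps)
  ultimately show "(y \<preceq>\<^bsub>C\<^esub> x \<setminus>\<^bsub>C\<^esub> z) = (x \<otimes>\<^bsub>C\<^esub> y \<preceq>\<^bsub>C\<^esub> z)"
    "(x \<otimes>\<^bsub>C\<^esub> y \<preceq>\<^bsub>C\<^esub> z) = (x \<preceq>\<^bsub>C\<^esub> z \<oslash>\<^bsub>C\<^esub> y)"
    using x y z by (simp_all add: chain_le)
  show "x \<curlywedge>\<^bsub>C\<^esub> y = y \<curlywedge>\<^bsub>C\<^esub> x" "x \<curlyvee>\<^bsub>C\<^esub> y = y \<curlyvee>\<^bsub>C\<^esub> x"
    using x y total[of x y] antisym[of x y] by (auto simp: chain_simps)
  show "\<one>\<^bsub>C\<^esub> \<otimes>\<^bsub>C\<^esub> x = x" "x \<otimes>\<^bsub>C\<^esub> \<one>\<^bsub>C\<^esub> = x"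
    using x total[of x e] antisym[of x e] le_e_iff_r[of x] e_closed by (auto simp: chain_simps l_e)
qed (use e_closed l_closed r_closed refl in \<open>auto simp: chain_simps\<close>)

lemma chain_lneg: "x \<in> X \<Longrightarrow> lneg_rl C x = l x"
  using le_e_iff_r[of x] total[of x e] e_le_l[of x] antisym[of e "l x"] l_closed e_closed
  by (auto simp: lneg_rl_def chain_simps)

lemma chain_rneg: "x \<in> X \<Longrightarrow> rneg_rl C x = r x"
  using le_e_iff_l[of x] total[of x e] e_le_r[of x] antisym[of e "r x"] r_closed e_closed
  by (auto simp: rneg_rl_def chain_simps)

lemma star_chain: "star_chain C"
proof -
  define st where "st u = (if leq (l u) (r u) then l u else r u)" for u
  have st_closed: "st u \<in> X" if "u \<in> X" for u using that l_closed r_closed by (simp add: st_def)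
  have "star_rl C u = st u" if "u \<in> X" for u
    using that by (simp add: star_rl_def chain_lneg chain_rneg chain_simps st_def)
  moreover have "st (st x) = x" if "x \<in> X" for x
    using star_star[OF that, of st] antisym[of "st (st x)" x] that st_closed unfolding st_def[abs_def] by auto
  ultimately show ?thesis
    using chain_residuated total st_closed
    by (auto simp: star_chain_def totally_ordered_rl_def idempotent_rl_def chain_simps(1,5) chain_le)
qed

end

lemma (in star_chain_rl) skeleton: "skeleton (carrier L) (le_rl L) \<one> (lneg_rl L) (rneg_rl L)"
proof
  fix x st assume x: "x \<in> carrier L"
    and st: "st = (\<lambda>u. if lneg_rl L u \<preceq> rneg_rl L u then lneg_rl L u else rneg_rl L u)"
  have "st u = star_rl L u" if "u \<in> carrier L" for u
    using that by (simp add: st star_rl_def meet_min lneg_closed rneg_closed)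
  then show "st (st x) \<preceq> x \<and> x \<preceq> st (st x)"
    using star_star x star_closed le_refl by simp
next
  show "x \<preceq> z" if "x \<in> carrier L" "y \<in> carrier L" "z \<in> carrier L" "x \<preceq> y" "y \<preceq> z" for x y z
    using that by (rule le_trans)
  show "y \<preceq> lneg_rl L x \<or> rneg_rl L x \<preceq> y" if "x \<in> carrier L" "y \<in> carrier L" for x y
    using that by (rule cover_r)
qed (simp_all add: le_total le_antisym le_refl lneg_closed rneg_closed galois cover_l lneg_one rneg_one)

section \<open>Amalgamating skeletons\<close>

text \<open>Within a cut of the common part \<open>R\<close>, elements of the first summand precede those of the second
  above the unit and follow them below it, which is what the antitone negations require.\<close>

fun amalg_le :: "('b \<Rightarrow> 'b \<Rightarrow> bool) \<Rightarrow> 'b \<Rightarrow> ('c \<Rightarrow> 'c \<Rightarrow> bool) \<Rightarrow> 'c \<Rightarrow> ('b \<times> 'c) set \<Rightarrow> 'b + 'c \<Rightarrow> 'b + 'c \<Rightarrow> bool"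
  where
    "amalg_le leB eB leC eC R (Inl b) (Inl b') \<longleftrightarrow> leB b b'"
  | "amalg_le leB eB leC eC R (Inr c) (Inr c') \<longleftrightarrow> leC c c'"
  | "amalg_le leB eB leC eC R (Inl b) (Inr c) \<longleftrightarrow> (\<exists>(p, q) \<in> R. leB b p \<and> leC q c)
      \<or> leB eB b \<and> leC eC c \<and> \<not> (\<exists>(p, q) \<in> R. leC c q \<and> leB p b)"
  | "amalg_le leB eB leC eC R (Inr c) (Inl b) \<longleftrightarrow> (\<exists>(p, q) \<in> R. leC c q \<and> leB p b)
      \<or> \<not> leB eB b \<and> \<not> leC eC c \<and> \<not> (\<exists>(p, q) \<in> R. leB b p \<and> leC q c)"

text \<open>\<open>R\<close> is the common part, given as matching pairs. The conditions say that
  matching is compatible with unit, negations and order, so that the two members of a pair can be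
  identified.\<close>

locale preskeleton_span =
  B: preskeleton XB leB eB lB rB + C: preskeleton XC leC eC lC rC
  for XB :: "'b set" and leB eB lB rB and XC :: "'c set" and leC eC lC rC +
  fixes R :: "('b \<times> 'c) set"
  assumes R_closed: "(p, q) \<in> R \<Longrightarrow> p \<in> XB" "(p, q) \<in> R \<Longrightarrow> q \<in> XC"
    and R_e: "(eB, eC) \<in> R"
    and R_l: "(p, q) \<in> R \<Longrightarrow> (lB p, lC q) \<in> R"
    and R_r: "(p, q) \<in> R \<Longrightarrow> (rB p, rC q) \<in> R"
    and R_le: "\<lbrakk>(p, q) \<in> R; (p', q') \<in> R\<rbrakk> \<Longrightarrow> leB p p' \<longleftrightarrow> leC q q'"
begin

text \<open>\<open>up\<close> and \<open>dn\<close> describe the comparisons already forced by a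
  common element lying in between. All other comparisons across the summands are free and decided by
  the sign rule of \<open>amalg_le\<close>.\<close>

definition up where "up b c \<longleftrightarrow> (\<exists>(p, q) \<in> R. leB b p \<and> leC q c)"
definition dn where "dn c b \<longleftrightarrow> (\<exists>(p, q) \<in> R. leC c q \<and> leB p b)"
definition posB where "posB b \<longleftrightarrow> leB eB b"
definition posC where "posC c \<longleftrightarrow> leC eC c"
definition leD where "leD = amalg_le leB eB leC eC R"

lemma leD:
  "leD (Inl b) (Inl b') \<longleftrightarrow> leB b b'"
  "leD (Inr c) (Inr c') \<longleftrightarrow> leC c c'"
  "leD (Inl b) (Inr c) \<longleftrightarrow> up b c \<or> posB b \<and> posC c \<and> \<not> dn c b"
  "leD (Inr c) (Inl b) \<longleftrightarrow> dn c b \<or> \<not> posB b \<and> \<not> posC c \<and> \<not> up b c"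
  by (auto simp: leD_def up_def dn_def posB_def posC_def)

lemma up_left: "\<lbrakk>b \<in> XB; b' \<in> XB; leB b b'; up b' c\<rbrakk> \<Longrightarrow> up b c"
  using B.trans[of b b'] R_closed(1) unfolding up_def by blast

lemma up_right: "\<lbrakk>c \<in> XC; c' \<in> XC; leC c c'; up b c\<rbrakk> \<Longrightarrow> up b c'"
  using C.trans[of _ c c'] R_closed(2) unfolding up_def by blast

lemma dn_left: "\<lbrakk>c \<in> XC; c' \<in> XC; leC c c'; dn c' b\<rbrakk> \<Longrightarrow> dn c b"
  using C.trans[of c c'] R_closed(2) unfolding dn_def by blast

lemma dn_right: "\<lbrakk>b \<in> XB; b' \<in> XB; leB b b'; dn c b\<rbrakk> \<Longrightarrow> dn c b'"
  using B.trans[of _ b b'] R_closed(1) unfolding dn_def by blast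

lemma up_dn:
  assumes "b \<in> XB" "b' \<in> XB" "c \<in> XC" "up b c" "dn c b'"
  shows "leB b b'"
proof -
  obtain p q p' q' where pq: "(p, q) \<in> R" "leB b p" "leC q c" and pq': "(p', q') \<in> R" "leC c q'" "leB p' b'"
    using assms(4,5) by (auto simp: up_def dn_def)
  note cl = R_closed[OF pq(1)] R_closed[OF pq'(1)]
  have "leB p p'" using C.trans[of q c q'] R_le[OF pq(1) pq'(1)] pq pq' cl assms by simp
  then show ?thesis using B.trans[of b p p'] B.trans[of b p' b'] pq pq' cl assms by simp
qed

lemma dn_up:
  assumes "c \<in> XC" "c' \<in> XC" "b \<in> XB" "dn c b" "up b c'"
  shows "leC c c'"
proof -
  obtain p q p' q' where pq: "(p, q) \<in> R" "leC c q" "leB p b" and pq': "(p', q') \<in> R" "leB b p'" "leC q' c'"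
    using assms(4,5) by (auto simp: up_def dn_def)
  note cl = R_closed[OF pq(1)] R_closed[OF pq'(1)]
  have "leC q q'" using B.trans[of p b p'] R_le[OF pq(1) pq'(1)] pq pq' cl assms by simp
  then show ?thesis using C.trans[of c q q'] C.trans[of c q' c'] pq pq' cl assms by simp
qed

text \<open>The unit is common, so elements on different sides of it are never compared freely.
  Hence the sign rule only has to treat elements of equal sign.\<close>

lemma up_mixed: "\<lbrakk>b \<in> XB; \<not> posB b; posC c\<rbrakk> \<Longrightarrow> up b c"
  using R_e B.total[of b eB] B.e_closed unfolding up_def posB_def posC_def by blast

lemma dn_mixed: "\<lbrakk>c \<in> XC; posB b; \<not> posC c\<rbrakk> \<Longrightarrow> dn c b"
  using R_e C.total[of c eC] C.e_closed unfolding dn_def posB_def posC_def by blast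

lemma posC_up: "\<lbrakk>c \<in> XC; c' \<in> XC; leC c c'; posC c\<rbrakk> \<Longrightarrow> posC c'"
  using C.trans[of eC c c'] C.e_closed by (simp add: posC_def)

lemma leD_total: assumes "x \<in> XB <+> XC" "y \<in> XB <+> XC" shows "leD x y \<or> leD y x"
proof -
  have BC: "leD (Inl b) (Inr c) \<or> leD (Inr c) (Inl b)" if "b \<in> XB" "c \<in> XC" for b c
    using up_mixed[of b c] dn_mixed[of c b] that by (auto simp: leD)
  show ?thesis
    using assms
  proof (elim PlusE)
    fix b b' assume "b \<in> XB" "b' \<in> XB" "x = Inl b" "y = Inl b'"
    then show ?thesis using B.total[of b b'] by (simp add: leD)
  next
    fix c c' assume "c \<in> XC" "c' \<in> XC" "x = Inr c" "y = Inr c'"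
    then show ?thesis using C.total[of c c'] by (simp add: leD)
  qed (use BC in blast)+
qed

text \<open>The mixed cases are named after the summands of the three elements. A free comparison
  followed by a forced one, or conversely, is handled by moving the common element along: where the
  conclusion fails, it would separate two elements that were compared freely.\<close>

lemma leD_trans:
  assumes "x \<in> XB <+> XC" "y \<in> XB <+> XC" "z \<in> XB <+> XC" "leD x y" "leD y z"
  shows "leD x z"
proof -
  have BBC: "leD (Inl b) (Inr c)" if "b \<in> XB" "b' \<in> XB" "c \<in> XC" "leB b b'" "leD (Inl b') (Inr c)" for b b' c
    using that up_left[of b b' c] dn_right[of b b' c] up_mixed[of b c] by (auto simp: leD)
  have BCB: "leB b b'" if "b \<in> XB" "b' \<in> XB" "c \<in> XC" "leD (Inl b) (Inr c)" "leD (Inr c) (Inl b')" for b b' c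
    using that up_dn[of b b' c] B.total[of b b'] up_left[of b' b c] dn_right[of b' b c] by (auto simp: leD)
  have BCC: "leD (Inl b) (Inr c')" if "b \<in> XB" "c \<in> XC" "c' \<in> XC" "leD (Inl b) (Inr c)" "leC c c'" for b c c'
    using that up_right[of c c' b] dn_left[of c c' b] posC_up[of c c'] by (auto simp: leD)
  have CCB: "leD (Inr c) (Inl b)" if "b \<in> XB" "c \<in> XC" "c' \<in> XC" "leD (Inr c') (Inl b)" "leC c c'" for b c c'
    using that up_right[of c c' b] dn_left[of c c' b] posC_up[of c c'] by (auto simp: leD)
  have CBC: "leC c c'" if "b \<in> XB" "c \<in> XC" "c' \<in> XC" "leD (Inr c) (Inl b)" "leD (Inl b) (Inr c')" for b c c'
    using that dn_up[of c c' b] C.total[of c c'] up_right[of c' c b] dn_left[of c' c b] by (auto simp: leD)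
  have CBB: "leD (Inr c) (Inl b')" if "b \<in> XB" "b' \<in> XB" "c \<in> XC" "leD (Inr c) (Inl b)" "leB b b'" for b b' c
    using that up_left[of b b' c] dn_right[of b b' c] dn_mixed[of c b'] by (auto simp: leD)
  show ?thesis
    using assms
    by (elim PlusE; hypsubst)
      (simp_all only: leD(1,2), (erule (4) B.trans BBC BCB BCC CCB CBC CBB C.trans)+)
qed

lemma leD_glue: "(p, q) \<in> R \<Longrightarrow> leD (Inl p) (Inr q)" "(p, q) \<in> R \<Longrightarrow> leD (Inr q) (Inl p)"
  using R_closed[of p q] B.refl C.refl by (auto simp: leD up_def dn_def)

definition inB where "inB b \<longleftrightarrow> (\<exists>(p, q) \<in> R. leB b p \<and> leB p b)"
definition inC where "inC c \<longleftrightarrow> (\<exists>(p, q) \<in> R. leC c q \<and> leC q c)"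

text \<open>Strong amalgamation for chains. Free comparisons go in one direction only, so
  comparability both ways needs a common element in each direction, and these two squeeze each other
  into one class.\<close>

lemma glued_eq:
  assumes "b \<in> XB" "c \<in> XC" "leD (Inl b) (Inr c)" "leD (Inr c) (Inl b)"
  shows "\<exists>(p, q) \<in> R. leB b p \<and> leB p b \<and> leC c q \<and> leC q c"
proof -
  have "up b c" "dn c b" using assms by (auto simp: leD)
  then obtain p q p' q' where pq: "(p, q) \<in> R" "leB b p" "leC q c" and pq': "(p', q') \<in> R" "leC c q'" "leB p' b"
    by (auto simp: up_def dn_def)
  note cl = R_closed[OF pq(1)] R_closed[OF pq'(1)] assms(1,2)
  have "leB p p'" using C.trans[of q c q'] R_le[OF pq(1) pq'(1)] pq pq' cl by simp
  then have "leB p b" using B.trans[of p p' b] pq pq' cl by simp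
  have "leB p' p" using B.trans[of p' b p] pq pq' cl by simp
  then have "leC q' q" using R_le[OF pq'(1) pq(1)] by simp
  then have "leC c q" using C.trans[of c q' q] pq pq' cl by simp
  then show ?thesis using pq \<open>leB p b\<close> by blast
qed

text \<open>By \<open>recover_equiv\<close>, \<open>b\<close> is equivalent to a negation of the
  common element equivalent to \<open>rB b\<close>. Read contrapositively, negations of elements
  outside the common part stay outside, so their weak comparisons with common elements are
  strict.\<close>

lemma inB_of_r: assumes "b \<in> XB" "inB (rB b)" shows "inB b"
proof -
  obtain p q where pq: "(p, q) \<in> R" "leB (rB b) p" "leB p (rB b)" using assms by (auto simp: inB_def)
  show ?thesis
    using B.recover_equiv[OF assms(1) R_closed(1)[OF pq(1)] pq(2,3)] R_l[OF pq(1)] R_r[OF pq(1)]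
    by (auto simp: inB_def)
qed

lemma inC_of_r: assumes "c \<in> XC" "inC (rC c)" shows "inC c"
proof -
  obtain p q where pq: "(p, q) \<in> R" "leC (rC c) q" "leC q (rC c)" using assms by (auto simp: inC_def)
  show ?thesis
    using C.recover_equiv[OF assms(1) R_closed(2)[OF pq(1)] pq(2,3)] R_l[OF pq(1)] R_r[OF pq(1)]
    by (auto simp: inC_def)
qed

lemma span_swapped: "preskeleton_span XB leB eB rB lB XC leC eC rC lC R"
  using B.swapped C.swapped R_closed R_e R_l R_r R_le
  by (simp add: preskeleton_span_def preskeleton_span_axioms_def)

lemma inB_of_l: "b \<in> XB \<Longrightarrow> inB (lB b) \<Longrightarrow> inB b"
  using preskeleton_span.inB_of_r[OF span_swapped, of b]
    preskeleton_span.inB_def[OF span_swapped] inB_def by simp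

lemma inC_of_l: "b \<in> XC \<Longrightarrow> inC (lC b) \<Longrightarrow> inC b"
  using preskeleton_span.inC_of_r[OF span_swapped, of b]
    preskeleton_span.inC_def[OF span_swapped] inC_def by simp

lemma leD_glued_B:
  assumes "b \<in> XB" "(p, q) \<in> R" "leB b p" "leB p b"
  shows "leD (Inl b) (Inr q)" "leD (Inr q) (Inl b)"
  using assms R_closed[OF assms(2)] C.refl by (auto simp: leD up_def dn_def)

lemma leD_glued_C:
  assumes "c \<in> XC" "(p, q) \<in> R" "leC c q" "leC q c"
  shows "leD (Inl p) (Inr c)" "leD (Inr c) (Inl p)"
  using assms R_closed[OF assms(2)] B.refl by (auto simp: leD up_def dn_def)

lemma leD_cong:
  assumes "x \<in> XB <+> XC" "x' \<in> XB <+> XC" "leD x x'" "leD x' x" "y \<in> XB <+> XC"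
  shows "leD x y \<longleftrightarrow> leD x' y" "leD y x \<longleftrightarrow> leD y x'"
  using assms leD_trans[of x x' y] leD_trans[of x' x y] leD_trans[of y x x'] leD_trans[of y x' x] by blast+

text \<open>If one of the two elements is equivalent to a common one, replace it and use the law
  inside a single summand. Otherwise the negations exchange \<open>up\<close> with \<open>dn\<close>
  and reverse both signs, and the free clause for one side turns into the free clause for the other
  precisely because the sign rule of \<open>amalg_le\<close> is reversed below the unit.\<close>

lemma galois_mixed:
  assumes x: "x \<in> XB" and y: "y \<in> XC"
  shows "leD (Inl x) (Inr (lC y)) \<longleftrightarrow> leD (Inr y) (Inl (rB x))"
proof -
  note cl = x y B.l_closed[OF x] B.r_closed[OF x] C.l_closed[OF y] C.r_closed[OF y]
  consider (B) "inB x" | (C) "inC y" | (N) "\<not> inB x" "\<not> inC y" by blast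
  then show ?thesis
  proof cases
    case B
    then obtain p q where pq: "(p, q) \<in> R" "leB x p" "leB p x" by (auto simp: inB_def)
    note pcl = R_closed[OF pq(1)] R_closed[OF R_r[OF pq(1)]]
    have "leD (Inl x) (Inr (lC y)) \<longleftrightarrow> leC q (lC y)"
      using leD_cong(1)[OF _ _ leD_glued_B[OF x pq], of "Inr (lC y)"] cl pcl by (auto simp: leD(2))
    also have "\<dots> \<longleftrightarrow> leC y (rC q)" using C.galois cl pcl by simp
    also have "\<dots> \<longleftrightarrow> leD (Inr y) (Inl (rB x))"
      using leD_cong(2)[OF _ _ leD_glued_B[OF cl(4) R_r[OF pq(1)]], of "Inr y"] cl pcl
        B.r_antimono[OF _ _ pq(2)] B.r_antimono[OF _ _ pq(3)] by (auto simp: leD(2))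
    finally show ?thesis .
  next
    case C
    then obtain p q where pq: "(p, q) \<in> R" "leC y q" "leC q y" by (auto simp: inC_def)
    note pcl = R_closed[OF pq(1)] R_closed[OF R_l[OF pq(1)]]
    have "leD (Inl x) (Inr (lC y)) \<longleftrightarrow> leB x (lB p)"
      using leD_cong(2)[OF _ _ leD_glued_C[OF cl(5) R_l[OF pq(1)]], of "Inl x"] cl pcl
        C.l_antimono[OF _ _ pq(2)] C.l_antimono[OF _ _ pq(3)] by (auto simp: leD(1))
    also have "\<dots> \<longleftrightarrow> leB p (rB x)" using B.galois cl pcl by simp
    also have "\<dots> \<longleftrightarrow> leD (Inr y) (Inl (rB x))"
      using leD_cong(1)[OF _ _ leD_glued_C[OF y pq], of "Inl (rB x)"] cl pcl by (auto simp: leD(1))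
    finally show ?thesis .
  next
    case N
    \<comment> \<open>The unit is common, so \<open>x\<close> and \<open>y\<close> are not
      equivalent to it and negation changes their signs.\<close>
    have pos: "posB (rB x) \<longleftrightarrow> \<not> posB x" "posC (lC y) \<longleftrightarrow> \<not> posC y"
      using N R_e B.le_e_iff_l[OF x] C.le_e_iff_r[OF y] B.total[OF x B.e_closed] C.total[OF y C.e_closed]
      by (auto simp: posB_def posC_def inB_def inC_def)
    have "dn y (rB x)" if "up x (lC y)"
    proof -
      obtain p q where pq: "(p, q) \<in> R" "leB x p" "leC q (lC y)" using \<open>up x (lC y)\<close> by (auto simp: up_def)
      then have "leC y (rC q)" "leB (rB p) (rB x)"
        using R_closed[OF pq(1)] cl C.galois B.r_antimono by auto
      then show ?thesis using R_r[OF pq(1)] by (auto simp: dn_def)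
    qed
    moreover have "up x (lC y)" if "dn y (rB x)"
    proof -
      obtain p q where pq: "(p, q) \<in> R" "leC y q" "leB p (rB x)" using \<open>dn y (rB x)\<close> by (auto simp: dn_def)
      then have "leB x (lB p)" "leC (lC q) (lC y)"
        using R_closed[OF pq(1)] cl B.galois C.l_antimono by auto
      then show ?thesis using R_l[OF pq(1)] by (auto simp: up_def)
    qed
    \<comment> \<open>Unlike the two preceding implications, this one runs against the Galois
      connection. The comparison with \<open>p\<close> is strict because \<open>rB x\<close> lies
      outside the common part, so it can be negated.\<close>
    moreover have "dn (lC y) x" if "up (rB x) y"
    proof -
      obtain p q where pq: "(p, q) \<in> R" "leB (rB x) p" "leC q y" using \<open>up (rB x) y\<close> by (auto simp: up_def)
      note pcl = R_closed[OF pq(1)]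
      have "\<not> leB p (rB x)" using inB_of_r[OF x] N pq by (auto simp: inB_def)
      then have "leB (lB p) x" using B.galois[OF x pcl(1)] B.total[of x "lB p"] B.l_closed pcl x by blast
      moreover have "leC (lC y) (lC q)" using C.l_antimono pcl y pq by blast
      ultimately show ?thesis using R_l[OF pq(1)] by (auto simp: dn_def)
    qed
    moreover have "up (rB x) y" if "dn (lC y) x"
    proof -
      obtain p q where pq: "(p, q) \<in> R" "leC (lC y) q" "leB p x" using \<open>dn (lC y) x\<close> by (auto simp: dn_def)
      note pcl = R_closed[OF pq(1)]
      have "\<not> leC q (lC y)" using inC_of_l[OF y] N pq by (auto simp: inC_def)
      then have "leC (rC q) y" using C.galois[OF pcl(2) y] C.total[of y "rC q"] C.r_closed pcl y by blast
      moreover have "leB (rB x) (rB p)" using B.r_antimono pcl x pq by blast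
      ultimately show ?thesis using R_r[OF pq(1)] by (auto simp: up_def)
    qed
    ultimately show ?thesis using pos by (auto simp: leD)
  qed
qed

text \<open>A common element cannot separate \<open>y\<close> from either negation of
  \<open>x\<close>, since it would itself lie strictly between the two negations of \<open>x\<close>
  inside \<open>XB\<close>. So both comparisons of \<open>y\<close> with these negations would be
  free, but they place \<open>y\<close> after one element of \<open>XB\<close> and before another,
  against the sign rule.\<close>

lemma cover_BC:
  assumes x: "x \<in> XB" and y: "y \<in> XC"
  shows "leD (Inr y) (Inl (rB x)) \<or> leD (Inl (lB x)) (Inr y)"
proof (cases "inB x")
  case True
  then obtain p q where pq: "(p, q) \<in> R" "leB x p" "leB p x" by (auto simp: inB_def)
  note cl = x y B.l_closed[OF x] B.r_closed[OF x]
    R_closed[OF pq(1)] R_closed[OF R_r[OF pq(1)]] R_closed[OF R_l[OF pq(1)]]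
  have "leD (Inr y) (Inl (rB x)) \<longleftrightarrow> leC y (rC q)"
    using leD_cong(2)[OF _ _ leD_glued_B[OF cl(4) R_r[OF pq(1)]], of "Inr y"] cl
      B.r_antimono[OF _ _ pq(2)] B.r_antimono[OF _ _ pq(3)] by (auto simp: leD(2))
  moreover have "leD (Inl (lB x)) (Inr y) \<longleftrightarrow> leC (lC q) y"
    using leD_cong(1)[OF _ _ leD_glued_B[OF cl(3) R_l[OF pq(1)]], of "Inr y"] cl
      B.l_antimono[OF _ _ pq(2)] B.l_antimono[OF _ _ pq(3)] by (auto simp: leD(2))
  ultimately show ?thesis using C.cover_l cl by simp
next
  case False
  note cl = x y B.l_closed[OF x] B.r_closed[OF x]
  show ?thesis
  proof (rule ccontr)
    assume "\<not> ?thesis"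
    then have 1: "\<not> leD (Inr y) (Inl (rB x))" and 2: "\<not> leD (Inl (lB x)) (Inr y)" by auto
    have 3: "leD (Inr y) (Inl (lB x))" "leD (Inl (rB x)) (Inr y)"
      using 1 2 leD_total cl by blast+
    have "\<not> up (rB x) y"
    proof
      assume "up (rB x) y"
      then obtain p q where pq: "(p, q) \<in> R" "leB (rB x) p" "leC q y" by (auto simp: up_def)
      then have "\<not> leB p (rB x)" using inB_of_r[OF x] False by (auto simp: inB_def)
      then have "leB (lB x) p" using B.cover_l[OF x] R_closed[OF pq(1)] by blast
      then show False using 2 pq by (auto simp: leD up_def)
    qed
    \<comment> \<open>A free comparison with \<open>XB\<close> on the left needs positive sign. For
      positive \<open>y\<close>, the comparison in the other direction cannot be free, so it comes
      from a common element.\<close>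
    then have pos: "posC y" using 3(2) by (simp add: leD)
    then have "dn y (lB x)" using 3(1) by (simp add: leD)
    then obtain p q where pq: "(p, q) \<in> R" "leC y q" "leB p (lB x)" by (auto simp: dn_def)
    then have "\<not> leB (lB x) p" using inB_of_l[OF x] False by (auto simp: inB_def)
    then have "leB p (rB x)" using B.cover_l[OF x] R_closed[OF pq(1)] by blast
    then show False using 1 pq by (auto simp: leD dn_def)
  qed
qed

lemma cover_CB:
  assumes x: "x \<in> XC" and y: "y \<in> XB"
  shows "leD (Inl y) (Inr (rC x)) \<or> leD (Inr (lC x)) (Inl y)"
proof (cases "inC x")
  case True
  then obtain p q where pq: "(p, q) \<in> R" "leC x q" "leC q x" by (auto simp: inC_def)
  note cl = x y C.l_closed[OF x] C.r_closed[OF x]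
    R_closed[OF pq(1)] R_closed[OF R_r[OF pq(1)]] R_closed[OF R_l[OF pq(1)]]
  have "leD (Inl y) (Inr (rC x)) \<longleftrightarrow> leB y (rB p)"
    using leD_cong(2)[OF _ _ leD_glued_C[OF cl(4) R_r[OF pq(1)]], of "Inl y"] cl
      C.r_antimono[OF _ _ pq(2)] C.r_antimono[OF _ _ pq(3)] by (auto simp: leD(1))
  moreover have "leD (Inr (lC x)) (Inl y) \<longleftrightarrow> leB (lB p) y"
    using leD_cong(1)[OF _ _ leD_glued_C[OF cl(3) R_l[OF pq(1)]], of "Inl y"] cl
      C.l_antimono[OF _ _ pq(2)] C.l_antimono[OF _ _ pq(3)] by (auto simp: leD(1))
  ultimately show ?thesis using B.cover_l cl by simp
next
  case False
  note cl = x y C.l_closed[OF x] C.r_closed[OF x]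
  show ?thesis
  proof (rule ccontr)
    assume "\<not> ?thesis"
    then have 1: "\<not> leD (Inl y) (Inr (rC x))" and 2: "\<not> leD (Inr (lC x)) (Inl y)" by auto
    have 3: "leD (Inl y) (Inr (lC x))" "leD (Inr (rC x)) (Inl y)"
      using 1 2 leD_total cl by blast+
    have "\<not> dn (rC x) y"
    proof
      assume "dn (rC x) y"
      then obtain p q where pq: "(p, q) \<in> R" "leC (rC x) q" "leB p y" by (auto simp: dn_def)
      then have "\<not> leC q (rC x)" using inC_of_r[OF x] False by (auto simp: inC_def)
      then have "leC (lC x) q" using C.cover_l[OF x] R_closed[OF pq(1)] by blast
      then show False using 2 pq by (auto simp: leD dn_def)
    qed
    then have pos: "\<not> posB y" using 3(2) by (simp add: leD)
    then have "up y (lC x)" using 3(1) by (simp add: leD)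
    then obtain p q where pq: "(p, q) \<in> R" "leB y p" "leC q (lC x)" by (auto simp: up_def)
    then have "\<not> leC (lC x) q" using inC_of_l[OF x] False by (auto simp: inC_def)
    then have "leC q (rC x)" using C.cover_l[OF x] R_closed[OF pq(1)] by blast
    then show False using 1 pq by (auto simp: leD up_def)
  qed
qed

lemma galois_D: "\<lbrakk>x \<in> XB <+> XC; y \<in> XB <+> XC\<rbrakk>
    \<Longrightarrow> leD x (map_sum lB lC y) \<longleftrightarrow> leD y (map_sum rB rC x)"
  using B.galois C.galois galois_mixed
    preskeleton_span.galois_mixed[OF span_swapped, unfolded preskeleton_span.leD_def[OF span_swapped], folded leD_def]
  by (elim PlusE) (simp_all add: leD(1,2))

lemma cover_D: "\<lbrakk>x \<in> XB <+> XC; y \<in> XB <+> XC\<rbrakk>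
    \<Longrightarrow> leD y (map_sum rB rC x) \<or> leD (map_sum lB lC x) y"
  using B.cover_l C.cover_l cover_BC cover_CB by (elim PlusE) (simp_all add: leD(1,2))

lemma amalgam: "preskeleton (XB <+> XC) (amalg_le leB eB leC eC R) (Inl eB) (map_sum lB lC) (map_sum rB rC)"
  unfolding leD_def[symmetric]
proof
  fix x st assume x: "x \<in> XB <+> XC" and st: "st = (\<lambda>u. if leD (map_sum lB lC u) (map_sum rB rC u)
    then map_sum lB lC u else map_sum rB rC u)"
  define stB where "stB b = (if leB (lB b) (rB b) then lB b else rB b)" for b
  define stC where "stC c = (if leC (lC c) (rC c) then lC c else rC c)" for c
  have "st (Inl b) = Inl (stB b)" "st (Inr c) = Inr (stC c)" for b c
    by (simp_all add: st leD stB_def stC_def)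
  moreover have "leB (stB (stB b)) b \<and> leB b (stB (stB b))" if "b \<in> XB" for b
    using B.star_star[OF that] unfolding stB_def[abs_def] by blast
  moreover have "leC (stC (stC c)) c \<and> leC c (stC (stC c))" if "c \<in> XC" for c
    using C.star_star[OF that] unfolding stC_def[abs_def] by blast
  ultimately show "leD (st (st x)) x \<and> leD x (st (st x))"
    using x by (elim PlusE) (simp_all add: leD(1,2))
next
  show "leD x z" if "x \<in> XB <+> XC" "y \<in> XB <+> XC" "z \<in> XB <+> XC" "leD x y" "leD y z" for x y z
    using that by (rule leD_trans)
  show "leD y (map_sum lB lC x) \<or> leD (map_sum rB rC x) y" if "x \<in> XB <+> XC" "y \<in> XB <+> XC" for x y
    using preskeleton_span.cover_D[OF span_swapped, unfolded preskeleton_span.leD_def[OF span_swapped], folded leD_def] that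
    by blast
  show "map_sum lB lC x \<in> XB <+> XC" "map_sum rB rC x \<in> XB <+> XC" if "x \<in> XB <+> XC" for x
    using that B.l_closed C.l_closed B.r_closed C.r_closed by auto
qed (simp_all add: leD_total galois_D cover_D B.e_closed InlI leD B.unit_l B.unit_r)

end

section \<open>Congruence filters on chains\<close>

text \<open>On a star-involutive chain this is \<open>1\<close> if \<open>x \<le> y\<close> and otherwise the meet of the levels \<open>x \<and> x*\<close>
  and \<open>y \<and> y*\<close>: membership in a filter expresses \<open>x \<le> y\<close> in the quotient.\<close>

definition imp_rl :: "('a, 'b) reslat_scheme \<Rightarrow> 'a \<Rightarrow> 'a \<Rightarrow> 'a"
  where "imp_rl L x y = (x \<setminus>\<^bsub>L\<^esub> y) \<curlywedge>\<^bsub>L\<^esub> (y \<oslash>\<^bsub>L\<^esub> x) \<curlywedge>\<^bsub>L\<^esub> \<one>\<^bsub>L\<^esub>"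

text \<open>On a chain, \<open>delta\<close> moves a negative element to its lower cover if the two negations of the element
  differ, and fixes it otherwise. Conjugates of an element are bounded below by iterates of \<open>delta\<close>.\<close>

definition delta_rl :: "('a, 'b) reslat_scheme \<Rightarrow> 'a \<Rightarrow> 'a"
  where "delta_rl L x = star_rl L (lneg_rl L x \<curlyvee>\<^bsub>L\<^esub> rneg_rl L x)"

definition neg_cone :: "('a, 'b) reslat_scheme \<Rightarrow> 'a set"
  where "neg_cone L = {x \<in> carrier L. x \<preceq>\<^bsub>L\<^esub> \<one>\<^bsub>L\<^esub>}"

context residuated_lattice
begin

lemma imp_closed: "\<lbrakk>x \<in> carrier L; y \<in> carrier L\<rbrakk> \<Longrightarrow> imp_rl L x y \<in> carrier L"
  by (simp add: imp_rl_def meet_closed ldiv_closed rdiv_closed)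

lemma delta_closed: "x \<in> carrier L \<Longrightarrow> delta_rl L x \<in> carrier L"
  by (simp add: delta_rl_def star_closed join_closed lneg_closed rneg_closed)

lemmas closed = meet_closed join_closed ldiv_closed rdiv_closed lneg_closed rneg_closed star_closed
  imp_closed delta_closed

lemma le_imp_iff: "\<lbrakk>x \<in> carrier L; y \<in> carrier L; z \<in> carrier L\<rbrakk>
    \<Longrightarrow> z \<preceq> imp_rl L x y \<longleftrightarrow> x \<otimes> z \<preceq> y \<and> z \<otimes> x \<preceq> y \<and> z \<preceq> \<one>"
  by (simp add: imp_rl_def le_meet_iff closed ldiv_residual rdiv_residual)

lemma imp_le_one: "\<lbrakk>x \<in> carrier L; y \<in> carrier L\<rbrakk> \<Longrightarrow> imp_rl L x y \<preceq> \<one>"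
  using le_imp_iff[of x y "imp_rl L x y"] imp_closed le_refl by simp

lemma imp_neg_cone: "\<lbrakk>x \<in> carrier L; y \<in> carrier L\<rbrakk> \<Longrightarrow> imp_rl L x y \<in> neg_cone L"
  by (simp add: neg_cone_def imp_closed imp_le_one)

lemma one_le_iff: "\<lbrakk>x \<in> carrier L; x \<preceq> \<one>\<rbrakk> \<Longrightarrow> \<one> \<preceq> x \<longleftrightarrow> x = \<one>"
  using le_antisym[of x \<one>] le_refl by auto

lemma imp_eq_one: "\<lbrakk>x \<in> carrier L; y \<in> carrier L\<rbrakk> \<Longrightarrow> imp_rl L x y = \<one> \<longleftrightarrow> x \<preceq> y"
  using le_imp_iff[of x y \<one>] imp_closed[of x y] imp_le_one[of x y] one_le_iff[of "imp_rl L x y"] le_refl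
  by auto

lemma star_one: "star_rl L \<one> = \<one>"
  by (simp add: star_rl_def lneg_one rneg_one meet_idem)

lemma delta_one: "delta_rl L \<one> = \<one>"
proof -
  have "\<one> \<curlyvee> \<one> = \<one>" using le_iff_join[of \<one> \<one>] le_refl by simp
  then show ?thesis by (simp add: delta_rl_def lneg_one rneg_one star_one)
qed

lemma neg_cone_meet: "\<lbrakk>x \<in> neg_cone L; y \<in> neg_cone L\<rbrakk> \<Longrightarrow> x \<curlywedge> y \<in> neg_cone L"
  using le_trans[of "x \<curlywedge> y" x \<one>] meet_le1[of x y] by (simp add: neg_cone_def meet_closed)

lemma neg_cone_join: "\<lbrakk>x \<in> neg_cone L; y \<in> neg_cone L\<rbrakk> \<Longrightarrow> x \<curlyvee> y \<in> neg_cone L"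
  by (simp add: neg_cone_def join_closed join_le_iff)

lemma one_neg_cone: "\<one> \<in> neg_cone L"
  by (simp add: neg_cone_def le_refl)

end

section \<open>Levels and the implication term on chains\<close>

context star_chain_rl
begin

lemma lneg_antimono: "\<lbrakk>x \<in> carrier L; y \<in> carrier L; x \<preceq> y\<rbrakk> \<Longrightarrow> lneg_rl L y \<preceq> lneg_rl L x"
  and rneg_antimono: "\<lbrakk>x \<in> carrier L; y \<in> carrier L; x \<preceq> y\<rbrakk> \<Longrightarrow> rneg_rl L y \<preceq> rneg_rl L x"
  using skeleton.axioms(1)[OF skeleton] preskeleton.l_antimono preskeleton.r_antimono by fastforce+

lemma star_antimono: "\<lbrakk>x \<in> carrier L; y \<in> carrier L; x \<preceq> y\<rbrakk> \<Longrightarrow> star_rl L y \<preceq> star_rl L x"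
  unfolding star_rl_def by (intro meet_mono lneg_antimono rneg_antimono closed)

lemma star_le: "\<lbrakk>x \<in> carrier L; y \<in> carrier L\<rbrakk> \<Longrightarrow> star_rl L x \<preceq> y \<longleftrightarrow> star_rl L y \<preceq> x"
  using star_antimono[of "star_rl L x" y] star_antimono[of "star_rl L y" x] star_star closed by auto

lemma delta_le: "x \<in> carrier L \<Longrightarrow> delta_rl L x \<preceq> x"
  unfolding delta_rl_def
  by (subst star_le)
    (auto simp: closed star_rl_def[of L x] intro: le_trans[OF _ _ _ meet_le1 le_join1])

lemma delta_mono: "\<lbrakk>x \<in> carrier L; y \<in> carrier L; x \<preceq> y\<rbrakk> \<Longrightarrow> delta_rl L x \<preceq> delta_rl L y"
  unfolding delta_rl_def by (intro star_antimono join_mono lneg_antimono rneg_antimono closed)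

lemma delta_meet: "\<lbrakk>x \<in> carrier L; y \<in> carrier L\<rbrakk>
    \<Longrightarrow> delta_rl L (x \<curlywedge> y) = delta_rl L x \<curlywedge> delta_rl L y"
  using le_total[of x y] delta_mono[of x y] delta_mono[of y x] le_absorb[of x y] le_absorb[of y x]
    le_absorb[of "delta_rl L x" "delta_rl L y"] le_absorb[of "delta_rl L y" "delta_rl L x"] closed
  by auto

lemma delta_join: "\<lbrakk>x \<in> carrier L; y \<in> carrier L\<rbrakk>
    \<Longrightarrow> delta_rl L (x \<curlyvee> y) = delta_rl L x \<curlyvee> delta_rl L y"
  using le_total[of x y] delta_mono[of x y] delta_mono[of y x] le_absorb[of x y] le_absorb[of y x]
    le_absorb[of "delta_rl L x" "delta_rl L y"] le_absorb[of "delta_rl L y" "delta_rl L x"] closed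
  by auto

definition level :: "'a \<Rightarrow> 'a" where "level x = x \<curlywedge> star_rl L x"

lemma level_closed: "x \<in> carrier L \<Longrightarrow> level x \<in> carrier L"
  by (simp add: level_def closed)

lemma level_star: "x \<in> carrier L \<Longrightarrow> level (star_rl L x) = level x"
  by (simp add: level_def star_star meet_comm closed)

lemma imp_eq:
  assumes x: "x \<in> carrier L" and y: "y \<in> carrier L"
  shows "imp_rl L x y = (if x \<preceq> y then \<one> else level x \<curlywedge> level y)"
proof (cases "x \<preceq> y")
  case True
  then show ?thesis using imp_eq_one x y by simp
next
  case False
  then have yx: "y \<preceq> x" using le_total x y by blast
  have s: "star_rl L x \<preceq> star_rl L y" using star_antimono yx x y by simp
  have "imp_rl L x y = level x \<curlywedge> level y"
  proof (rule eq_iff_lower)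
    fix z assume z: "z \<in> carrier L"
    \<comment> \<open>This accounts for the conjunct 1 in \<open>imp_rl\<close>: as \<open>y\<close>
      is below \<open>x\<close>, either \<open>y\<close> is negative or \<open>x\<close> is
      positive, and then the star of \<open>x\<close> is negative.\<close>
    have "z \<preceq> \<one>" if "z \<preceq> y" "z \<preceq> star_rl L x"
    proof (cases "y \<preceq> \<one>")
      case True
      then show ?thesis using le_trans[of z y \<one>] that y z by simp
    next
      case False
      then have "\<one> \<preceq> x" using le_total[of y \<one>] le_trans[of \<one> y x] x y yx by simp
      then have "star_rl L x \<preceq> \<one>" using star_antimono[of \<one> x] star_one x by simp
      then show ?thesis using le_trans[of z "star_rl L x" \<one>] that x z closed by simp
    qed
    then show "z \<preceq> imp_rl L x y \<longleftrightarrow> z \<preceq> level x \<curlywedge> level y"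
      using False x y z yx s le_trans[of z y x] le_trans[of z "star_rl L x" "star_rl L y"]
      by (auto simp: imp_rl_def ldiv_eq rdiv_eq level_def le_meet_iff closed star_rl_def[of L x])
  qed (use x y closed level_closed in auto)
  with False show ?thesis by simp
qed

lemma level_le: "x \<in> carrier L \<Longrightarrow> level x \<preceq> x" "x \<in> carrier L \<Longrightarrow> level x \<preceq> star_rl L x"
  by (simp_all add: level_def meet_le1 meet_le2 closed)

lemma star_le_neg: "x \<in> carrier L \<Longrightarrow> star_rl L x \<preceq> lneg_rl L x" "x \<in> carrier L \<Longrightarrow> star_rl L x \<preceq> rneg_rl L x"
  by (simp_all add: star_rl_def meet_le1 meet_le2 closed)

text \<open>The chain \<open>delta (level x)\<close>, \<open>level x\<close>, star of
  \<open>x\<close>, \<open>v\<close> increases. For the bound by the star of \<open>v\<close>: as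
  \<open>level x\<close> is below \<open>x\<close>, the antitone negations put \<open>v\<close>
  below the join of the two negations of \<open>level x\<close>, and the star of that join is
  \<open>delta (level x)\<close>.\<close>

lemma delta_level_le:
  assumes x: "x \<in> carrier L" and v: "v = lneg_rl L x \<or> v = rneg_rl L x"
  shows "delta_rl L (level x) \<preceq> level v"
proof -
  have vc: "v \<in> carrier L" using x v closed by auto
  note cl = x vc level_closed[OF x] star_closed[OF x] delta_closed[OF level_closed[OF x]]
  have "delta_rl L (level x) \<preceq> level x" "level x \<preceq> star_rl L x" "star_rl L x \<preceq> v"
    using cl v star_le_neg delta_le level_le by auto
  then have 1: "delta_rl L (level x) \<preceq> v"
    using le_trans[of "delta_rl L (level x)" "level x" v] le_trans[of "level x" "star_rl L x" v] cl by simp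
  have "v \<preceq> lneg_rl L (level x) \<curlyvee> rneg_rl L (level x)"
    using v lneg_antimono[of "level x" x] rneg_antimono[of "level x" x] level_le cl
      le_trans[of "lneg_rl L x" "lneg_rl L (level x)" "lneg_rl L (level x) \<curlyvee> rneg_rl L (level x)"]
      le_trans[of "rneg_rl L x" "rneg_rl L (level x)" "lneg_rl L (level x) \<curlyvee> rneg_rl L (level x)"]
      le_join1 le_join2 closed by auto
  then have "delta_rl L (level x) \<preceq> star_rl L v"
    unfolding delta_rl_def using cl closed star_antimono by simp
  with 1 show ?thesis unfolding level_def[of v] using cl closed le_meet by simp
qed

text \<open>Write \<open>u\<close> for \<open>level v\<close>. From \<open>u\<close> below
  \<open>v\<close>, the Galois connection puts \<open>x\<close> below a negation of
  \<open>u\<close>; from \<open>u\<close> below the star of \<open>v\<close>, the star of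
  \<open>x\<close> lies below a negation of \<open>u\<close> as well. Taking the star of the join of
  both negations yields the two bounds on \<open>delta u\<close>.\<close>

lemma delta_level_neg_le:
  assumes x: "x \<in> carrier L" and v: "v = lneg_rl L x \<or> v = rneg_rl L x"
  shows "delta_rl L (level v) \<preceq> level x"
proof -
  define u where "u = level v"
  have vc: "v \<in> carrier L" using x v closed by auto
  have uc: "u \<in> carrier L" using vc level_closed by (simp add: u_def)
  have u: "u \<preceq> v" "u \<preceq> star_rl L v" using level_le[OF vc] by (simp_all add: u_def)
  note cl = x vc uc star_closed lneg_closed rneg_closed join_closed
  have "x \<preceq> lneg_rl L u \<or> x \<preceq> rneg_rl L u"
    using v u(1) galois[of x u] galois[of u x] cl by auto
  then have "x \<preceq> lneg_rl L u \<curlyvee> rneg_rl L u"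
    using le_join1[of "lneg_rl L u" "rneg_rl L u"] le_join2[of "lneg_rl L u" "rneg_rl L u"]
      le_trans[of x "lneg_rl L u" "lneg_rl L u \<curlyvee> rneg_rl L u"]
      le_trans[of x "rneg_rl L u" "lneg_rl L u \<curlyvee> rneg_rl L u"] cl by auto
  then have 1: "delta_rl L u \<preceq> star_rl L x"
    unfolding delta_rl_def using star_antimono cl by simp
  have "star_rl L x \<preceq> v" using star_le_neg[OF x] v by auto
  moreover have "v \<preceq> star_rl L u" using star_antimono[OF uc _ u(2)] star_star cl by simp
  moreover have "star_rl L u \<preceq> lneg_rl L u" "lneg_rl L u \<preceq> lneg_rl L u \<curlyvee> rneg_rl L u"
    using star_le_neg le_join1 cl by simp_all
  ultimately have "star_rl L x \<preceq> lneg_rl L u \<curlyvee> rneg_rl L u"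
    using le_trans[of "star_rl L x" v "star_rl L u"] le_trans[of "star_rl L x" "star_rl L u" "lneg_rl L u"]
      le_trans[of "star_rl L x" "lneg_rl L u" "lneg_rl L u \<curlyvee> rneg_rl L u"] cl by simp
  then have 2: "delta_rl L u \<preceq> x"
    unfolding delta_rl_def using star_le[of x "lneg_rl L u \<curlyvee> rneg_rl L u"]
      star_antimono[of "star_rl L x" "lneg_rl L u \<curlyvee> rneg_rl L u"] star_star cl by simp
  from 1 2 show ?thesis unfolding level_def[of x] u_def[symmetric] using cl closed le_meet by simp
qed

lemma delta_le_one: "x \<in> carrier L \<Longrightarrow> x \<preceq> \<one> \<Longrightarrow> delta_rl L x \<preceq> \<one>"
  using le_trans[of "delta_rl L x" x \<one>] delta_le closed by simp

lemma imp_self: "x \<in> carrier L \<Longrightarrow> imp_rl L x x = \<one>"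
  by (simp add: imp_eq_one le_refl)

lemma imp_total: "\<lbrakk>x \<in> carrier L; y \<in> carrier L\<rbrakk> \<Longrightarrow> imp_rl L x y = \<one> \<or> imp_rl L y x = \<one>"
  using le_total imp_eq_one by auto

end

section \<open>Semilinear algebras\<close>

context star_chain_rl
begin

text \<open>If \<open>a \<preceq> b\<close> fails then so does \<open>x \<preceq> y\<close>, and
  both implications are meets of two levels, compared factor by factor. The crossed alternative is
  needed for the Galois law, where the two arguments trade places.\<close>

lemma delta_imp_le:
  assumes cl: "x \<in> carrier L" "y \<in> carrier L" "a \<in> carrier L" "b \<in> carrier L"
    and le: "x \<preceq> y \<Longrightarrow> a \<preceq> b"
    and lev: "delta_rl L (level x) \<preceq> level a \<and> delta_rl L (level y) \<preceq> level b
      \<or> delta_rl L (level x) \<preceq> level b \<and> delta_rl L (level y) \<preceq> level a"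
  shows "delta_rl L (imp_rl L x y) \<preceq> imp_rl L a b"
proof (cases "a \<preceq> b")
  case True
  then show ?thesis using imp_eq_one[of a b] delta_le_one imp_closed imp_le_one cl by simp
next
  case False
  note lc = cl level_closed delta_closed
  have "delta_rl L (imp_rl L x y) = delta_rl L (level x) \<curlywedge> delta_rl L (level y)"
    using False le imp_eq cl delta_meet lc by auto
  moreover have "imp_rl L a b = level a \<curlywedge> level b" "imp_rl L a b = level b \<curlywedge> level a"
    using False imp_eq cl meet_comm lc by auto
  ultimately show ?thesis using lev meet_mono lc by metis
qed

lemma delta_level: "x \<in> carrier L \<Longrightarrow> delta_rl L (level x) \<preceq> level x"
  by (simp add: delta_le level_closed)

text \<open>Both implications equal 1 in the same cases, but their levels belong to \<open>x\<close>
  and a negation of \<open>y\<close> on one side, to \<open>y\<close> and a negation of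
  \<open>x\<close> on the other. These agree only up to one \<open>delta_rl\<close>, which closure
  of filters under \<open>delta_rl\<close> absorbs.\<close>

lemma delta_imp_galois:
  assumes "x \<in> carrier L" "y \<in> carrier L"
  shows "delta_rl L (imp_rl L x (lneg_rl L y)) \<preceq> imp_rl L y (rneg_rl L x)"
    and "delta_rl L (imp_rl L y (rneg_rl L x)) \<preceq> imp_rl L x (lneg_rl L y)"
  by (rule delta_imp_le; use assms galois closed delta_level_le delta_level_neg_le in auto)+

lemma imp_cover:
  assumes "x \<in> carrier L" "y \<in> carrier L"
  shows "imp_rl L y (rneg_rl L x) = \<one> \<or> imp_rl L (lneg_rl L x) y = \<one>"
    and "imp_rl L y (lneg_rl L x) = \<one> \<or> imp_rl L (rneg_rl L x) y = \<one>"
  using assms cover_l cover_r imp_eq_one closed by auto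

lemma imp_meet: "\<lbrakk>x \<in> carrier L; y \<in> carrier L\<rbrakk> \<Longrightarrow> imp_rl L x (x \<curlywedge> y) = imp_rl L x y"
  using imp_self[of x] imp_eq_one[of x y] by (auto simp: meet_min)

lemma imp_join: "\<lbrakk>x \<in> carrier L; y \<in> carrier L\<rbrakk> \<Longrightarrow> imp_rl L (x \<curlyvee> y) y = imp_rl L x y"
  using imp_self[of y] imp_eq_one[of x y] by (auto simp: join_max)

lemma imp_star: "\<lbrakk>x \<in> carrier L; y \<in> carrier L\<rbrakk> \<Longrightarrow> imp_rl L (star_rl L y) (star_rl L x) = imp_rl L x y"
  using star_antimono[of x y] star_antimono[of "star_rl L y" "star_rl L x"] star_star closed
  by (auto simp: imp_eq level_star level_closed intro: meet_comm)

text \<open>The product formula cut into pieces free of case distinctions: the bounds always hold,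
  and \<open>delta_imp_mult\<close> and \<open>imp_mult\<close> decide which one is attained modulo
  a prime filter. The residuals are treated in the same way.\<close>

lemma mult_bounds: "\<lbrakk>x \<in> carrier L; y \<in> carrier L\<rbrakk> \<Longrightarrow> x \<curlywedge> y \<preceq> x \<otimes> y \<and> x \<otimes> y \<preceq> x \<curlyvee> y"
  using le_total[of x y] le_refl by (auto simp: mult_eq meet_min join_max)

lemma ldiv_bounds: "\<lbrakk>x \<in> carrier L; z \<in> carrier L\<rbrakk>
    \<Longrightarrow> rneg_rl L x \<curlywedge> z \<preceq> x \<setminus> z \<and> x \<setminus> z \<preceq> rneg_rl L x \<curlyvee> z"
  using le_total[of "rneg_rl L x" z] le_refl closed by (auto simp: ldiv_eq meet_min join_max)

lemma rdiv_bounds: "\<lbrakk>y \<in> carrier L; z \<in> carrier L\<rbrakk>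
    \<Longrightarrow> lneg_rl L y \<curlywedge> z \<preceq> z \<oslash> y \<and> z \<oslash> y \<preceq> lneg_rl L y \<curlyvee> z"
  using le_total[of "lneg_rl L y" z] le_refl closed by (auto simp: rdiv_eq meet_min join_max)

lemma delta_imp_join_meet:
  assumes "x \<in> carrier L" "y \<in> carrier L" "a \<in> carrier L" "b \<in> carrier L" "\<not> x \<preceq> y"
    and "delta_rl L (level x) \<preceq> level a \<and> delta_rl L (level y) \<preceq> level b
      \<or> delta_rl L (level x) \<preceq> level b \<and> delta_rl L (level y) \<preceq> level a"
  shows "delta_rl L (imp_rl L x y) \<preceq> imp_rl L (a \<curlyvee> b) (a \<curlywedge> b)"
  by (rule delta_imp_le) (use assms closed in \<open>auto simp: meet_min join_max\<close>)

lemma delta_imp_mult: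
  assumes "x \<in> carrier L" "y \<in> carrier L"
  shows "delta_rl L (imp_rl L x (lneg_rl L y)) \<preceq> imp_rl L (x \<otimes> y) (x \<curlywedge> y)"
proof (cases "x \<preceq> lneg_rl L y")
  case True
  then show ?thesis
    using assms delta_le_one imp_le_one by (simp add: mult_eq imp_self closed)
next
  case False
  then show ?thesis
    using delta_imp_join_meet[of x "lneg_rl L y" x y] assms delta_level delta_level_neg_le[of y]
    by (simp add: mult_eq closed)
qed

lemma imp_mult: "\<lbrakk>x \<in> carrier L; y \<in> carrier L\<rbrakk>
    \<Longrightarrow> imp_rl L x (lneg_rl L y) = \<one> \<or> imp_rl L (x \<curlyvee> y) (x \<otimes> y) = \<one>"
  by (auto simp: mult_eq imp_self imp_eq_one closed le_refl)

lemma delta_imp_ldiv: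
  assumes "x \<in> carrier L" "z \<in> carrier L"
  shows "delta_rl L (imp_rl L x z) \<preceq> imp_rl L (rneg_rl L x \<curlyvee> z) (x \<setminus> z)"
proof (cases "x \<preceq> z")
  case True
  then show ?thesis
    using assms delta_le_one imp_le_one by (simp add: ldiv_eq imp_self closed)
next
  case False
  then show ?thesis
    using delta_imp_join_meet[of x z "rneg_rl L x" z] assms delta_level delta_level_le[of x]
    by (simp add: ldiv_eq closed)
qed

lemma imp_ldiv: "\<lbrakk>x \<in> carrier L; z \<in> carrier L\<rbrakk>
    \<Longrightarrow> imp_rl L x z = \<one> \<or> imp_rl L (x \<setminus> z) (rneg_rl L x \<curlywedge> z) = \<one>"
  by (auto simp: ldiv_eq imp_self imp_eq_one closed le_refl)

lemma delta_imp_rdiv: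
  assumes "y \<in> carrier L" "z \<in> carrier L"
  shows "delta_rl L (imp_rl L y z) \<preceq> imp_rl L (lneg_rl L y \<curlyvee> z) (z \<oslash> y)"
proof (cases "y \<preceq> z")
  case True
  then show ?thesis
    using assms delta_le_one imp_le_one by (simp add: rdiv_eq imp_self closed)
next
  case False
  then show ?thesis
    using delta_imp_join_meet[of y z "lneg_rl L y" z] assms delta_level delta_level_le[of y]
    by (simp add: rdiv_eq closed)
qed

lemma imp_rdiv: "\<lbrakk>y \<in> carrier L; z \<in> carrier L\<rbrakk>
    \<Longrightarrow> imp_rl L y z = \<one> \<or> imp_rl L (z \<oslash> y) (lneg_rl L y \<curlywedge> z) = \<one>"
  by (auto simp: rdiv_eq imp_self imp_eq_one closed le_refl)

lemma join_eq_one: "\<lbrakk>x \<in> carrier L; y \<in> carrier L; x \<preceq> \<one>; y \<preceq> \<one>\<rbrakk>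
    \<Longrightarrow> x \<curlyvee> y = \<one> \<longleftrightarrow> x = \<one> \<or> y = \<one>"
  using join_max[of x y] one_le_iff[of y] one_le_iff[of x] le_total[of x y] by auto

end

section \<open>Separating families of homomorphisms into star-involutive chains\<close>

lemma hom_rlD:
  assumes "g \<in> hom_rl L M"
  shows "x \<in> carrier L \<Longrightarrow> g x \<in> carrier M" "g \<one>\<^bsub>L\<^esub> = \<one>\<^bsub>M\<^esub>"
    "\<lbrakk>x \<in> carrier L; y \<in> carrier L\<rbrakk> \<Longrightarrow> g (x \<otimes>\<^bsub>L\<^esub> y) = g x \<otimes>\<^bsub>M\<^esub> g y"
    "\<lbrakk>x \<in> carrier L; y \<in> carrier L\<rbrakk> \<Longrightarrow> g (x \<curlywedge>\<^bsub>L\<^esub> y) = g x \<curlywedge>\<^bsub>M\<^esub> g y"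
    "\<lbrakk>x \<in> carrier L; y \<in> carrier L\<rbrakk> \<Longrightarrow> g (x \<curlyvee>\<^bsub>L\<^esub> y) = g x \<curlyvee>\<^bsub>M\<^esub> g y"
    "\<lbrakk>x \<in> carrier L; y \<in> carrier L\<rbrakk> \<Longrightarrow> g (x \<setminus>\<^bsub>L\<^esub> y) = g x \<setminus>\<^bsub>M\<^esub> g y"
    "\<lbrakk>x \<in> carrier L; y \<in> carrier L\<rbrakk> \<Longrightarrow> g (x \<oslash>\<^bsub>L\<^esub> y) = g x \<oslash>\<^bsub>M\<^esub> g y"
  using assms by (auto simp: hom_rl_def hom_def)

context residuated_lattice
begin

lemma hom_derived:
  assumes g: "g \<in> hom_rl L M"
  shows "x \<in> carrier L \<Longrightarrow> g (lneg_rl L x) = lneg_rl M (g x)"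
    "x \<in> carrier L \<Longrightarrow> g (rneg_rl L x) = rneg_rl M (g x)"
    "x \<in> carrier L \<Longrightarrow> g (star_rl L x) = star_rl M (g x)"
    "x \<in> carrier L \<Longrightarrow> g (delta_rl L x) = delta_rl M (g x)"
    "\<lbrakk>x \<in> carrier L; y \<in> carrier L\<rbrakk> \<Longrightarrow> g (imp_rl L x y) = imp_rl M (g x) (g y)"
proof -
  show 1: "g (lneg_rl L x) = lneg_rl M (g x)" "g (rneg_rl L x) = rneg_rl M (g x)" if "x \<in> carrier L" for x
    using that by (simp_all add: lneg_rl_def rneg_rl_def hom_rlD[OF g])
  show 2: "g (star_rl L x) = star_rl M (g x)" if "x \<in> carrier L" for x
    using that by (simp add: star_rl_def hom_rlD[OF g] 1 closed)
  show "g (delta_rl L x) = delta_rl M (g x)" if "x \<in> carrier L"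
    using that by (simp add: delta_rl_def hom_rlD[OF g] 1 2 closed)
  show "g (imp_rl L x y) = imp_rl M (g x) (g y)" if "x \<in> carrier L" "y \<in> carrier L"
    using that by (simp add: imp_rl_def hom_rlD[OF g] closed)
qed

lemmas hom_simps = hom_rlD hom_derived

lemma hom_le: "\<lbrakk>g \<in> hom_rl L M; x \<in> carrier L; y \<in> carrier L; x \<preceq> y\<rbrakk> \<Longrightarrow> g x \<preceq>\<^bsub>M\<^esub> g y"
  using hom_rlD(4)[of g L M x y] by (simp add: le_rl_def)

end

text \<open>The homomorphisms need only separate points, so a subalgebra keeps the same chains.
  Index set and chains may live in any types.\<close>

locale star_semilinear = residuated_lattice L for L :: "('a, 'b) reslat_scheme" (structure) +
  fixes I :: "'i set" and F :: "'i \<Rightarrow> ('c, 'd) reslat_scheme" and h :: "'i \<Rightarrow> 'a \<Rightarrow> 'c"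
  assumes hom: "i \<in> I \<Longrightarrow> h i \<in> hom_rl L (F i)"
    and chains: "i \<in> I \<Longrightarrow> star_chain (F i)"
    and separating: "\<lbrakk>x \<in> carrier L; y \<in> carrier L; \<And>i. i \<in> I \<Longrightarrow> h i x = h i y\<rbrakk> \<Longrightarrow> x = y"
begin

lemma chain: "i \<in> I \<Longrightarrow> star_chain_rl (F i)"
  using chains[of i]
  by (simp add: star_chain_rl_def star_chain_rl_axioms_def star_chain_def totally_ordered_rl_def)

lemma le_iff:
  assumes "x \<in> carrier L" "y \<in> carrier L"
  shows "x \<preceq> y \<longleftrightarrow> (\<forall>i \<in> I. h i x \<preceq>\<^bsub>F i\<^esub> h i y)"
proof
  show "\<forall>i \<in> I. h i x \<preceq>\<^bsub>F i\<^esub> h i y" if "x \<preceq> y"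
    using that hom_le hom assms by blast
  show "x \<preceq> y" if "\<forall>i \<in> I. h i x \<preceq>\<^bsub>F i\<^esub> h i y"
    unfolding le_rl_def
    by (rule separating) (use that assms in \<open>auto simp: closed hom_rlD[OF hom] le_rl_def\<close>)
qed

lemma eq_iff:
  assumes "x \<in> carrier L" "y \<in> carrier L"
  shows "x = y \<longleftrightarrow> (\<forall>i \<in> I. h i x = h i y)"
  using assms separating by blast

lemmas hs = hom_simps[OF hom]

lemma mult_idem: "x \<in> carrier L \<Longrightarrow> x \<otimes> x = x"
  by (rule separating) (simp_all add: hs star_chain_rl.mult_idem[OF chain])

lemma star_star: "x \<in> carrier L \<Longrightarrow> star_rl L (star_rl L x) = x"
  by (rule separating) (simp_all add: hs closed star_chain_rl.star_star[OF chain])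

lemma delta_le: "x \<in> carrier L \<Longrightarrow> delta_rl L x \<preceq> x"
  by (simp add: le_iff hs closed star_chain_rl.delta_le[OF chain])

lemma delta_mono: "\<lbrakk>x \<in> carrier L; y \<in> carrier L; x \<preceq> y\<rbrakk> \<Longrightarrow> delta_rl L x \<preceq> delta_rl L y"
  by (simp add: le_iff hs closed star_chain_rl.delta_mono[OF chain])

lemma delta_meet: "\<lbrakk>x \<in> carrier L; y \<in> carrier L\<rbrakk>
    \<Longrightarrow> delta_rl L (x \<curlywedge> y) = delta_rl L x \<curlywedge> delta_rl L y"
  by (simp add: eq_iff hs closed star_chain_rl.delta_meet[OF chain])

lemma delta_join: "\<lbrakk>x \<in> carrier L; y \<in> carrier L\<rbrakk>
    \<Longrightarrow> delta_rl L (x \<curlyvee> y) = delta_rl L x \<curlyvee> delta_rl L y"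
  by (simp add: eq_iff hs closed star_chain_rl.delta_join[OF chain])

text \<open>The meet \<open>w\<close> on the left is idempotent: multiplying \<open>x\<close> by
  \<open>w\<close> twice leads first below \<open>y\<close> and then below \<open>z\<close>, but is
  the same as multiplying once.\<close>

lemma imp_trans:
  assumes c: "x \<in> carrier L" "y \<in> carrier L" "z \<in> carrier L"
  shows "imp_rl L x y \<curlywedge> imp_rl L y z \<preceq> imp_rl L x z" (is "?w \<preceq> _")
proof -
  have w: "?w \<in> carrier L" "?w \<preceq> imp_rl L x y" "?w \<preceq> imp_rl L y z"
    using c by (simp_all add: closed meet_le1 meet_le2)
  then have le: "x \<otimes> ?w \<preceq> y" "?w \<otimes> x \<preceq> y" "y \<otimes> ?w \<preceq> z" "?w \<otimes> y \<preceq> z" "?w \<preceq> \<one>"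
    using c le_imp_iff by auto
  have "x \<otimes> ?w \<preceq> y \<otimes> ?w" "?w \<otimes> x \<preceq> ?w \<otimes> y"
    using mult_mono_left[OF _ c(2) w(1) le(1)] mult_mono_right[OF _ c(2) w(1) le(2)] c w(1)
      m_assoc[of x ?w ?w] m_assoc[of ?w ?w x] mult_idem by simp_all
  then have "x \<otimes> ?w \<preceq> z" "?w \<otimes> x \<preceq> z"
    using le_trans[of "x \<otimes> ?w" "y \<otimes> ?w" z] le_trans[of "?w \<otimes> x" "?w \<otimes> y" z] le c w(1) by simp_all
  then show ?thesis using le(5) c w(1) le_imp_iff by simp
qed

lemma delta_imp_galois:
  assumes "x \<in> carrier L" "y \<in> carrier L"
  shows "delta_rl L (imp_rl L x (lneg_rl L y)) \<preceq> imp_rl L y (rneg_rl L x)"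
    and "delta_rl L (imp_rl L y (rneg_rl L x)) \<preceq> imp_rl L x (lneg_rl L y)"
  using assms by (simp_all add: le_iff hs closed star_chain_rl.delta_imp_galois[OF chain])

text \<open>Turns a disjunction valid in every coordinate, with the valid alternative depending on
  the coordinate, into one identity; \<open>joinD\<close> turns it back into a disjunction modulo a
  prime filter.\<close>

lemma join_oneI:
  assumes "x \<in> neg_cone L" "y \<in> neg_cone L" "\<And>i. i \<in> I \<Longrightarrow> h i x = \<one>\<^bsub>F i\<^esub> \<or> h i y = \<one>\<^bsub>F i\<^esub>"
  shows "x \<curlyvee> y = \<one>"
  using assms hom_le[OF hom, of _ x \<one>] hom_le[OF hom, of _ y \<one>]
  by (auto simp: eq_iff neg_cone_def hs closed star_chain_rl.join_eq_one[OF chain])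

lemma imp_total: "\<lbrakk>x \<in> carrier L; y \<in> carrier L\<rbrakk> \<Longrightarrow> imp_rl L x y \<curlyvee> imp_rl L y x = \<one>"
  by (rule join_oneI) (simp_all add: imp_neg_cone closed hs star_chain_rl.imp_total[OF chain])

lemma imp_cover:
  assumes "x \<in> carrier L" "y \<in> carrier L"
  shows "imp_rl L y (rneg_rl L x) \<curlyvee> imp_rl L (lneg_rl L x) y = \<one>"
    and "imp_rl L y (lneg_rl L x) \<curlyvee> imp_rl L (rneg_rl L x) y = \<one>"
  by (rule join_oneI; use assms in \<open>simp add: imp_neg_cone closed hs star_chain_rl.imp_cover[OF chain]\<close>)+

lemma imp_meet: "\<lbrakk>x \<in> carrier L; y \<in> carrier L\<rbrakk> \<Longrightarrow> imp_rl L x (x \<curlywedge> y) = imp_rl L x y"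
  by (simp add: eq_iff hs closed star_chain_rl.imp_meet[OF chain])

lemma imp_join: "\<lbrakk>x \<in> carrier L; y \<in> carrier L\<rbrakk> \<Longrightarrow> imp_rl L (x \<curlyvee> y) y = imp_rl L x y"
  by (simp add: eq_iff hs closed star_chain_rl.imp_join[OF chain])

lemma imp_star: "\<lbrakk>x \<in> carrier L; y \<in> carrier L\<rbrakk> \<Longrightarrow> imp_rl L (star_rl L y) (star_rl L x) = imp_rl L x y"
  by (simp add: eq_iff hs closed star_chain_rl.imp_star[OF chain])

lemma mult_bounds: "\<lbrakk>x \<in> carrier L; y \<in> carrier L\<rbrakk> \<Longrightarrow> x \<curlywedge> y \<preceq> x \<otimes> y \<and> x \<otimes> y \<preceq> x \<curlyvee> y"
  by (simp add: le_iff hs closed star_chain_rl.mult_bounds[OF chain])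

lemma ldiv_bounds: "\<lbrakk>x \<in> carrier L; z \<in> carrier L\<rbrakk>
    \<Longrightarrow> rneg_rl L x \<curlywedge> z \<preceq> x \<setminus> z \<and> x \<setminus> z \<preceq> rneg_rl L x \<curlyvee> z"
  by (simp add: le_iff hs closed star_chain_rl.ldiv_bounds[OF chain])

lemma rdiv_bounds: "\<lbrakk>y \<in> carrier L; z \<in> carrier L\<rbrakk>
    \<Longrightarrow> lneg_rl L y \<curlywedge> z \<preceq> z \<oslash> y \<and> z \<oslash> y \<preceq> lneg_rl L y \<curlyvee> z"
  by (simp add: le_iff hs closed star_chain_rl.rdiv_bounds[OF chain])

lemma delta_imp_mult: "\<lbrakk>x \<in> carrier L; y \<in> carrier L\<rbrakk>
    \<Longrightarrow> delta_rl L (imp_rl L x (lneg_rl L y)) \<preceq> imp_rl L (x \<otimes> y) (x \<curlywedge> y)"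
  by (simp add: le_iff hs closed star_chain_rl.delta_imp_mult[OF chain])

lemma imp_mult: "\<lbrakk>x \<in> carrier L; y \<in> carrier L\<rbrakk>
    \<Longrightarrow> imp_rl L x (lneg_rl L y) \<curlyvee> imp_rl L (x \<curlyvee> y) (x \<otimes> y) = \<one>"
  by (rule join_oneI) (simp_all add: imp_neg_cone closed hs star_chain_rl.imp_mult[OF chain])

lemma delta_imp_ldiv: "\<lbrakk>x \<in> carrier L; z \<in> carrier L\<rbrakk>
    \<Longrightarrow> delta_rl L (imp_rl L x z) \<preceq> imp_rl L (rneg_rl L x \<curlyvee> z) (x \<setminus> z)"
  by (simp add: le_iff hs closed star_chain_rl.delta_imp_ldiv[OF chain])

lemma imp_ldiv: "\<lbrakk>x \<in> carrier L; z \<in> carrier L\<rbrakk>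
    \<Longrightarrow> imp_rl L x z \<curlyvee> imp_rl L (x \<setminus> z) (rneg_rl L x \<curlywedge> z) = \<one>"
  by (rule join_oneI) (simp_all add: imp_neg_cone closed hs star_chain_rl.imp_ldiv[OF chain])

lemma delta_imp_rdiv: "\<lbrakk>y \<in> carrier L; z \<in> carrier L\<rbrakk>
    \<Longrightarrow> delta_rl L (imp_rl L y z) \<preceq> imp_rl L (lneg_rl L y \<curlyvee> z) (z \<oslash> y)"
  by (simp add: le_iff hs closed star_chain_rl.delta_imp_rdiv[OF chain])

lemma imp_rdiv: "\<lbrakk>y \<in> carrier L; z \<in> carrier L\<rbrakk>
    \<Longrightarrow> imp_rl L y z \<curlyvee> imp_rl L (z \<oslash> y) (lneg_rl L y \<curlywedge> z) = \<one>"
  by (rule join_oneI) (simp_all add: imp_neg_cone closed hs star_chain_rl.imp_rdiv[OF chain])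

end

section \<open>Prime filters\<close>

definition delta_filter :: "('a, 'b) reslat_scheme \<Rightarrow> 'a set \<Rightarrow> bool"
  where "delta_filter L P \<longleftrightarrow> P \<subseteq> neg_cone L \<and> \<one>\<^bsub>L\<^esub> \<in> P \<and>
    (\<forall>x \<in> P. \<forall>y \<in> neg_cone L. x \<preceq>\<^bsub>L\<^esub> y \<longrightarrow> y \<in> P) \<and>
    (\<forall>x \<in> P. \<forall>y \<in> P. x \<curlywedge>\<^bsub>L\<^esub> y \<in> P) \<and> (\<forall>x \<in> P. delta_rl L x \<in> P)"

text \<open>The whole negative cone counts as prime, with the one-element chain as quotient. A
  proper filter may restrict to the whole cone of a subalgebra, and this keeps restrictions
  prime.\<close>

definition prime_filter :: "('a, 'b) reslat_scheme \<Rightarrow> 'a set \<Rightarrow> bool"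
  where "prime_filter L P \<longleftrightarrow> delta_filter L P \<and>
    (\<forall>x \<in> neg_cone L. \<forall>y \<in> neg_cone L. x \<curlyvee>\<^bsub>L\<^esub> y \<in> P \<longrightarrow> x \<in> P \<or> y \<in> P)"

context star_semilinear
begin

abbreviation dpow :: "nat \<Rightarrow> 'a \<Rightarrow> 'a" where "dpow n x \<equiv> (delta_rl L ^^ n) x"

lemma neg_coneD: "x \<in> neg_cone L \<Longrightarrow> x \<in> carrier L" "x \<in> neg_cone L \<Longrightarrow> x \<preceq> \<one>"
  by (simp_all add: neg_cone_def)

lemma neg_cone_down: "\<lbrakk>x \<in> carrier L; y \<in> neg_cone L; x \<preceq> y\<rbrakk> \<Longrightarrow> x \<in> neg_cone L"
  using le_trans[of x y \<one>] by (simp add: neg_cone_def)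

lemma dpow_closed: "x \<in> carrier L \<Longrightarrow> dpow n x \<in> carrier L"
  by (induction n) (simp_all add: closed)

lemma dpow_antimono:
  assumes "x \<in> carrier L" "m \<le> n"
  shows "dpow n x \<preceq> dpow m x"
  using assms(2)
proof (induction rule: dec_induct)
  case base
  then show ?case using assms dpow_closed le_refl by simp
next
  case (step n)
  then show ?case
    using assms(1) dpow_closed[of x] delta_le[of "dpow n x"] le_trans[of "dpow (Suc n) x" "dpow n x" "dpow m x"]
      delta_closed by simp
qed

lemma dpow_le: "x \<in> carrier L \<Longrightarrow> dpow n x \<preceq> x"
  using dpow_antimono[of x 0 n] by simp

lemma dpow_neg_cone: "x \<in> neg_cone L \<Longrightarrow> dpow n x \<in> neg_cone L"
  using neg_cone_down[of "dpow n x" x] dpow_le dpow_closed neg_coneD by simp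

lemma dpow_join: "\<lbrakk>x \<in> carrier L; y \<in> carrier L\<rbrakk> \<Longrightarrow> dpow n (x \<curlyvee> y) = dpow n x \<curlyvee> dpow n y"
  by (induction n) (simp_all add: delta_join dpow_closed)

lemma distrib_join:
  assumes "g \<in> carrier L" "x \<in> carrier L" "y \<in> carrier L"
  shows "g \<curlywedge> (x \<curlyvee> y) \<preceq> (g \<curlywedge> x) \<curlyvee> (g \<curlywedge> y)"
proof -
  have "u \<curlywedge>\<^bsub>F i\<^esub> (v \<curlyvee>\<^bsub>F i\<^esub> w) \<preceq>\<^bsub>F i\<^esub> (u \<curlywedge>\<^bsub>F i\<^esub> v) \<curlyvee>\<^bsub>F i\<^esub> (u \<curlywedge>\<^bsub>F i\<^esub> w)"
    if i: "i \<in> I" and uvw: "u \<in> carrier (F i)" "v \<in> carrier (F i)" "w \<in> carrier (F i)" for i u v w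
  proof -
    interpret C: star_chain_rl "F i" by (rule chain[OF i])
    show ?thesis
      using C.join_max[of v w] C.le_join1[of "u \<curlywedge>\<^bsub>F i\<^esub> v" "u \<curlywedge>\<^bsub>F i\<^esub> w"]
        C.le_join2[of "u \<curlywedge>\<^bsub>F i\<^esub> v" "u \<curlywedge>\<^bsub>F i\<^esub> w"] C.closed uvw by simp
  qed
  then show ?thesis using assms by (simp add: le_iff hs closed)
qed

lemma delta_filterD:
  assumes "delta_filter L P"
  shows "x \<in> P \<Longrightarrow> x \<in> neg_cone L" "\<one> \<in> P" "\<lbrakk>x \<in> P; y \<in> neg_cone L; x \<preceq> y\<rbrakk> \<Longrightarrow> y \<in> P"
    "\<lbrakk>x \<in> P; y \<in> P\<rbrakk> \<Longrightarrow> x \<curlywedge> y \<in> P" "x \<in> P \<Longrightarrow> delta_rl L x \<in> P"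
  using assms by (auto simp: delta_filter_def)

lemma delta_filter_dpow: "\<lbrakk>delta_filter L P; x \<in> P\<rbrakk> \<Longrightarrow> dpow n x \<in> P"
  by (induction n) (simp_all add: delta_filterD(5))

lemma one_filter: "delta_filter L {\<one>}"
  using one_neg_cone one_le_iff by (auto simp: delta_filter_def meet_idem delta_one neg_cone_def)

text \<open>The delta-filter generated by \<open>G\<close> and \<open>u\<close>. The iterates
  decrease, so finitely many are bounded below by the last one.\<close>

definition extend :: "'a set \<Rightarrow> 'a \<Rightarrow> 'a set"
  where "extend G u = {z \<in> neg_cone L. \<exists>n. \<exists>g \<in> G. g \<curlywedge> dpow n u \<preceq> z}"

lemma extend_filter:
  assumes G: "delta_filter L G" and u: "u \<in> neg_cone L"
  shows "delta_filter L (extend G u)" "G \<subseteq> extend G u" "u \<in> extend G u"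
proof -
  note uc = neg_coneD(1)[OF u]
  have gc: "g \<in> carrier L" if "g \<in> G" for g using delta_filterD(1)[OF G that] neg_coneD by simp
  show sub: "G \<subseteq> extend G u"
    using delta_filterD(1)[OF G] meet_le1[OF gc dpow_closed[OF uc]] unfolding extend_def by blast
  have "\<one> \<curlywedge> dpow 0 u \<preceq> u" using meet_le2 uc by simp
  then show "u \<in> extend G u"
    using delta_filterD(2)[OF G] u unfolding extend_def by blast
  show "delta_filter L (extend G u)"
    unfolding delta_filter_def
  proof (intro conjI ballI impI)
    show "extend G u \<subseteq> neg_cone L" by (auto simp: extend_def)
    show "\<one> \<in> extend G u" using sub delta_filterD(2)[OF G] by blast
  next
    fix x y assume x: "x \<in> extend G u" and y: "y \<in> neg_cone L" and xy: "x \<preceq> y"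
    then obtain n g where ng: "g \<in> G" "g \<curlywedge> dpow n u \<preceq> x" and xc: "x \<in> neg_cone L" by (auto simp: extend_def)
    then have "g \<curlywedge> dpow n u \<preceq> y"
      using le_trans[of "g \<curlywedge> dpow n u" x y] xy y xc gc dpow_closed[OF uc] closed neg_coneD by simp
    then show "y \<in> extend G u" using ng y by (auto simp: extend_def)
  next
    fix x y assume "x \<in> extend G u" "y \<in> extend G u"
    then obtain n g m k where ng: "g \<in> G" "g \<curlywedge> dpow n u \<preceq> x" and mk: "k \<in> G" "k \<curlywedge> dpow m u \<preceq> y"
      and xy: "x \<in> neg_cone L" "y \<in> neg_cone L" by (auto simp: extend_def)
    define j where "j = max n m"
    note cl = gc[OF ng(1)] gc[OF mk(1)] dpow_closed[OF uc] xy[THEN neg_coneD(1)] closed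
    have "(g \<curlywedge> k) \<curlywedge> dpow j u \<preceq> g \<curlywedge> dpow n u" "(g \<curlywedge> k) \<curlywedge> dpow j u \<preceq> k \<curlywedge> dpow m u"
      using dpow_antimono[OF uc, of n j] dpow_antimono[OF uc, of m j] cl
      by (auto simp: j_def intro!: meet_mono meet_le1 meet_le2)
    then have "(g \<curlywedge> k) \<curlywedge> dpow j u \<preceq> x \<curlywedge> y"
      using ng mk cl le_meet_iff le_trans[of "(g \<curlywedge> k) \<curlywedge> dpow j u" "g \<curlywedge> dpow n u" x]
        le_trans[of "(g \<curlywedge> k) \<curlywedge> dpow j u" "k \<curlywedge> dpow m u" y] by simp
    then show "x \<curlywedge> y \<in> extend G u"
      using neg_cone_meet[OF xy] delta_filterD(4)[OF G ng(1) mk(1)] unfolding extend_def by blast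
  next
    fix x assume "x \<in> extend G u"
    then obtain n g where ng: "g \<in> G" "g \<curlywedge> dpow n u \<preceq> x" and x: "x \<in> neg_cone L" by (auto simp: extend_def)
    have "delta_rl L g \<curlywedge> dpow (Suc n) u \<preceq> delta_rl L x"
      using delta_mono[OF _ _ ng(2)] delta_meet gc[OF ng(1)] dpow_closed[OF uc] x neg_coneD closed by simp
    moreover have "delta_rl L x \<in> neg_cone L" using dpow_neg_cone[OF x, of 1] by simp
    ultimately show "delta_rl L x \<in> extend G u"
      using delta_filterD(5)[OF G ng(1)] unfolding extend_def by blast
  qed
qed

text \<open>A filter \<open>P\<close> maximal among those containing \<open>G\<close> and avoiding
  \<open>S\<close> is prime: if neither \<open>x\<close> nor \<open>y\<close> lies in
  \<open>P\<close>, the extensions by \<open>x\<close> and by \<open>y\<close> reach some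
  \<open>s\<close> and \<open>t\<close> in \<open>S\<close>. Since iterates of
  \<open>delta_rl\<close> preserve joins and the lattice is distributive, the join of
  \<open>x\<close> and \<open>y\<close> being in \<open>P\<close> would put the join of
  \<open>s\<close> and \<open>t\<close> into both \<open>P\<close> and \<open>S\<close>.\<close>

lemma prime_filter_exists:
  assumes G: "delta_filter L G" and S: "S \<subseteq> neg_cone L" "\<And>x y. \<lbrakk>x \<in> S; y \<in> S\<rbrakk> \<Longrightarrow> x \<curlyvee> y \<in> S"
    and GS: "G \<inter> S = {}"
  obtains P where "prime_filter L P" "G \<subseteq> P" "P \<inter> S = {}"
proof -
  define Z where "Z = {P. delta_filter L P \<and> G \<subseteq> P \<and> P \<inter> S = {}}"
  have "\<exists>M \<in> Z. \<forall>X \<in> Z. M \<subseteq> X \<longrightarrow> X = M"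
  proof (rule subset_Zorn_nonempty)
    show "Z \<noteq> {}" using G GS by (auto simp: Z_def)
  next
    fix K assume K: "K \<noteq> {}" "subset.chain Z K"
    then have KZ: "K \<subseteq> Z" and lin: "\<And>X Y. X \<in> K \<Longrightarrow> Y \<in> K \<Longrightarrow> X \<subseteq> Y \<or> Y \<subseteq> X"
      by (auto simp: subset_chain_def)
    have df: "delta_filter L X" if "X \<in> K" for X using that KZ by (auto simp: Z_def)
    have "delta_filter L (\<Union>K)"
      unfolding delta_filter_def
    proof (intro conjI ballI impI)
      show "\<Union>K \<subseteq> neg_cone L" using delta_filterD(1)[OF df] by blast
      show "\<one> \<in> \<Union>K" using delta_filterD(2)[OF df] K(1) by blast
      show "y \<in> \<Union>K" if "x \<in> \<Union>K" "y \<in> neg_cone L" "x \<preceq> y" for x y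
        using delta_filterD(3)[OF df] that by blast
      show "delta_rl L x \<in> \<Union>K" if "x \<in> \<Union>K" for x using delta_filterD(5)[OF df] that by blast
      show "x \<curlywedge> y \<in> \<Union>K" if xy: "x \<in> \<Union>K" "y \<in> \<Union>K" for x y
      proof -
        obtain X Y where "X \<in> K" "Y \<in> K" "x \<in> X" "y \<in> Y" using xy by blast
        then obtain Z' where "Z' \<in> K" "x \<in> Z'" "y \<in> Z'" using lin[of X Y] by blast
        then show ?thesis using delta_filterD(4)[OF df] by blast
      qed
    qed
    moreover have "G \<subseteq> \<Union>K" "\<Union>K \<inter> S = {}" using K(1) KZ by (auto simp: Z_def)
    ultimately show "\<Union>K \<in> Z" by (simp add: Z_def)
  qed
  then obtain P where P: "P \<in> Z" and max: "\<And>X. X \<in> Z \<Longrightarrow> P \<subseteq> X \<Longrightarrow> X = P" by blast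
  have Pf: "delta_filter L P" and GP: "G \<subseteq> P" and PS: "P \<inter> S = {}" using P by (auto simp: Z_def)
  have meets: "\<exists>s \<in> S. \<exists>n. \<exists>g \<in> P. g \<curlywedge> dpow n x \<preceq> s" if "x \<in> neg_cone L" "x \<notin> P" for x
  proof (rule ccontr)
    assume "\<not> ?thesis"
    then have "extend P x \<inter> S = {}" by (auto simp: extend_def)
    then have "extend P x \<in> Z" using extend_filter[OF Pf that(1)] GP by (auto simp: Z_def)
    then show False using max extend_filter[OF Pf that(1)] that(2) by blast
  qed
  have "x \<in> P \<or> y \<in> P" if x: "x \<in> neg_cone L" and y: "y \<in> neg_cone L" and xy: "x \<curlyvee> y \<in> P" for x y
  proof (rule ccontr)
    assume "\<not> ?thesis"
    then obtain s n g t m k where s: "s \<in> S" "g \<in> P" "g \<curlywedge> dpow n x \<preceq> s"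
      and t: "t \<in> S" "k \<in> P" "k \<curlywedge> dpow m y \<preceq> t"
      using meets[OF x] meets[OF y] by blast
    define j where "j = max n m"
    have gc: "g \<in> carrier L" "k \<in> carrier L" using s t delta_filterD(1)[OF Pf] neg_coneD by blast+
    have sc: "s \<in> carrier L" "t \<in> carrier L" using s t S neg_coneD by blast+
    note cl = gc sc neg_coneD(1)[OF x] neg_coneD(1)[OF y] dpow_closed closed
    have "(g \<curlywedge> k) \<curlywedge> dpow j x \<preceq> g \<curlywedge> dpow n x" "(g \<curlywedge> k) \<curlywedge> dpow j y \<preceq> k \<curlywedge> dpow m y"
      using dpow_antimono[of x n j] dpow_antimono[of y m j] cl
      by (auto simp: j_def intro!: meet_mono meet_le1 meet_le2)
    then have "(g \<curlywedge> k) \<curlywedge> dpow j x \<preceq> s" "(g \<curlywedge> k) \<curlywedge> dpow j y \<preceq> t"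
      using le_trans[of "(g \<curlywedge> k) \<curlywedge> dpow j x" "g \<curlywedge> dpow n x" s]
        le_trans[of "(g \<curlywedge> k) \<curlywedge> dpow j y" "k \<curlywedge> dpow m y" t] s t cl by simp_all
    then have "((g \<curlywedge> k) \<curlywedge> dpow j x) \<curlyvee> ((g \<curlywedge> k) \<curlywedge> dpow j y) \<preceq> s \<curlyvee> t"
      using cl by (intro join_mono) auto
    then have le: "(g \<curlywedge> k) \<curlywedge> dpow j (x \<curlyvee> y) \<preceq> s \<curlyvee> t"
      using distrib_join[of "g \<curlywedge> k" "dpow j x" "dpow j y"] dpow_join[of x y j] cl
        le_trans[of "(g \<curlywedge> k) \<curlywedge> (dpow j x \<curlyvee> dpow j y)"
          "((g \<curlywedge> k) \<curlywedge> dpow j x) \<curlyvee> ((g \<curlywedge> k) \<curlywedge> dpow j y)" "s \<curlyvee> t"] by simp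
    have "(g \<curlywedge> k) \<curlywedge> dpow j (x \<curlyvee> y) \<in> P"
      using delta_filterD(4)[OF Pf] delta_filter_dpow[OF Pf xy] s t by blast
    then have "s \<curlyvee> t \<in> P" using delta_filterD(3)[OF Pf _ _ le] S s t by blast
    then show False using S(2)[OF s(1) t(1)] PS by blast
  qed
  then have "prime_filter L P" using Pf by (auto simp: prime_filter_def)
  then show ?thesis using that GP PS by blast
qed

end

section \<open>Quotients by prime filters\<close>

locale star_semilinear_prime = star_semilinear +
  fixes P assumes prime: "prime_filter L P"
begin

definition ple :: "'a \<Rightarrow> 'a \<Rightarrow> bool" (infix "\<lesssim>" 50)
  where "x \<lesssim> y \<longleftrightarrow> imp_rl L x y \<in> P"

lemma filter: "delta_filter L P"
  using prime by (simp add: prime_filter_def)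

lemma joinD: "\<lbrakk>x \<curlyvee> y = \<one>; x \<in> neg_cone L; y \<in> neg_cone L\<rbrakk> \<Longrightarrow> x \<in> P \<or> y \<in> P"
  using prime delta_filterD(2)[OF filter] by (auto simp: prime_filter_def)

lemma le_ple: "\<lbrakk>x \<in> carrier L; y \<in> carrier L; x \<preceq> y\<rbrakk> \<Longrightarrow> x \<lesssim> y"
  using imp_eq_one[of x y] delta_filterD(2)[OF filter] by (simp add: ple_def)

lemma ple_refl: "x \<in> carrier L \<Longrightarrow> x \<lesssim> x"
  by (simp add: le_ple le_refl)

lemma ple_trans: "\<lbrakk>x \<in> carrier L; y \<in> carrier L; z \<in> carrier L; x \<lesssim> y; y \<lesssim> z\<rbrakk> \<Longrightarrow> x \<lesssim> z"
  using delta_filterD(3)[OF filter _ imp_neg_cone imp_trans] delta_filterD(4)[OF filter]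
  unfolding ple_def by blast

lemma ple_delta: "\<lbrakk>x \<lesssim> y; a \<in> carrier L; b \<in> carrier L; delta_rl L (imp_rl L x y) \<preceq> imp_rl L a b\<rbrakk> \<Longrightarrow> a \<lesssim> b"
  using delta_filterD(3)[OF filter _ imp_neg_cone] delta_filterD(5)[OF filter]
  unfolding ple_def by blast

lemma ple_total: "\<lbrakk>x \<in> carrier L; y \<in> carrier L\<rbrakk> \<Longrightarrow> x \<lesssim> y \<or> y \<lesssim> x"
  unfolding ple_def by (intro joinD imp_total imp_neg_cone)

lemma ple_star: "\<lbrakk>x \<in> carrier L; y \<in> carrier L; x \<lesssim> y\<rbrakk> \<Longrightarrow> star_rl L y \<lesssim> star_rl L x"
  by (simp add: ple_def imp_star)

lemma meet_equiv:
  assumes "x \<in> carrier L" "y \<in> carrier L" "x \<lesssim> y"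
  shows "x \<lesssim> x \<curlywedge> y" "x \<curlywedge> y \<lesssim> x" "y \<lesssim> x \<curlyvee> y" "x \<curlyvee> y \<lesssim> y"
  using assms imp_meet imp_join le_ple[OF _ _ meet_le1] le_ple[OF _ _ le_join2] closed by (simp_all add: ple_def)

lemma preskeleton: "preskeleton (carrier L) (\<lesssim>) \<one> (lneg_rl L) (rneg_rl L)"
proof
  fix x st assume x: "x \<in> carrier L"
    and st: "st = (\<lambda>u. if lneg_rl L u \<lesssim> rneg_rl L u then lneg_rl L u else rneg_rl L u)"
  have stc: "st u \<in> carrier L" if "u \<in> carrier L" for u using that closed by (simp add: st)
  \<comment> \<open>Modulo \<open>P\<close> the order may choose the other negation, so
    \<open>st\<close> is only equivalent to the star. That is enough, because the star respects the
    preorder: \<open>imp_star\<close> is an exact identity.\<close>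
  have eq: "st u \<lesssim> star_rl L u" "star_rl L u \<lesssim> st u" if u: "u \<in> carrier L" for u
    using meet_equiv(1,2)[of "lneg_rl L u" "rneg_rl L u"] meet_equiv(1,2)[of "rneg_rl L u" "lneg_rl L u"]
      ple_total[of "lneg_rl L u" "rneg_rl L u"] closed u meet_comm[of "lneg_rl L u" "rneg_rl L u"]
    by (auto simp: st star_rl_def)
  have "star_rl L (st x) \<lesssim> x" "x \<lesssim> star_rl L (st x)"
    using ple_star[OF stc[OF x] star_closed[OF x] eq(1)[OF x]] ple_star[OF star_closed[OF x] stc[OF x] eq(2)[OF x]]
    by (simp_all add: star_star x)
  then show "st (st x) \<lesssim> x \<and> x \<lesssim> st (st x)"
    using ple_trans[OF _ _ x eq(1)[OF stc[OF x]]] ple_trans[OF x _ _ _ eq(2)[OF stc[OF x]]]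
      stc[OF x] stc[OF stc[OF x]] star_closed[OF stc[OF x]] by blast
next
  fix x y assume xy: "x \<in> carrier L" "y \<in> carrier L"
  show "x \<lesssim> y \<or> y \<lesssim> x" using ple_total xy .
  show "x \<lesssim> lneg_rl L y \<longleftrightarrow> y \<lesssim> rneg_rl L x"
    using ple_delta[OF _ _ _ delta_imp_galois(1)[OF xy]] ple_delta[OF _ _ _ delta_imp_galois(2)[OF xy]]
      xy lneg_closed[OF xy(2)] rneg_closed[OF xy(1)] by auto
  show "y \<lesssim> rneg_rl L x \<or> lneg_rl L x \<lesssim> y" "y \<lesssim> lneg_rl L x \<or> rneg_rl L x \<lesssim> y"
    unfolding ple_def using xy by (intro joinD imp_cover imp_neg_cone closed; simp)+
next
  show "x \<lesssim> z" if "x \<in> carrier L" "y \<in> carrier L" "z \<in> carrier L" "x \<lesssim> y" "y \<lesssim> z" for x y z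
    using that by (rule ple_trans)
qed (simp_all add: closed lneg_one rneg_one ple_refl)

lemma mult_equiv:
  assumes xy: "x \<in> carrier L" "y \<in> carrier L"
  shows "x \<lesssim> lneg_rl L y \<Longrightarrow> x \<otimes> y \<lesssim> x \<curlywedge> y" "x \<curlywedge> y \<lesssim> x \<otimes> y"
    "\<not> x \<lesssim> lneg_rl L y \<Longrightarrow> x \<curlyvee> y \<lesssim> x \<otimes> y" "x \<otimes> y \<lesssim> x \<curlyvee> y"
proof -
  show "x \<otimes> y \<lesssim> x \<curlywedge> y" if "x \<lesssim> lneg_rl L y"
    by (rule ple_delta[OF that _ _ delta_imp_mult]) (use xy closed in auto)
  show "x \<curlyvee> y \<lesssim> x \<otimes> y" if "\<not> x \<lesssim> lneg_rl L y"
    using joinD[OF imp_mult[OF xy] imp_neg_cone imp_neg_cone] that xy by (simp add: ple_def closed)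
qed (use mult_bounds[OF xy] xy in \<open>simp_all add: le_ple closed\<close>)

lemma ldiv_equiv:
  assumes xz: "x \<in> carrier L" "z \<in> carrier L"
  shows "x \<lesssim> z \<Longrightarrow> rneg_rl L x \<curlyvee> z \<lesssim> x \<setminus> z" "x \<setminus> z \<lesssim> rneg_rl L x \<curlyvee> z"
    "\<not> x \<lesssim> z \<Longrightarrow> x \<setminus> z \<lesssim> rneg_rl L x \<curlywedge> z" "rneg_rl L x \<curlywedge> z \<lesssim> x \<setminus> z"
proof -
  show "rneg_rl L x \<curlyvee> z \<lesssim> x \<setminus> z" if "x \<lesssim> z"
    by (rule ple_delta[OF that _ _ delta_imp_ldiv]) (use xz closed in auto)
  show "x \<setminus> z \<lesssim> rneg_rl L x \<curlywedge> z" if "\<not> x \<lesssim> z"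
    using joinD[OF imp_ldiv[OF xz] imp_neg_cone imp_neg_cone] that xz by (simp add: ple_def closed)
qed (use ldiv_bounds[OF xz] xz in \<open>simp_all add: le_ple closed\<close>)

lemma rdiv_equiv:
  assumes yz: "y \<in> carrier L" "z \<in> carrier L"
  shows "y \<lesssim> z \<Longrightarrow> lneg_rl L y \<curlyvee> z \<lesssim> z \<oslash> y" "z \<oslash> y \<lesssim> lneg_rl L y \<curlyvee> z"
    "\<not> y \<lesssim> z \<Longrightarrow> z \<oslash> y \<lesssim> lneg_rl L y \<curlywedge> z" "lneg_rl L y \<curlywedge> z \<lesssim> z \<oslash> y"
proof -
  show "lneg_rl L y \<curlyvee> z \<lesssim> z \<oslash> y" if "y \<lesssim> z"
    by (rule ple_delta[OF that _ _ delta_imp_rdiv]) (use yz closed in auto)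
  show "z \<oslash> y \<lesssim> lneg_rl L y \<curlywedge> z" if "\<not> y \<lesssim> z"
    using joinD[OF imp_rdiv[OF yz] imp_neg_cone imp_neg_cone] that yz by (simp add: ple_def closed)
qed (use rdiv_bounds[OF yz] yz in \<open>simp_all add: le_ple closed\<close>)

text \<open>Modulo a prime filter all operations are expressed by the order and the negations, so
  nothing else has to be preserved. The target is any chain receiving the quotient, in particular an
  amalgam.\<close>

lemma hom_into_chain:
  assumes Y: "skeleton Y leY eY lY rY"
    and j: "\<And>x. x \<in> carrier L \<Longrightarrow> j x \<in> Y"
      "\<And>x y. x \<in> carrier L \<Longrightarrow> y \<in> carrier L \<Longrightarrow> leY (j x) (j y) \<longleftrightarrow> x \<lesssim> y"
      "j \<one> = eY" "\<And>x. x \<in> carrier L \<Longrightarrow> j (lneg_rl L x) = lY (j x)"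
      "\<And>x. x \<in> carrier L \<Longrightarrow> j (rneg_rl L x) = rY (j x)"
  shows "j \<in> hom_rl L (chain_rl Y leY eY lY rY)"
proof -
  interpret Y: skeleton Y leY eY lY rY by (rule Y)
  have eqI: "j x = j y" if "x \<in> carrier L" "y \<in> carrier L" "x \<lesssim> y" "y \<lesssim> x" for x y
    using that j Y.antisym by metis
  have meet: "j (x \<curlywedge> y) = (if leY (j x) (j y) then j x else j y)" if "x \<in> carrier L" "y \<in> carrier L" for x y
    using that meet_equiv[of x y] meet_equiv[of y x] ple_total[of x y] meet_comm[of x y] eqI j closed by auto
  have join: "j (x \<curlyvee> y) = (if leY (j x) (j y) then j y else j x)" if "x \<in> carrier L" "y \<in> carrier L" for x y
    using that meet_equiv[of x y] meet_equiv[of y x] ple_total[of x y] join_comm[of x y] eqI j closed by auto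
  have mult: "j (x \<otimes> y) = (if leY (j x) (lY (j y)) then j (x \<curlywedge> y) else j (x \<curlyvee> y))"
    if "x \<in> carrier L" "y \<in> carrier L" for x y
    using that mult_equiv[of x y] eqI j(2)[of x "lneg_rl L y"] j(4) closed by auto
  have ldiv: "j (x \<setminus> z) = (if leY (j x) (j z) then j (rneg_rl L x \<curlyvee> z) else j (rneg_rl L x \<curlywedge> z))"
    if "x \<in> carrier L" "z \<in> carrier L" for x z
    using that ldiv_equiv[of x z] eqI j(2)[of x z] closed by auto
  have rdiv: "j (z \<oslash> y) = (if leY (j y) (j z) then j (lneg_rl L y \<curlyvee> z) else j (lneg_rl L y \<curlywedge> z))"
    if "y \<in> carrier L" "z \<in> carrier L" for y z
    using that rdiv_equiv[of y z] eqI j(2)[of y z] closed by auto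
  note neg = j(4)[symmetric] j(5)[symmetric]
  have "j (x \<otimes> y) = j x \<otimes>\<^bsub>Y.C\<^esub> j y" "j (x \<curlywedge> y) = j x \<curlywedge>\<^bsub>Y.C\<^esub> j y" "j (x \<curlyvee> y) = j x \<curlyvee>\<^bsub>Y.C\<^esub> j y"
    "j (x \<setminus> y) = j x \<setminus>\<^bsub>Y.C\<^esub> j y" "j (x \<oslash> y) = j x \<oslash>\<^bsub>Y.C\<^esub> j y"
    if "x \<in> carrier L" "y \<in> carrier L" for x y
    using that by (simp_all add: Y.chain_simps mult ldiv rdiv meet join neg closed)
  then show ?thesis
    using j(1,3) by (simp add: hom_rl_def hom_def Y.chain_simps(1,2))
qed

end

section \<open>Membership in the variety\<close>

definition closed_ops :: "('a, 'b) reslat_scheme \<Rightarrow> 'a set \<Rightarrow> bool"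
  where "closed_ops L S \<longleftrightarrow> \<one>\<^bsub>L\<^esub> \<in> S \<and> (\<forall>x \<in> S. \<forall>y \<in> S. x \<otimes>\<^bsub>L\<^esub> y \<in> S \<and> x \<curlywedge>\<^bsub>L\<^esub> y \<in> S \<and>
    x \<curlyvee>\<^bsub>L\<^esub> y \<in> S \<and> x \<setminus>\<^bsub>L\<^esub> y \<in> S \<and> x \<oslash>\<^bsub>L\<^esub> y \<in> S)"

lemma (in residuated_lattice) closed_ops_carrier: "closed_ops L (carrier L)"
  by (simp add: closed_ops_def closed)

lemma hom_image_closed_ops:
  assumes g: "g \<in> hom_rl L M" and L: "closed_ops L (carrier L)"
  shows "closed_ops M (g ` carrier L)"
  using L unfolding closed_ops_def
  by (auto simp: hom_rlD(2-7)[OF g, symmetric])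

text \<open>The order is itself an equation, so separation makes it coordinatewise; the residuation
  equivalences are then inherited just like the identities.\<close>

lemma residuated_lattice_of_homs:
  fixes L :: "('a, 'b) reslat_scheme"
  assumes L: "closed_ops L (carrier L)"
    and hom: "\<And>i. i \<in> I \<Longrightarrow> h i \<in> hom_rl L (F i)" and F: "\<And>i. i \<in> I \<Longrightarrow> residuated_lattice (F i)"
    and sep: "\<And>x y. \<lbrakk>x \<in> carrier L; y \<in> carrier L; \<And>i. i \<in> I \<Longrightarrow> h i x = h i y\<rbrakk> \<Longrightarrow> x = y"
  shows "residuated_lattice L"
proof -
  have mon: "monoid (F i)" if "i \<in> I" for i using F[OF that] by (simp add: residuated_lattice_def)
  note hs = hom_rlD[OF hom]
  have cl: "\<one>\<^bsub>L\<^esub> \<in> carrier L"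
    "\<And>x y. \<lbrakk>x \<in> carrier L; y \<in> carrier L\<rbrakk> \<Longrightarrow> x \<otimes>\<^bsub>L\<^esub> y \<in> carrier L"
    "\<And>x y. \<lbrakk>x \<in> carrier L; y \<in> carrier L\<rbrakk> \<Longrightarrow> x \<curlywedge>\<^bsub>L\<^esub> y \<in> carrier L"
    "\<And>x y. \<lbrakk>x \<in> carrier L; y \<in> carrier L\<rbrakk> \<Longrightarrow> x \<curlyvee>\<^bsub>L\<^esub> y \<in> carrier L"
    "\<And>x y. \<lbrakk>x \<in> carrier L; y \<in> carrier L\<rbrakk> \<Longrightarrow> x \<setminus>\<^bsub>L\<^esub> y \<in> carrier L"
    "\<And>x y. \<lbrakk>x \<in> carrier L; y \<in> carrier L\<rbrakk> \<Longrightarrow> x \<oslash>\<^bsub>L\<^esub> y \<in> carrier L"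
    using L by (auto simp: closed_ops_def)
  have le: "x \<preceq>\<^bsub>L\<^esub> y \<longleftrightarrow> (\<forall>i \<in> I. h i x \<preceq>\<^bsub>F i\<^esub> h i y)" if "x \<in> carrier L" "y \<in> carrier L" for x y
    using that sep[of "x \<curlywedge>\<^bsub>L\<^esub> y" x] hs(4)[of _ x y] unfolding le_rl_def by (metis cl(3))
  show ?thesis
  proof
    fix x y z assume x: "x \<in> carrier L" and y: "y \<in> carrier L" and z: "z \<in> carrier L"
    show "x \<otimes>\<^bsub>L\<^esub> y \<otimes>\<^bsub>L\<^esub> z = x \<otimes>\<^bsub>L\<^esub> (y \<otimes>\<^bsub>L\<^esub> z)"
      by (rule sep) (simp_all add: x y z cl hs monoid.m_assoc[OF mon])
    show "(x \<curlywedge>\<^bsub>L\<^esub> y) \<curlywedge>\<^bsub>L\<^esub> z = x \<curlywedge>\<^bsub>L\<^esub> (y \<curlywedge>\<^bsub>L\<^esub> z)"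
      by (rule sep) (simp_all add: x y z cl hs residuated_lattice.meet_assoc[OF F])
    show "(x \<curlyvee>\<^bsub>L\<^esub> y) \<curlyvee>\<^bsub>L\<^esub> z = x \<curlyvee>\<^bsub>L\<^esub> (y \<curlyvee>\<^bsub>L\<^esub> z)"
      by (rule sep) (simp_all add: x y z cl hs residuated_lattice.join_assoc[OF F])
    show "(y \<preceq>\<^bsub>L\<^esub> x \<setminus>\<^bsub>L\<^esub> z) = (x \<otimes>\<^bsub>L\<^esub> y \<preceq>\<^bsub>L\<^esub> z)"
      by (simp add: x y z cl hs le residuated_lattice.ldiv_residual[OF F])
    show "(x \<otimes>\<^bsub>L\<^esub> y \<preceq>\<^bsub>L\<^esub> z) = (x \<preceq>\<^bsub>L\<^esub> z \<oslash>\<^bsub>L\<^esub> y)"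
      by (simp add: x y z cl hs le residuated_lattice.rdiv_residual[OF F])
  next
    fix x y assume x: "x \<in> carrier L" and y: "y \<in> carrier L"
    show "x \<curlywedge>\<^bsub>L\<^esub> y = y \<curlywedge>\<^bsub>L\<^esub> x"
      by (rule sep) (simp_all add: x y cl hs residuated_lattice.meet_comm[OF F, of _ "h _ x"])
    show "x \<curlyvee>\<^bsub>L\<^esub> y = y \<curlyvee>\<^bsub>L\<^esub> x"
      by (rule sep) (simp_all add: x y cl hs residuated_lattice.join_comm[OF F, of _ "h _ x"])
    show "x \<curlywedge>\<^bsub>L\<^esub> (x \<curlyvee>\<^bsub>L\<^esub> y) = x"
      by (rule sep) (simp_all add: x y cl hs residuated_lattice.meet_join_absorb[OF F])
    show "x \<curlyvee>\<^bsub>L\<^esub> (x \<curlywedge>\<^bsub>L\<^esub> y) = x"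
      by (rule sep) (simp_all add: x y cl hs residuated_lattice.join_meet_absorb[OF F])
    show "\<one>\<^bsub>L\<^esub> \<otimes>\<^bsub>L\<^esub> x = x" "x \<otimes>\<^bsub>L\<^esub> \<one>\<^bsub>L\<^esub> = x"
      by (rule sep; simp add: x cl hs monoid.l_one[OF mon] monoid.r_one[OF mon])+
  qed (simp_all add: cl)
qed

lemma carrier_update_simps:
  "le_rl (M\<lparr>carrier := S\<rparr>) = le_rl M" "lneg_rl (M\<lparr>carrier := S\<rparr>) = lneg_rl M"
  "rneg_rl (M\<lparr>carrier := S\<rparr>) = rneg_rl M" "star_rl (M\<lparr>carrier := S\<rparr>) = star_rl M"
  "closed_ops (M\<lparr>carrier := S\<rparr>) S' = closed_ops M S'"
  by (simp_all add: fun_eq_iff le_rl_def lneg_rl_def rneg_rl_def star_rl_def closed_ops_def)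

lemma residuated_sublattice:
  assumes "residuated_lattice M" "S \<subseteq> carrier M" "closed_ops M S"
  shows "residuated_lattice (M\<lparr>carrier := S\<rparr>)"
  by (rule residuated_lattice_of_homs[where I = UNIV and h = "\<lambda>_::unit. id" and F = "\<lambda>_. M"])
    (use assms in \<open>auto simp: carrier_update_simps hom_rl_def hom_def\<close>)

lemma star_subchain:
  assumes M: "star_chain M" and S: "S \<subseteq> carrier M" "closed_ops M S"
  shows "star_chain (M\<lparr>carrier := S\<rparr>)"
  using M residuated_sublattice[OF _ S] S(1)
  by (auto simp: star_chain_def totally_ordered_rl_def idempotent_rl_def carrier_update_simps subset_iff)

lemma star_involutive_of_homs:
  fixes L :: "'u reslat" and F :: "'i \<Rightarrow> 'c reslat"
  assumes L: "closed_ops L (carrier L)"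
    and hom: "\<And>i. i \<in> I \<Longrightarrow> h i \<in> hom_rl L (F i)" and F: "\<And>i. i \<in> I \<Longrightarrow> star_chain (F i)"
    and sep: "\<And>x y. \<lbrakk>x \<in> carrier L; y \<in> carrier L; \<And>i. i \<in> I \<Longrightarrow> h i x = h i y\<rbrakk> \<Longrightarrow> x = y"
  shows "L \<in> star_involutive_rl"
proof -
  have rl: "residuated_lattice L"
    by (rule residuated_lattice_of_homs[OF L hom _ sep])
      (use F in \<open>auto simp: star_chain_def totally_ordered_rl_def\<close>)
  then have sl: "star_semilinear L I F h"
    using hom F sep by (simp add: star_semilinear_def star_semilinear_axioms_def)
  \<comment> \<open>Cutting each chain down to the image makes the projections surjective, as
    subdirectness demands.\<close>
  define G where "G i = (F i)\<lparr>carrier := h i ` carrier L\<rparr>" for i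
  define e where "e x = (\<lambda>i \<in> I. h i x)" for x
  note hs = hom_rlD[OF hom]
  have G: "totally_ordered_rl (G i)" if "i \<in> I" for i
    using star_subchain[OF F[OF that] _ hom_image_closed_ops[OF hom[OF that] L]] hs(1)[OF that]
    by (auto simp: G_def star_chain_def)
  have "e \<in> hom_rl L (product_rl I G)"
    by (auto simp: hom_rl_def hom_def product_rl_def e_def G_def hs intro!: restrict_ext)
  moreover have "inj_on e (carrier L)"
    by (intro inj_onI sep) (auto simp: e_def fun_eq_iff restrict_def split: if_splits)
  moreover have "(\<lambda>x. e x i) ` carrier L = carrier (G i)" if "i \<in> I" for i
    using that by (simp add: e_def G_def)
  ultimately have "subdirect_emb L I G e" by (simp add: subdirect_emb_def emb_rl_def)
  with rl G have "semilinear_rl L" by (rule semilinear_rlI)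
  then show ?thesis
    using rl star_semilinear.mult_idem[OF sl] star_semilinear.star_star[OF sl]
    by (simp add: star_involutive_rl_def idempotent_rl_def)
qed

lemma star_involutive_separated:
  fixes A :: "'u reslat"
  assumes "A \<in> star_involutive_rl"
  obtains I :: "('u \<times> 'u) set" and F :: "'u \<times> 'u \<Rightarrow> 'u reslat" and h
  where "star_semilinear A I F h"
proof -
  have rl: "residuated_lattice A" and semi: "semilinear_rl A" and idem: "idempotent_rl A"
    and star: "\<And>x. x \<in> carrier A \<Longrightarrow> star_rl A (star_rl A x) = x"
    using assms by (auto simp: star_involutive_rl_def semilinear_rl_def)
  interpret A: residuated_lattice A by (rule rl)
  obtain I :: "('u \<times> 'u) set" and F :: "'u \<times> 'u \<Rightarrow> 'u reslat" and e
    where F: "\<And>i. i \<in> I \<Longrightarrow> totally_ordered_rl (F i)" and e: "subdirect_emb A I F e"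
    using semi by (auto simp: semilinear_rl_def)
  define h where "h i x = e x i" for i x
  have eh: "e \<in> hom_rl A (product_rl I F)" and inj: "inj_on e (carrier A)"
    and onto: "\<And>i. i \<in> I \<Longrightarrow> h i ` carrier A = carrier (F i)"
    using e by (auto simp: subdirect_emb_def emb_rl_def h_def)
  have PiE: "e x \<in> (\<Pi>\<^sub>E i \<in> I. carrier (F i))" if "x \<in> carrier A" for x
    using hom_rlD(1)[OF eh that] by (simp add: product_rl_def)
  have hom: "h i \<in> hom_rl A (F i)" if "i \<in> I" for i
    using that PiE hom_rlD[OF eh] by (auto simp: hom_rl_def hom_def h_def product_rl_def PiE_iff)
  have "star_chain (F i)" if i: "i \<in> I" for i
  proof -
    \<comment> \<open>The factors are only known to be totally ordered. Idempotence and
      star-involution reach them because the projections are onto.\<close>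
    have "x \<otimes>\<^bsub>F i\<^esub> x = x \<and> star_rl (F i) (star_rl (F i) x) = x" if x: "x \<in> carrier (F i)" for x
    proof -
      obtain a where a: "a \<in> carrier A" "x = h i a" using x onto[OF i] by auto
      then show ?thesis
        using idem star[OF a(1)] A.hom_simps(3)[OF hom[OF i], of a a] A.hom_derived(3)[OF hom[OF i]]
        by (metis A.star_closed idempotent_rl_def)
    qed
    then show ?thesis using F[OF i] by (simp add: star_chain_def idempotent_rl_def totally_ordered_rl_def)
  qed
  moreover have "x = y" if "x \<in> carrier A" "y \<in> carrier A" "\<And>i. i \<in> I \<Longrightarrow> h i x = h i y" for x y
    using PiE_ext[OF PiE[OF that(1)] PiE[OF that(2)]] inj that by (auto simp: h_def inj_on_def)
  ultimately have "star_semilinear A I F h"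
    using rl hom by (intro star_semilinear.intro star_semilinear_axioms.intro) blast+
  then show ?thesis by (rule that)
qed

section \<open>Generated subalgebras and their cardinality\<close>

primrec gen_stage :: "('a, 'b) reslat_scheme \<Rightarrow> 'a set \<Rightarrow> nat \<Rightarrow> 'a set"
  where
    "gen_stage L X 0 = X"
  | "gen_stage L X (Suc n) = gen_stage L X n \<union>
      (\<Union>f \<in> {monoid.mult L, meet_rl L, join_rl L, ldiv L, rdiv L}.
        case_prod f ` (gen_stage L X n \<times> gen_stage L X n))"

lemma gen_stage_mono: "m \<le> n \<Longrightarrow> gen_stage L X m \<subseteq> gen_stage L X n"
  by (rule lift_Suc_mono_le) auto

lemma gen_closed_ops:
  assumes "\<one>\<^bsub>L\<^esub> \<in> X"
  shows "closed_ops L (\<Union>n. gen_stage L X n)"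
proof -
  have step: "\<exists>n. f x y \<in> gen_stage L X n"
    if xy: "x \<in> gen_stage L X n" "y \<in> gen_stage L X m"
      and f: "f \<in> {monoid.mult L, meet_rl L, join_rl L, ldiv L, rdiv L}" for x y f n m
  proof
    have "x \<in> gen_stage L X (max n m)" "y \<in> gen_stage L X (max n m)"
      using xy gen_stage_mono[of n "max n m" L X] gen_stage_mono[of m "max n m" L X] by auto
    then show "f x y \<in> gen_stage L X (Suc (max n m))" using f by (auto simp: image_iff)
  qed
  define T where "T = (\<Union>n. gen_stage L X n)"
  have ops: "f x y \<in> T" if "x \<in> T" "y \<in> T" "f \<in> {monoid.mult L, meet_rl L, join_rl L, ldiv L, rdiv L}" for x y f
  proof -
    obtain n m where "x \<in> gen_stage L X n" "y \<in> gen_stage L X m" using \<open>x \<in> T\<close> \<open>y \<in> T\<close> by (auto simp: T_def)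
    from step[OF this that(3)] show ?thesis by (simp add: T_def)
  qed
  have "\<one>\<^bsub>L\<^esub> \<in> T" unfolding T_def using assms by (intro UN_I[of 0]) simp_all
  then have "closed_ops L T" using ops by (simp add: closed_ops_def)
  then show ?thesis by (simp only: T_def)
qed

lemma gen_stage_subset:
  assumes "closed_ops L S" "X \<subseteq> S"
  shows "gen_stage L X n \<subseteq> S"
proof (induction n)
  case (Suc n)
  have "f x y \<in> S" if "x \<in> S" "y \<in> S" "f \<in> {monoid.mult L, meet_rl L, join_rl L, ldiv L, rdiv L}" for x y f
    using that assms(1) by (auto simp: closed_ops_def)
  then show ?case
    using Suc unfolding gen_stage.simps by (intro Un_least UN_least image_subsetI) (auto simp: subset_iff)
qed (use assms in simp)

lemma card_of_Un_ordLeq_UNIV: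
  includes cardinal_syntax
  assumes "infinite (UNIV :: 'u set)" "|A| \<le>o |UNIV :: 'u set|" "|B| \<le>o |UNIV :: 'u set|"
  shows "|A \<union> B| \<le>o |UNIV :: 'u set|"
  by (rule card_of_Un_ordLeq_infinite_Field[OF _ assms(2,3) card_of_Card_order])
    (simp add: Field_card_of assms(1))

lemma gen_card:
  includes cardinal_syntax
  assumes inf: "infinite (UNIV :: 'u set)" and X: "|X| \<le>o |UNIV :: 'u set|"
  shows "|\<Union>n. gen_stage L X n| \<le>o |UNIV :: 'u set|"
proof (rule card_of_UNION_ordLeq_infinite[OF inf])
  show "|UNIV :: nat set| \<le>o |UNIV :: 'u set|" using inf infinite_iff_card_of_nat by blast
  show "\<forall>n \<in> UNIV. |gen_stage L X n| \<le>o |UNIV :: 'u set|"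
  proof
    fix n show "|gen_stage L X n| \<le>o |UNIV :: 'u set|"
    proof (induction n)
      case 0
      then show ?case using X by simp
    next
      case (Suc n)
      have "|case_prod f ` (gen_stage L X n \<times> gen_stage L X n)| \<le>o |UNIV :: 'u set|" for f :: "'a \<Rightarrow> 'a \<Rightarrow> 'a"
        by (rule ordLeq_transitive[OF card_of_image card_of_Sigma_ordLeq_infinite[OF inf Suc ballI[OF Suc]]])
      moreover have "|{monoid.mult L, meet_rl L, join_rl L, ldiv L, rdiv L}| \<le>o |UNIV :: 'u set|"
        using ordLeq_total[OF card_of_Well_order card_of_Well_order] card_of_ordLeq_finite inf
        by (metis finite.simps)
      ultimately show ?case
        unfolding gen_stage.simps
        by (intro card_of_Un_ordLeq_UNIV[OF inf Suc] card_of_UNION_ordLeq_infinite[OF inf] ballI)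
    qed
  qed
qed

text \<open>The product of all chains may be too large for the type \<open>'u\<close>. The
  subalgebra generated by the images of \<open>B\<close> and \<open>C\<close> is not, because
  \<open>'u\<close> is infinite, and an injection \<open>s\<close> copies it into \<open>'u\<close>.
  Its projections separate points, which puts the copy into the variety.\<close>

lemma joint_amalgam:
  includes cardinal_syntax
  fixes B C :: "'u reslat" and F :: "'i \<Rightarrow> 'c reslat"
  assumes inf: "infinite (UNIV :: 'u set)"
    and B: "residuated_lattice B" and C: "residuated_lattice C"
    and F: "\<And>i. i \<in> I \<Longrightarrow> star_chain (F i)"
    and jB: "\<And>i. i \<in> I \<Longrightarrow> jB i \<in> hom_rl B (F i)" and jC: "\<And>i. i \<in> I \<Longrightarrow> jC i \<in> hom_rl C (F i)"
  obtains D :: "'u reslat" and gB gC where "D \<in> star_involutive_rl" "gB \<in> hom_rl B D" "gC \<in> hom_rl C D"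
    "\<And>b b'. \<lbrakk>b \<in> carrier B; b' \<in> carrier B\<rbrakk> \<Longrightarrow> gB b = gB b' \<longleftrightarrow> (\<forall>i \<in> I. jB i b = jB i b')"
    "\<And>c c'. \<lbrakk>c \<in> carrier C; c' \<in> carrier C\<rbrakk> \<Longrightarrow> gC c = gC c' \<longleftrightarrow> (\<forall>i \<in> I. jC i c = jC i c')"
    "\<And>b c. \<lbrakk>b \<in> carrier B; c \<in> carrier C\<rbrakk> \<Longrightarrow> gB b = gC c \<longleftrightarrow> (\<forall>i \<in> I. jB i b = jC i c)"
proof -
  interpret B: residuated_lattice B by (rule B)
  interpret C: residuated_lattice C by (rule C)
  define P where "P = product_rl I F"
  define kB where "kB b = (\<lambda>i \<in> I. jB i b)" for b
  define kC where "kC c = (\<lambda>i \<in> I. jC i c)" for c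
  define X where "X = kB ` carrier B \<union> kC ` carrier C"
  define T where "T = (\<Union>n. gen_stage P X n)"
  have rl: "residuated_lattice (F i)" if "i \<in> I" for i
    using F[OF that] by (simp add: star_chain_def totally_ordered_rl_def)
  note Fcl = residuated_lattice.closed_ops_carrier[OF rl, unfolded closed_ops_def]
  have Pcl: "closed_ops P (carrier P)"
    using Fcl by (auto simp: P_def product_rl_def closed_ops_def PiE_iff)
  have kB: "kB \<in> hom_rl B P"
    by (auto simp: P_def product_rl_def kB_def hom_rl_def hom_def hom_rlD[OF jB] intro!: restrict_ext)
  have kC: "kC \<in> hom_rl C P"
    by (auto simp: P_def product_rl_def kC_def hom_rl_def hom_def hom_rlD[OF jC] intro!: restrict_ext)
  have XP: "X \<subseteq> carrier P" using hom_rlD(1)[OF kB] hom_rlD(1)[OF kC] by (auto simp: X_def)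
  have "\<one>\<^bsub>P\<^esub> \<in> X" using hom_rlD(2)[OF kB] by (force simp: X_def)
  then have Tcl: "closed_ops P T" unfolding T_def by (rule gen_closed_ops)
  have TP: "T \<subseteq> carrier P" unfolding T_def using gen_stage_subset[OF Pcl XP] by blast
  have XT: "X \<subseteq> T" unfolding T_def using gen_stage.simps(1)[of P X] by blast
  have "|X| \<le>o |UNIV :: 'u set|"
    unfolding X_def
    by (intro card_of_Un_ordLeq_UNIV[OF inf] ordLeq_transitive[OF card_of_image card_of_mono1] subset_UNIV)
  then have "|T| \<le>o |UNIV :: 'u set|" unfolding T_def by (rule gen_card[OF inf])
  then obtain s :: "('i \<Rightarrow> 'c) \<Rightarrow> 'u" where s: "inj_on s T"
    using card_of_ordLeq[of T "UNIV :: 'u set"] by auto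
  define q where "q = inv_into T s"
  have qs: "q (s t) = t" if "t \<in> T" for t using that s by (simp add: q_def)
  define D :: "'u reslat" where "D = \<lparr>carrier = s ` T,
     monoid.mult = (\<lambda>x y. s (q x \<otimes>\<^bsub>P\<^esub> q y)), one = s \<one>\<^bsub>P\<^esub>,
     meet_rl = (\<lambda>x y. s (q x \<curlywedge>\<^bsub>P\<^esub> q y)), join_rl = (\<lambda>x y. s (q x \<curlyvee>\<^bsub>P\<^esub> q y)),
     ldiv = (\<lambda>x y. s (q x \<setminus>\<^bsub>P\<^esub> q y)), rdiv = (\<lambda>x y. s (q x \<oslash>\<^bsub>P\<^esub> q y))\<rparr>"
  have Dcl: "closed_ops D (carrier D)"
    using Tcl by (auto simp: D_def closed_ops_def qs)
  have proj: "(\<lambda>x. q x i) \<in> hom_rl D (F i)" if i: "i \<in> I" for i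
  proof -
    have "t i \<in> carrier (F i)" if "t \<in> T" for t
      using that TP i by (auto simp: P_def product_rl_def PiE_iff)
    moreover have "(x \<otimes>\<^bsub>P\<^esub> y) i = x i \<otimes>\<^bsub>F i\<^esub> y i" "(x \<curlywedge>\<^bsub>P\<^esub> y) i = x i \<curlywedge>\<^bsub>F i\<^esub> y i"
      "(x \<curlyvee>\<^bsub>P\<^esub> y) i = x i \<curlyvee>\<^bsub>F i\<^esub> y i" "(x \<setminus>\<^bsub>P\<^esub> y) i = x i \<setminus>\<^bsub>F i\<^esub> y i"
      "(x \<oslash>\<^bsub>P\<^esub> y) i = x i \<oslash>\<^bsub>F i\<^esub> y i" "\<one>\<^bsub>P\<^esub> i = \<one>\<^bsub>F i\<^esub>" for x y
      using i by (simp_all add: P_def product_rl_def)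
    ultimately show ?thesis
      using Tcl by (auto simp: D_def hom_rl_def hom_def qs closed_ops_def)
  qed
  have DK: "D \<in> star_involutive_rl"
  proof (rule star_involutive_of_homs[OF Dcl proj F])
    fix x y assume "x \<in> carrier D" "y \<in> carrier D" and eq: "\<And>i. i \<in> I \<Longrightarrow> q x i = q y i"
    then obtain t u where tu: "t \<in> T" "u \<in> T" "x = s t" "y = s u" by (auto simp: D_def)
    have "t \<in> (\<Pi>\<^sub>E i \<in> I. carrier (F i))" "u \<in> (\<Pi>\<^sub>E i \<in> I. carrier (F i))"
      using tu TP by (auto simp: P_def product_rl_def)
    then have "t = u" by (rule PiE_ext) (use eq tu qs in auto)
    then show "x = y" using tu by simp
  qed auto
  have kT: "kB b \<in> T" if "b \<in> carrier B" for b using that XT by (auto simp: X_def)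
  have kT': "kC c \<in> T" if "c \<in> carrier C" for c using that XT by (auto simp: X_def)
  have hB: "(\<lambda>b. s (kB b)) \<in> hom_rl B D"
    using kT by (auto simp: hom_rl_def hom_def D_def qs hom_rlD[OF kB] B.closed)
  have hC: "(\<lambda>c. s (kC c)) \<in> hom_rl C D"
    using kT' by (auto simp: hom_rl_def hom_def D_def qs hom_rlD[OF kC] C.closed)
  have seq: "s t = s u \<longleftrightarrow> t = u" if "t \<in> T" "u \<in> T" for t u using s that by (auto simp: inj_on_def)
  have ext: "(\<lambda>i \<in> I. u i) = (\<lambda>i \<in> I. v i) \<longleftrightarrow> (\<forall>i \<in> I. u i = v i)" for u v :: "'i \<Rightarrow> 'c"
    by (auto simp: fun_eq_iff restrict_def)
  show ?thesis
    by (rule that[OF DK hB hC]) (simp_all add: seq kT kT' kB_def kC_def ext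
        kT[unfolded kB_def] kT'[unfolded kC_def])
qed

section \<open>Lying over\<close>

context star_semilinear
begin

definition eqv :: "'a \<Rightarrow> 'a \<Rightarrow> 'a" where "eqv x y = imp_rl L x y \<curlywedge> imp_rl L y x"

lemma eqv_neg_cone: "\<lbrakk>x \<in> carrier L; y \<in> carrier L\<rbrakk> \<Longrightarrow> eqv x y \<in> neg_cone L"
  by (simp add: eqv_def neg_cone_meet imp_neg_cone)

lemma eqv_closed: "\<lbrakk>x \<in> carrier L; y \<in> carrier L\<rbrakk> \<Longrightarrow> eqv x y \<in> carrier L"
  by (simp add: eqv_def closed)

lemma eqv_mem_iff:
  assumes "delta_filter L P" "x \<in> carrier L" "y \<in> carrier L"
  shows "eqv x y \<in> P \<longleftrightarrow> imp_rl L x y \<in> P \<and> imp_rl L y x \<in> P"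
  using delta_filterD(3,4)[OF assms(1)] imp_neg_cone assms(2,3) meet_le1 meet_le2 closed
  unfolding eqv_def by metis

lemma eqv_one_iff: "\<lbrakk>x \<in> carrier L; y \<in> carrier L\<rbrakk> \<Longrightarrow> eqv x y = \<one> \<longleftrightarrow> x = y"
  using eqv_mem_iff[OF one_filter, of x y] imp_eq_one le_antisym le_refl by auto

text \<open>Products of negative elements lie below their meet. Together with
  \<open>meet_imp_le\<close> this makes \<open>imp_rl\<close> the relative pseudocomplement of the
  negative cone.\<close>

lemma heyting_le:
  assumes "x \<in> neg_cone L" "y \<in> neg_cone L" "z \<in> neg_cone L" "x \<curlywedge> z \<preceq> y"
  shows "z \<preceq> imp_rl L x y"
proof -
  note c = assms(1-3)[THEN neg_coneD(1)] and n = assms(1-3)[THEN neg_coneD(2)]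
  have "x \<otimes> z \<preceq> x" "x \<otimes> z \<preceq> z" "z \<otimes> x \<preceq> x" "z \<otimes> x \<preceq> z"
    using mult_mono_right[of z \<one> x] mult_mono_left[of x \<one> z] mult_mono_right[of x \<one> z]
      mult_mono_left[of z \<one> x] c n by auto
  then have "x \<otimes> z \<preceq> x \<curlywedge> z" "z \<otimes> x \<preceq> x \<curlywedge> z" using c by (simp_all add: le_meet)
  then have "x \<otimes> z \<preceq> y" "z \<otimes> x \<preceq> y"
    using le_trans[of "x \<otimes> z" "x \<curlywedge> z" y] le_trans[of "z \<otimes> x" "x \<curlywedge> z" y] assms(4) c closed by simp_all
  then show ?thesis using c n by (simp add: le_imp_iff)
qed

lemma meet_imp_le:
  assumes "x \<in> carrier L" "y \<in> carrier L"
  shows "x \<curlywedge> imp_rl L x y \<preceq> y"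
proof -
  define w where "w = x \<curlywedge> imp_rl L x y"
  note c = assms imp_closed[OF assms]
  have wc: "w \<in> carrier L" using c closed by (simp add: w_def)
  have "w \<otimes> w \<preceq> x \<otimes> w" "x \<otimes> w \<preceq> x \<otimes> imp_rl L x y"
    using mult_mono_left[of w x w] mult_mono_right[of w "imp_rl L x y" x] meet_le1 meet_le2 c wc
    by (simp_all add: w_def)
  moreover have "x \<otimes> imp_rl L x y \<preceq> y" using le_imp_iff[of x y "imp_rl L x y"] c le_refl by simp
  ultimately have "w \<otimes> w \<preceq> y"
    using le_trans[of "w \<otimes> w" "x \<otimes> w" y] le_trans[of "x \<otimes> w" "x \<otimes> imp_rl L x y" y] c wc by simp
  then show ?thesis using mult_idem wc by (simp add: w_def)
qed

lemma prime_avoiding: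
  assumes "w \<in> neg_cone L" "delta_filter L G" "w \<notin> G"
  obtains P where "prime_filter L P" "G \<subseteq> P" "w \<notin> P"
  by (rule prime_filter_exists[OF assms(2), of "{w}"])
    (use assms le_refl[OF neg_coneD(1)[OF assms(1)]] neg_coneD in
      \<open>auto simp: le_iff_join intro: that\<close>)

lemma prime_filterD: "prime_filter L P \<Longrightarrow> delta_filter L P"
  by (simp add: prime_filter_def)

lemma eqv_trans:
  assumes P: "delta_filter L P" and c: "x \<in> carrier L" "y \<in> carrier L" "z \<in> carrier L"
    and m: "eqv x y \<in> P" "eqv y z \<in> P"
  shows "eqv x z \<in> P"
proof -
  have "imp_rl L x z \<in> P" if "x \<in> carrier L" "y \<in> carrier L" "z \<in> carrier L" "imp_rl L x y \<in> P" "imp_rl L y z \<in> P"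
    for x y z
    using delta_filterD(3)[OF P delta_filterD(4)[OF P that(4,5)] imp_neg_cone[OF that(1,3)] imp_trans[OF that(1-3)]] .
  from this[OF c] this[OF c(3,2,1)] show ?thesis
    using m eqv_mem_iff[OF P c(1,2)] eqv_mem_iff[OF P c(2,3)] eqv_mem_iff[OF P c(1,3)] by simp
qed

lemma eqv_sym: "\<lbrakk>x \<in> carrier L; y \<in> carrier L\<rbrakk> \<Longrightarrow> eqv x y = eqv y x"
  by (simp add: eqv_def meet_comm imp_closed)

end

section \<open>Embeddings and primes lying over primes\<close>

locale star_embedding =
  A: star_semilinear A IA FA hA + B: star_semilinear B IB FB hB
  for A :: "('a, 'x) reslat_scheme" and IA :: "'i set" and FA :: "'i \<Rightarrow> ('c, 'y) reslat_scheme" and hA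
    and B :: "('b, 'z) reslat_scheme" and IB :: "'j set" and FB :: "'j \<Rightarrow> ('d, 'w) reslat_scheme" and hB +
  fixes f :: "'a \<Rightarrow> 'b"
  assumes emb: "f \<in> emb_rl A B"
begin

lemma fhom: "f \<in> hom_rl A B" using emb by (simp add: emb_rl_def)

lemmas fs = A.hom_simps[OF fhom]

lemma f_inj: "\<lbrakk>a \<in> carrier A; a' \<in> carrier A\<rbrakk> \<Longrightarrow> f a = f a' \<longleftrightarrow> a = a'"
  using emb by (auto simp: emb_rl_def inj_on_def)

lemma f_le: "\<lbrakk>a \<in> carrier A; a' \<in> carrier A\<rbrakk> \<Longrightarrow> f a \<preceq>\<^bsub>B\<^esub> f a' \<longleftrightarrow> a \<preceq>\<^bsub>A\<^esub> a'"
  using f_inj[of "a \<curlywedge>\<^bsub>A\<^esub> a'" a] fs(4)[of a a'] A.meet_closed[of a a'] by (simp add: le_rl_def)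

lemma f_neg_cone: "a \<in> carrier A \<Longrightarrow> f a \<in> neg_cone B \<longleftrightarrow> a \<in> neg_cone A"
  using f_le[of a "\<one>\<^bsub>A\<^esub>"] by (simp add: neg_cone_def fs)

lemma f_eqv: "\<lbrakk>a \<in> carrier A; a' \<in> carrier A\<rbrakk> \<Longrightarrow> f (A.eqv a a') = B.eqv (f a) (f a')"
  by (simp add: A.eqv_def B.eqv_def fs A.closed)

lemma f_neg: "a \<in> neg_cone A \<Longrightarrow> f a \<in> neg_cone B"
  using f_neg_cone A.neg_coneD(1) by blast

lemma preimage_filter:
  assumes P: "delta_filter B P"
  shows "delta_filter A {a \<in> neg_cone A. f a \<in> P}" (is "delta_filter A ?Q")
  unfolding delta_filter_def
proof (intro conjI ballI impI)
  show "\<one>\<^bsub>A\<^esub> \<in> ?Q" using A.one_neg_cone B.delta_filterD(2)[OF P] by (simp add: fs)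
  show "y \<in> ?Q" if "x \<in> ?Q" "y \<in> neg_cone A" "x \<preceq>\<^bsub>A\<^esub> y" for x y
    using that B.delta_filterD(3)[OF P, of "f x" "f y"] f_le[of x y] f_neg A.neg_coneD by simp
  show "x \<curlywedge>\<^bsub>A\<^esub> y \<in> ?Q" if "x \<in> ?Q" "y \<in> ?Q" for x y
    using that B.delta_filterD(4)[OF P, of "f x" "f y"] A.neg_cone_meet A.neg_coneD by (simp add: fs)
  show "delta_rl A x \<in> ?Q" if "x \<in> ?Q" for x
    using that B.delta_filterD(5)[OF P, of "f x"] A.dpow_neg_cone[of x 1] A.neg_coneD by (simp add: fs)
qed auto

lemma restriction:
  assumes "prime_filter B P"
  shows "prime_filter A {a \<in> neg_cone A. f a \<in> P}"
  using assms preimage_filter f_neg A.neg_coneD by (auto simp: prime_filter_def fs)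

text \<open>The assumption on \<open>u\<close> is necessary for a filter containing \<open>u\<close>
  to restrict to \<open>Q\<close>. It suffices: the filter generated by the image of
  \<open>Q\<close> and by \<open>u\<close> avoids the image of the complement of \<open>Q\<close>,
  which is closed under joins since \<open>Q\<close> is prime, and so a prime filter exists between
  them.\<close>

lemma lying_over:
  assumes Q: "prime_filter A Q" and u: "u \<in> neg_cone B"
    and uQ: "\<And>n a. \<lbrakk>a \<in> neg_cone A; B.dpow n u \<preceq>\<^bsub>B\<^esub> f a\<rbrakk> \<Longrightarrow> a \<in> Q"
  obtains P where "prime_filter B P" "u \<in> P" "\<And>a. a \<in> neg_cone A \<Longrightarrow> f a \<in> P \<longleftrightarrow> a \<in> Q"
proof -
  have Qf: "delta_filter A Q" using Q by (simp add: prime_filter_def)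
  note n = f_neg
  note Qn = A.delta_filterD(1)[OF Qf]
  have Qc: "x \<in> carrier A" if "x \<in> Q" for x using Qn[OF that] A.neg_coneD by simp
  define G where "G = {z \<in> neg_cone B. \<exists>x \<in> Q. f x \<preceq>\<^bsub>B\<^esub> z}"
  have fQG: "f x \<in> G" if "x \<in> Q" for x
    using n[OF Qn[OF that]] B.le_refl[of "f x"] B.neg_coneD that by (auto simp: G_def)
  have G: "delta_filter B G"
    unfolding delta_filter_def
  proof (intro conjI ballI impI)
    show "\<one>\<^bsub>B\<^esub> \<in> G" using fQG[OF A.delta_filterD(2)[OF Qf]] by (simp add: fs)
  next
    fix x y assume x: "x \<in> G" and y: "y \<in> neg_cone B" "x \<preceq>\<^bsub>B\<^esub> y"
    then obtain a where a: "a \<in> Q" "f a \<preceq>\<^bsub>B\<^esub> x" "x \<in> neg_cone B" by (auto simp: G_def)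
    then have "f a \<preceq>\<^bsub>B\<^esub> y" using B.le_trans[of "f a" x y] y B.neg_coneD n Qn by blast
    then show "y \<in> G" using a y by (auto simp: G_def)
  next
    fix x y assume "x \<in> G" "y \<in> G"
    then obtain a b where ab: "a \<in> Q" "f a \<preceq>\<^bsub>B\<^esub> x" "x \<in> neg_cone B" "b \<in> Q" "f b \<preceq>\<^bsub>B\<^esub> y" "y \<in> neg_cone B"
      by (auto simp: G_def)
    have "f (a \<curlywedge>\<^bsub>A\<^esub> b) \<preceq>\<^bsub>B\<^esub> x \<curlywedge>\<^bsub>B\<^esub> y"
      using ab B.meet_mono[of "f a" "f b" x y] B.neg_coneD Qc by (simp add: fs)
    then show "x \<curlywedge>\<^bsub>B\<^esub> y \<in> G"
      using A.delta_filterD(4)[OF Qf ab(1,4)] B.neg_cone_meet[OF ab(3,6)] by (auto simp: G_def)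
  next
    fix x assume "x \<in> G"
    then obtain a where a: "a \<in> Q" "f a \<preceq>\<^bsub>B\<^esub> x" "x \<in> neg_cone B" by (auto simp: G_def)
    have "f (delta_rl A a) \<preceq>\<^bsub>B\<^esub> delta_rl B x"
      using a B.delta_mono[of "f a" x] B.neg_coneD Qc by (simp add: fs)
    then show "delta_rl B x \<in> G"
      using A.delta_filterD(5)[OF Qf a(1)] B.dpow_neg_cone[OF a(3), of 1] by (auto simp: G_def)
  qed (auto simp: G_def)
  define S where "S = f ` (neg_cone A - Q)"
  have "B.extend G u \<inter> S = {}"
  proof (rule ccontr)
    assume "\<not> ?thesis"
    then obtain y m g where y: "y \<in> neg_cone A" "y \<notin> Q" and g: "g \<in> G" "g \<curlywedge>\<^bsub>B\<^esub> B.dpow m u \<preceq>\<^bsub>B\<^esub> f y"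
      by (auto simp: B.extend_def S_def)
    then obtain x where x: "x \<in> Q" "f x \<preceq>\<^bsub>B\<^esub> g" "g \<in> neg_cone B" by (auto simp: G_def)
    note c = A.neg_coneD(1)[OF y(1)] Qc[OF x(1)] B.neg_coneD(1)[OF u] B.neg_coneD(1)[OF x(3)]
    have du: "B.dpow m u \<in> neg_cone B" using B.dpow_neg_cone[OF u] .
    note dc = B.neg_coneD(1)[OF du]
    have "f x \<curlywedge>\<^bsub>B\<^esub> B.dpow m u \<preceq>\<^bsub>B\<^esub> g \<curlywedge>\<^bsub>B\<^esub> B.dpow m u"
      using x c dc B.meet_mono B.le_refl by (simp add: fs)
    then have "f x \<curlywedge>\<^bsub>B\<^esub> B.dpow m u \<preceq>\<^bsub>B\<^esub> f y"
      using B.le_trans[of "f x \<curlywedge>\<^bsub>B\<^esub> B.dpow m u" "g \<curlywedge>\<^bsub>B\<^esub> B.dpow m u" "f y"] g c dc B.closed by (simp add: fs)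
    \<comment> \<open>Residuation moves \<open>f x\<close> to the right, where the implication is
      the image of one formed in \<open>A\<close>. The assumption \<open>uQ\<close> therefore
      applies to it, and modus ponens inside \<open>Q\<close> yields \<open>y\<close>.\<close>
    then have "B.dpow m u \<preceq>\<^bsub>B\<^esub> imp_rl B (f x) (f y)"
      using B.heyting_le n y Qn[OF x(1)] du by blast
    then have "imp_rl A x y \<in> Q"
      using uQ[of "imp_rl A x y" m] c A.imp_neg_cone by (simp add: fs)
    then have "x \<curlywedge>\<^bsub>A\<^esub> imp_rl A x y \<in> Q" using A.delta_filterD(4)[OF Qf x(1)] by simp
    then have "y \<in> Q" using A.delta_filterD(3)[OF Qf _ y(1) A.meet_imp_le] c by simp
    then show False using y by simp
  qed
  moreover have "S \<subseteq> neg_cone B" using n by (auto simp: S_def)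
  moreover have "x \<curlyvee>\<^bsub>B\<^esub> y \<in> S" if "x \<in> S" "y \<in> S" for x y
  proof -
    obtain a b where ab: "a \<in> neg_cone A" "a \<notin> Q" "b \<in> neg_cone A" "b \<notin> Q" "x = f a" "y = f b"
      using \<open>x \<in> S\<close> \<open>y \<in> S\<close> by (auto simp: S_def)
    then have "a \<curlyvee>\<^bsub>A\<^esub> b \<in> neg_cone A - Q" using Q A.neg_cone_join by (auto simp: prime_filter_def)
    then have "f (a \<curlyvee>\<^bsub>A\<^esub> b) \<in> S" by (simp add: S_def)
    then show ?thesis using ab A.neg_coneD by (simp add: fs)
  qed
  ultimately obtain P where P: "prime_filter B P" "B.extend G u \<subseteq> P" "P \<inter> S = {}"
    using B.prime_filter_exists[OF B.extend_filter(1)[OF G u]] by metis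
  show ?thesis
  proof (rule that[OF P(1)])
    show "u \<in> P" using P(2) B.extend_filter(3)[OF G u] by blast
    show "f a \<in> P \<longleftrightarrow> a \<in> Q" if "a \<in> neg_cone A" for a
      using that subsetD[OF P(2)] subsetD[OF B.extend_filter(2)[OF G u], of "f a"] fQG[of a] P(3)
      unfolding S_def by blast
  qed
qed

lemma lying_over_one:
  assumes "prime_filter A Q"
  obtains P where "prime_filter B P" "\<And>a. a \<in> neg_cone A \<Longrightarrow> f a \<in> P \<longleftrightarrow> a \<in> Q"
proof (rule lying_over[OF assms B.one_neg_cone])
  fix n a assume a: "a \<in> neg_cone A" and le: "B.dpow n \<one>\<^bsub>B\<^esub> \<preceq>\<^bsub>B\<^esub> f a"
  have "B.dpow n \<one>\<^bsub>B\<^esub> = \<one>\<^bsub>B\<^esub>" by (induction n) (simp_all add: B.delta_one)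
  then have "\<one>\<^bsub>A\<^esub> \<preceq>\<^bsub>A\<^esub> a" using le f_le[of "\<one>\<^bsub>A\<^esub>" a] a A.neg_coneD by (simp add: fs)
  then have "a = \<one>\<^bsub>A\<^esub>" using A.one_le_iff[of a] a A.neg_coneD by simp
  then show "a \<in> Q" using assms A.delta_filterD(2) by (simp add: prime_filter_def)
qed (use that in blast)

lemma eqv_restrict:
  assumes P: "prime_filter B P" and Q: "prime_filter A Q" and PQ: "\<And>a. a \<in> neg_cone A \<Longrightarrow> f a \<in> P \<longleftrightarrow> a \<in> Q"
    and b: "b \<in> carrier B" and a: "a \<in> carrier A" "a' \<in> carrier A"
    and m: "B.eqv b (f a) \<in> P" "B.eqv b (f a') \<in> P"
  shows "A.eqv a a' \<in> Q"
proof -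
  have fa: "f a \<in> carrier B" "f a' \<in> carrier B" using a fs(1) by auto
  have "B.eqv (f a) (f a') \<in> P"
    using B.eqv_trans[OF B.prime_filterD[OF P] fa(1) b fa(2) _ m(2)] m(1) B.eqv_sym[OF b fa(1)] by simp
  then show ?thesis using PQ[OF A.eqv_neg_cone[OF a]] f_eqv[OF a] by simp
qed

end

section \<open>Amalgams of prime quotients\<close>

locale star_span =
  f: star_embedding A IA FA hA B IB FB hB f + g: star_embedding A IA FA hA C IC FC hC g
  for A :: "('a, 'x) reslat_scheme" and IA :: "'i set" and FA :: "'i \<Rightarrow> ('k, 'y) reslat_scheme" and hA
    and B :: "('b, 'z) reslat_scheme" and IB :: "'j set" and FB :: "'j \<Rightarrow> ('l, 'w) reslat_scheme" and hB f
    and C :: "('c, 'v) reslat_scheme" and IC :: "'n set" and FC :: "'n \<Rightarrow> ('m, 'u) reslat_scheme" and hC g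
begin

text \<open>The preorders of \<open>B\<close> modulo \<open>P\<close> and of \<open>C\<close> modulo
  \<open>Q\<close> are amalgamated over the pairs of images of \<open>A\<close>, and equivalence is
  factored out once at the end. The last clause is chain-level strongness.\<close>

lemma pair_chain:
  assumes P: "prime_filter B P" and Q: "prime_filter C Q"
    and PQ: "\<And>a. a \<in> neg_cone A \<Longrightarrow> f a \<in> P \<longleftrightarrow> g a \<in> Q"
  shows "\<exists>(D :: ('b + 'c) reslat) jB jC. star_chain D \<and> jB \<in> hom_rl B D \<and> jC \<in> hom_rl C D \<and>
    (\<forall>a \<in> carrier A. jB (f a) = jC (g a)) \<and>
    (\<forall>b \<in> carrier B. \<forall>b' \<in> carrier B. jB b = jB b' \<longleftrightarrow> f.B.eqv b b' \<in> P) \<and>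
    (\<forall>c \<in> carrier C. \<forall>c' \<in> carrier C. jC c = jC c' \<longleftrightarrow> g.B.eqv c c' \<in> Q) \<and>
    (\<forall>b \<in> carrier B. \<forall>c \<in> carrier C. jB b = jC c \<longrightarrow>
      (\<exists>a \<in> carrier A. f.B.eqv b (f a) \<in> P \<and> g.B.eqv c (g a) \<in> Q))"
proof -
  interpret BP: star_semilinear_prime B IB FB hB P
    by unfold_locales (rule P)
  interpret CP: star_semilinear_prime C IC FC hC Q
    by unfold_locales (rule Q)
  interpret SB: preskeleton "carrier B" BP.ple "\<one>\<^bsub>B\<^esub>" "lneg_rl B" "rneg_rl B" by (rule BP.preskeleton)
  interpret SC: preskeleton "carrier C" CP.ple "\<one>\<^bsub>C\<^esub>" "lneg_rl C" "rneg_rl C" by (rule CP.preskeleton)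
  define R where "R = (\<lambda>a. (f a, g a)) ` carrier A"
  \<comment> \<open>Equal restrictions of \<open>P\<close> and \<open>Q\<close> enter here: the
    order of both quotients on the images of \<open>a\<close> and \<open>a'\<close> is decided by
    the single element \<open>imp_rl A a a'\<close>.\<close>
  have le_R: "BP.ple (f a) (f a') \<longleftrightarrow> CP.ple (g a) (g a')" if "a \<in> carrier A" "a' \<in> carrier A" for a a'
    using PQ[of "imp_rl A a a'"] f.A.imp_neg_cone that
    by (simp add: BP.ple_def CP.ple_def f.fs g.fs)
  interpret S: preskeleton_span "carrier B" BP.ple "\<one>\<^bsub>B\<^esub>" "lneg_rl B" "rneg_rl B"
    "carrier C" CP.ple "\<one>\<^bsub>C\<^esub>" "lneg_rl C" "rneg_rl C" R
  proof
    show "p \<in> carrier B" "q \<in> carrier C" if "(p, q) \<in> R" for p q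
      using that f.fs(1) g.fs(1) by (auto simp: R_def)
    show "(\<one>\<^bsub>B\<^esub>, \<one>\<^bsub>C\<^esub>) \<in> R"
      unfolding R_def by (rule image_eqI[of _ _ "\<one>\<^bsub>A\<^esub>"]) (simp_all add: f.fs(2) g.fs(2))
    show "(lneg_rl B p, lneg_rl C q) \<in> R" "(rneg_rl B p, rneg_rl C q) \<in> R" if "(p, q) \<in> R" for p q
    proof -
      obtain a where a: "a \<in> carrier A" "p = f a" "q = g a" using \<open>(p, q) \<in> R\<close> by (auto simp: R_def)
      show "(lneg_rl B p, lneg_rl C q) \<in> R"
        unfolding R_def by (rule image_eqI[of _ _ "lneg_rl A a"]) (simp_all add: a f.fs(8) g.fs(8) f.A.closed)
      show "(rneg_rl B p, rneg_rl C q) \<in> R"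
        unfolding R_def by (rule image_eqI[of _ _ "rneg_rl A a"]) (simp_all add: a f.fs(9) g.fs(9) f.A.closed)
    qed
    show "BP.ple p p' \<longleftrightarrow> CP.ple q q'" if "(p, q) \<in> R" "(p', q') \<in> R" for p q p' q'
      using that le_R by (auto simp: R_def)
  qed
  define le where "le = amalg_le BP.ple \<one>\<^bsub>B\<^esub> CP.ple \<one>\<^bsub>C\<^esub> R"
  let ?X = "carrier B <+> carrier C"
  let ?l = "map_sum (lneg_rl B) (lneg_rl C)" and ?r = "map_sum (rneg_rl B) (rneg_rl C)"
  interpret M: preskeleton ?X le "Inl \<one>\<^bsub>B\<^esub>" ?l ?r
    unfolding le_def by (rule S.amalgam)
  define D where "D = chain_rl (M.rep ` ?X) le (M.rep (Inl \<one>\<^bsub>B\<^esub>)) (\<lambda>x. M.rep (?l x)) (\<lambda>x. M.rep (?r x))"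
  define jB where "jB b = M.rep (Inl b)" for b
  define jC where "jC c = M.rep (Inr c)" for c
  have leI: "le (Inl b) (Inl b') \<longleftrightarrow> BP.ple b b'" "le (Inr c) (Inr c') \<longleftrightarrow> CP.ple c c'" for b b' c c'
    by (simp_all add: le_def)
  have le: "le = S.leD" by (simp add: le_def S.leD_def)
  have glue: "M.rep (Inl (f a)) = M.rep (Inr (g a))" if "a \<in> carrier A" for a
  proof -
    have "(f a, g a) \<in> R" using that by (simp add: R_def)
    then show ?thesis
      using M.rep_eq_iff[of "Inl (f a)" "Inr (g a)"] S.leD_glue f.fs(1)[OF that] g.fs(1)[OF that]
      by (auto simp: le)
  qed
  have "star_chain D" unfolding D_def by (rule skeleton.star_chain[OF M.quotient])
  moreover have "jB \<in> hom_rl B D"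
    unfolding D_def
  proof (rule BP.hom_into_chain[OF M.quotient])
    show "le (jB x) (jB y) \<longleftrightarrow> BP.ple x y" if "x \<in> carrier B" "y \<in> carrier B" for x y
      using that by (simp add: jB_def M.leq_rep_left M.leq_rep_right M.rep(1) leI InlI)
    show "jB (lneg_rl B x) = M.rep (?l (jB x))" "jB (rneg_rl B x) = M.rep (?r (jB x))" if "x \<in> carrier B" for x
      using M.rep_l[of "Inl x"] M.rep_r[of "Inl x"] that by (simp_all add: jB_def InlI)
  qed (simp_all add: jB_def InlI)
  moreover have "jC \<in> hom_rl C D"
    unfolding D_def
  proof (rule CP.hom_into_chain[OF M.quotient])
    show "le (jC x) (jC y) \<longleftrightarrow> CP.ple x y" if "x \<in> carrier C" "y \<in> carrier C" for x y
      using that by (simp add: jC_def M.leq_rep_left M.leq_rep_right M.rep(1) leI InrI)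
    show "jC (lneg_rl C x) = M.rep (?l (jC x))" "jC (rneg_rl C x) = M.rep (?r (jC x))" if "x \<in> carrier C" for x
      using M.rep_l[of "Inr x"] M.rep_r[of "Inr x"] that by (simp_all add: jC_def InrI)
    show "jC \<one>\<^bsub>C\<^esub> = M.rep (Inl \<one>\<^bsub>B\<^esub>)"
      using glue[of "\<one>\<^bsub>A\<^esub>"] by (simp add: jC_def f.fs(2) g.fs(2))
  qed (simp_all add: jC_def InrI)
  moreover have "jB b = jB b' \<longleftrightarrow> f.B.eqv b b' \<in> P" if "b \<in> carrier B" "b' \<in> carrier B" for b b'
    using M.rep_eq_iff[of "Inl b" "Inl b'"] f.B.eqv_mem_iff[OF BP.filter that] that
    by (auto simp: jB_def leI BP.ple_def)
  moreover have "jC c = jC c' \<longleftrightarrow> g.B.eqv c c' \<in> Q" if "c \<in> carrier C" "c' \<in> carrier C" for c c'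
    using M.rep_eq_iff[of "Inr c" "Inr c'"] g.B.eqv_mem_iff[OF CP.filter that] that
    by (auto simp: jC_def leI CP.ple_def)
  moreover have "\<exists>a \<in> carrier A. f.B.eqv b (f a) \<in> P \<and> g.B.eqv c (g a) \<in> Q"
    if bc: "b \<in> carrier B" "c \<in> carrier C" "jB b = jC c" for b c
  proof -
    have "le (Inl b) (Inr c)" "le (Inr c) (Inl b)"
      using M.rep_eq_iff[of "Inl b" "Inr c"] bc by (auto simp: jB_def jC_def)
    from S.glued_eq[OF bc(1,2) this[unfolded le]]
    obtain a where a: "a \<in> carrier A" "BP.ple b (f a)" "BP.ple (f a) b" "CP.ple c (g a)" "CP.ple (g a) c"
      by (auto simp: R_def)
    then show ?thesis
      using f.B.eqv_mem_iff[OF BP.filter bc(1) f.fs(1)] g.B.eqv_mem_iff[OF CP.filter bc(2) g.fs(1)]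
      by (auto simp: BP.ple_def CP.ple_def)
  qed
  moreover have "jB (f a) = jC (g a)" if "a \<in> carrier A" for a
    using glue[OF that] by (simp add: jB_def jC_def)
  ultimately show ?thesis by blast
qed

end

section \<open>Strong amalgamation\<close>

context star_span
begin

definition pairs :: "('b set \<times> 'c set) set"
  where "pairs = {(P, Q). prime_filter B P \<and> prime_filter C Q \<and> (\<forall>a \<in> neg_cone A. f a \<in> P \<longleftrightarrow> g a \<in> Q)}"

text \<open>Local membership in the common part: the witness \<open>a\<close> may change from pair
  to pair. It follows from \<open>b\<close> and \<open>c\<close> having equal images in all the
  chain amalgams.\<close>

definition joined :: "'b \<Rightarrow> 'c \<Rightarrow> bool"
  where "joined b c \<longleftrightarrow> (\<forall>(P, Q) \<in> pairs. \<exists>a \<in> carrier A. f.B.eqv b (f a) \<in> P \<and> g.B.eqv c (g a) \<in> Q)"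

lemma pair_over:
  assumes "prime_filter B P"
  obtains Q where "(P, Q) \<in> pairs"
proof -
  obtain Q where "prime_filter C Q" "\<And>a. a \<in> neg_cone A \<Longrightarrow> g a \<in> Q \<longleftrightarrow> a \<in> {a \<in> neg_cone A. f a \<in> P}"
    using g.lying_over_one[OF f.restriction[OF assms]] by metis
  then have "(P, Q) \<in> pairs" using assms by (auto simp: pairs_def)
  then show ?thesis by (rule that)
qed

lemma joined_locally:
  assumes "joined b c" "prime_filter B P"
  shows "\<exists>a \<in> carrier A. f.B.eqv b (f a) \<in> P"
proof -
  obtain Q where "(P, Q) \<in> pairs" using pair_over[OF assms(2)] .
  then show ?thesis using assms(1) by (auto simp: joined_def)
qed

text \<open>\<open>U u\<close> and \<open>U v\<close> collect the elements of \<open>A\<close> above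
  iterates of the equivalences of \<open>b\<close> with the two images. If the filter
  \<open>G\<close> they generate missed the equivalence \<open>w\<close> of \<open>a1\<close> and
  \<open>a2\<close>, some prime \<open>Z\<close> above \<open>G\<close> would miss it. Over
  \<open>Z\<close> lie primes \<open>P1\<close> containing \<open>u\<close> and \<open>P2\<close>
  containing \<open>v\<close>, and a single \<open>Q\<close> of \<open>C\<close>. Modulo
  \<open>Z\<close> the witnesses \<open>d1\<close> and \<open>d2\<close> for the pairs with
  \<open>Q\<close> agree with \<open>a1\<close> and \<open>a2\<close> through \<open>b\<close>, and
  with each other through \<open>c\<close>; hence \<open>w\<close> would belong to
  \<open>Z\<close>.\<close>

lemma joined_bound:
  assumes bc: "b \<in> carrier B" "c \<in> carrier C" "joined b c" and a: "a1 \<in> carrier A" "a2 \<in> carrier A"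
  obtains p q n m where "p \<in> neg_cone A" "q \<in> neg_cone A"
    "f.B.dpow n (f.B.eqv b (f a1)) \<preceq>\<^bsub>B\<^esub> f p" "f.B.dpow m (f.B.eqv b (f a2)) \<preceq>\<^bsub>B\<^esub> f q"
    "p \<curlywedge>\<^bsub>A\<^esub> q \<preceq>\<^bsub>A\<^esub> f.A.eqv a1 a2"
proof -
  define u where "u = f.B.eqv b (f a1)"
  define v where "v = f.B.eqv b (f a2)"
  define w where "w = f.A.eqv a1 a2"
  have fa: "f a1 \<in> carrier B" "f a2 \<in> carrier B" using a f.fs(1) by auto
  have u: "u \<in> neg_cone B" and v: "v \<in> neg_cone B" and w: "w \<in> neg_cone A"
    using bc fa a f.B.eqv_neg_cone f.A.eqv_neg_cone by (simp_all add: u_def v_def w_def)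
  note uc = f.B.neg_coneD(1)[OF u] and vc = f.B.neg_coneD(1)[OF v] and nc = f.A.neg_coneD(1)
  define U where "U s = {x \<in> neg_cone A. f x \<in> f.B.extend {\<one>\<^bsub>B\<^esub>} s}" for s
  have U: "delta_filter A (U s)" if "s \<in> neg_cone B" for s
    unfolding U_def by (rule f.preimage_filter[OF f.B.extend_filter(1)[OF f.B.one_filter that]])
  have U_iff: "x \<in> U s \<longleftrightarrow> x \<in> neg_cone A \<and> (\<exists>n. f.B.dpow n s \<preceq>\<^bsub>B\<^esub> f x)" if "s \<in> neg_cone B" for s x
    using f.f_neg f.B.le_absorb(2)[OF _ _ f.B.neg_coneD(2)[OF f.B.dpow_neg_cone[OF that]]]
      f.B.neg_coneD(1)[OF f.B.dpow_neg_cone[OF that]]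
    by (auto simp: U_def f.B.extend_def)
  note Uone = f.A.delta_filterD(2)[OF U] and Umeet = f.A.delta_filterD(4)[OF U]
    and Udelta = f.A.delta_filterD(5)[OF U]
  define G where "G = {x \<in> neg_cone A. \<exists>p \<in> U u. \<exists>q \<in> U v. p \<curlywedge>\<^bsub>A\<^esub> q \<preceq>\<^bsub>A\<^esub> x}"
  have Uc: "x \<in> carrier A" "x \<in> neg_cone A" if "x \<in> U s" for x s using that nc by (auto simp: U_def)
  have UG: "U u \<subseteq> G" "U v \<subseteq> G"
  proof -
    have "x \<in> G" if "x \<in> U u" for x
      using Uone[OF v] f.A.meet_le1[OF Uc(1)[OF that] f.A.one_closed] Uc(2)[OF that] that by (auto simp: G_def)
    moreover have "x \<in> G" if "x \<in> U v" for x
      using Uone[OF u] f.A.meet_le2[OF f.A.one_closed Uc(1)[OF that]] Uc(2)[OF that] that by (auto simp: G_def)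
    ultimately show "U u \<subseteq> G" "U v \<subseteq> G" by auto
  qed
  have G: "delta_filter A G"
    unfolding delta_filter_def
  proof (intro conjI ballI impI)
    show "\<one>\<^bsub>A\<^esub> \<in> G" using UG Uone[OF u] by blast
  next
    fix x y assume x: "x \<in> G" and y: "y \<in> neg_cone A" "x \<preceq>\<^bsub>A\<^esub> y"
    then obtain p q where pq: "p \<in> U u" "q \<in> U v" "p \<curlywedge>\<^bsub>A\<^esub> q \<preceq>\<^bsub>A\<^esub> x" "x \<in> neg_cone A" by (auto simp: G_def)
    then have "p \<curlywedge>\<^bsub>A\<^esub> q \<preceq>\<^bsub>A\<^esub> y"
      using f.A.le_trans[of "p \<curlywedge>\<^bsub>A\<^esub> q" x y] y Uc nc f.A.meet_closed by simp
    then show "y \<in> G" using pq y by (auto simp: G_def)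
  next
    fix x y assume "x \<in> G" "y \<in> G"
    then obtain p q p' q' where pq: "p \<in> U u" "q \<in> U v" "p \<curlywedge>\<^bsub>A\<^esub> q \<preceq>\<^bsub>A\<^esub> x" "x \<in> neg_cone A"
      and pq': "p' \<in> U u" "q' \<in> U v" "p' \<curlywedge>\<^bsub>A\<^esub> q' \<preceq>\<^bsub>A\<^esub> y" "y \<in> neg_cone A" by (auto simp: G_def)
    note c = Uc(1)[OF pq(1)] Uc(1)[OF pq(2)] Uc(1)[OF pq'(1)] Uc(1)[OF pq'(2)] nc[OF pq(4)] nc[OF pq'(4)] f.A.meet_closed
    have "(p \<curlywedge>\<^bsub>A\<^esub> p') \<curlywedge>\<^bsub>A\<^esub> (q \<curlywedge>\<^bsub>A\<^esub> q') \<preceq>\<^bsub>A\<^esub> p \<curlywedge>\<^bsub>A\<^esub> q" "(p \<curlywedge>\<^bsub>A\<^esub> p') \<curlywedge>\<^bsub>A\<^esub> (q \<curlywedge>\<^bsub>A\<^esub> q') \<preceq>\<^bsub>A\<^esub> p' \<curlywedge>\<^bsub>A\<^esub> q'"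
      using c by (intro f.A.meet_mono f.A.meet_le1 f.A.meet_le2; simp)+
    then have "(p \<curlywedge>\<^bsub>A\<^esub> p') \<curlywedge>\<^bsub>A\<^esub> (q \<curlywedge>\<^bsub>A\<^esub> q') \<preceq>\<^bsub>A\<^esub> x \<curlywedge>\<^bsub>A\<^esub> y"
      using f.A.le_meet f.A.le_trans[of "(p \<curlywedge>\<^bsub>A\<^esub> p') \<curlywedge>\<^bsub>A\<^esub> (q \<curlywedge>\<^bsub>A\<^esub> q')" "p \<curlywedge>\<^bsub>A\<^esub> q" x]
        f.A.le_trans[of "(p \<curlywedge>\<^bsub>A\<^esub> p') \<curlywedge>\<^bsub>A\<^esub> (q \<curlywedge>\<^bsub>A\<^esub> q')" "p' \<curlywedge>\<^bsub>A\<^esub> q'" y] pq(3) pq'(3) c by simp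
    then show "x \<curlywedge>\<^bsub>A\<^esub> y \<in> G"
      using Umeet[OF u pq(1) pq'(1)] Umeet[OF v pq(2) pq'(2)] f.A.neg_cone_meet[OF pq(4) pq'(4)] by (auto simp: G_def)
  next
    fix x assume "x \<in> G"
    then obtain p q where pq: "p \<in> U u" "q \<in> U v" "p \<curlywedge>\<^bsub>A\<^esub> q \<preceq>\<^bsub>A\<^esub> x" "x \<in> neg_cone A" by (auto simp: G_def)
    then have "delta_rl A p \<curlywedge>\<^bsub>A\<^esub> delta_rl A q \<preceq>\<^bsub>A\<^esub> delta_rl A x"
      using f.A.delta_mono[of "p \<curlywedge>\<^bsub>A\<^esub> q" x] f.A.delta_meet[of p q] Uc nc f.A.meet_closed by simp
    then show "delta_rl A x \<in> G"
      using Udelta[OF u pq(1)] Udelta[OF v pq(2)] f.A.dpow_neg_cone[OF pq(4), of 1] by (auto simp: G_def)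
  qed (auto simp: G_def)
  have "w \<in> G"
  proof (rule ccontr)
    assume "w \<notin> G"
    then obtain Z where Z: "prime_filter A Z" "G \<subseteq> Z" "w \<notin> Z" using f.A.prime_avoiding[OF w G] by blast
    have sU: "x \<in> Z" if "x \<in> neg_cone A" "f.B.dpow n s \<preceq>\<^bsub>B\<^esub> f x" "s = u \<or> s = v" for x n s
    proof -
      have "x \<in> U u \<or> x \<in> U v" using that U_iff[OF u, of x] U_iff[OF v, of x] by blast
      then show ?thesis using UG Z(2) by blast
    qed
    obtain P1 where P1: "prime_filter B P1" "u \<in> P1" "\<And>x. x \<in> neg_cone A \<Longrightarrow> f x \<in> P1 \<longleftrightarrow> x \<in> Z"
      using f.lying_over[OF Z(1) u] sU by blast
    obtain P2 where P2: "prime_filter B P2" "v \<in> P2" "\<And>x. x \<in> neg_cone A \<Longrightarrow> f x \<in> P2 \<longleftrightarrow> x \<in> Z"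
      using f.lying_over[OF Z(1) v] sU by blast
    obtain Q where Q: "prime_filter C Q" "\<And>x. x \<in> neg_cone A \<Longrightarrow> g x \<in> Q \<longleftrightarrow> x \<in> Z"
      using g.lying_over_one[OF Z(1)] by blast
    have "(P1, Q) \<in> pairs" "(P2, Q) \<in> pairs" using P1 P2 Q by (simp_all add: pairs_def)
    then have ex: "\<exists>d \<in> carrier A. f.B.eqv b (f d) \<in> P1 \<and> g.B.eqv c (g d) \<in> Q"
      "\<exists>d \<in> carrier A. f.B.eqv b (f d) \<in> P2 \<and> g.B.eqv c (g d) \<in> Q"
      using bc(3) by (auto simp: joined_def)
    obtain d1 where d1: "d1 \<in> carrier A" "f.B.eqv b (f d1) \<in> P1" "g.B.eqv c (g d1) \<in> Q" using ex(1) by auto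
    obtain d2 where d2: "d2 \<in> carrier A" "f.B.eqv b (f d2) \<in> P2" "g.B.eqv c (g d2) \<in> Q" using ex(2) by auto
    have "f.A.eqv a1 d1 \<in> Z" using f.eqv_restrict[OF P1(1) Z(1) P1(3) bc(1) a(1) d1(1)] P1(2) d1(2) by (simp add: u_def)
    moreover have "f.A.eqv d2 a2 \<in> Z"
      using f.eqv_restrict[OF P2(1) Z(1) P2(3) bc(1) d2(1) a(2)] P2(2) d2(2) by (simp add: v_def)
    moreover have "f.A.eqv d1 d2 \<in> Z" using g.eqv_restrict[OF Q(1) Z(1) Q(2) bc(2) d1(1) d2(1) d1(3) d2(3)] .
    ultimately have "w \<in> Z"
      using f.A.eqv_trans[OF f.A.prime_filterD[OF Z(1)]] a d1(1) d2(1) unfolding w_def by blast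
    then show False using Z(3) by simp
  qed
  then obtain p q where "p \<in> U u" "q \<in> U v" "p \<curlywedge>\<^bsub>A\<^esub> q \<preceq>\<^bsub>A\<^esub> w" by (auto simp: G_def)
  then show ?thesis using U_iff[OF u] U_iff[OF v] by (auto simp: u_def v_def w_def intro: that)
qed

lemma joined_combine:
  assumes bc: "b \<in> carrier B" "c \<in> carrier C" "joined b c" and a: "a1 \<in> carrier A" "a2 \<in> carrier A"
  obtains d where "d \<in> carrier A"
    "\<And>i. \<lbrakk>i \<in> IB; hB i b = hB i (f a1) \<or> hB i b = hB i (f a2)\<rbrakk> \<Longrightarrow> hB i b = hB i (f d)"
proof -
  obtain p q n m where pq: "p \<in> neg_cone A" "q \<in> neg_cone A"
    and un: "f.B.dpow n (f.B.eqv b (f a1)) \<preceq>\<^bsub>B\<^esub> f p" and vm: "f.B.dpow m (f.B.eqv b (f a2)) \<preceq>\<^bsub>B\<^esub> f q"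
    and w: "p \<curlywedge>\<^bsub>A\<^esub> q \<preceq>\<^bsub>A\<^esub> f.A.eqv a1 a2"
    using joined_bound[OF bc a] by metis
  note c = a pq[THEN f.A.neg_coneD(1)]
  note fc = c[THEN f.fs(1)] bc(1)
  define d where "d = (p \<otimes>\<^bsub>A\<^esub> a1) \<curlyvee>\<^bsub>A\<^esub> (q \<otimes>\<^bsub>A\<^esub> a2)"
  have dc: "d \<in> carrier A" using c by (simp add: d_def f.A.closed)
  have "hB i b = hB i (f d)" if i: "i \<in> IB" and or: "hB i b = hB i (f a1) \<or> hB i b = hB i (f a2)" for i
  proof -
    interpret F: star_chain_rl "FB i" by (rule f.B.chain[OF i])
    note hs = f.B.hs[OF i] and hle = f.B.hom_le[OF f.B.hom[OF i]]
    note F_closed = fc[THEN hs(1)]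
    \<comment> \<open>Where \<open>b\<close> agrees with \<open>x\<close>, their equivalence has
      value 1, which \<open>delta_rl\<close> fixes.\<close>
    have one: "hB i (f.B.dpow k (f.B.eqv b x)) = \<one>\<^bsub>FB i\<^esub>" if "x \<in> carrier B" "hB i b = hB i x" for x k
    proof (induction k)
      case 0
      show ?case using that bc(1) by (simp add: f.B.eqv_def hs f.B.closed F.imp_self F.meet_idem)
    next
      case (Suc k)
      then show ?case
        using f.B.dpow_closed[OF f.B.eqv_closed[OF bc(1) that(1)]] by (simp add: hs F.delta_one)
    qed
    have neg: "hB i (f x) \<preceq>\<^bsub>FB i\<^esub> \<one>\<^bsub>FB i\<^esub>" if "x \<in> neg_cone A" for x
      using hle[of "f x" "\<one>\<^bsub>B\<^esub>"] f.f_neg_cone[of x] f.A.neg_coneD[OF that] that f.B.neg_coneD f.fs(1) by (simp add: hs)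
    define \<alpha> where "\<alpha> = hB i (f a1)"
    define \<beta> where "\<beta> = hB i (f a2)"
    define \<pi> where "\<pi> = hB i (f p)"
    define \<kappa> where "\<kappa> = hB i (f q)"
    note cl = F_closed[folded \<alpha>_def \<beta>_def \<pi>_def \<kappa>_def]
    have "hB i (f (p \<curlywedge>\<^bsub>A\<^esub> q)) \<preceq>\<^bsub>FB i\<^esub> hB i (f (f.A.eqv a1 a2))"
      using w c by (intro hle f.A.hom_le[OF f.fhom]) (simp_all add: f.fs(1) f.A.closed f.A.eqv_closed)
    then have W: "\<pi> \<curlywedge>\<^bsub>FB i\<^esub> \<kappa> \<preceq>\<^bsub>FB i\<^esub> imp_rl (FB i) \<alpha> \<beta> \<curlywedge>\<^bsub>FB i\<^esub> imp_rl (FB i) \<beta> \<alpha>"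
      using c fc by (simp add: f.A.eqv_def f.fs hs f.A.closed f.B.closed \<alpha>_def \<beta>_def \<pi>_def \<kappa>_def)
    have pn: "\<pi> \<preceq>\<^bsub>FB i\<^esub> \<one>\<^bsub>FB i\<^esub>" "\<kappa> \<preceq>\<^bsub>FB i\<^esub> \<one>\<^bsub>FB i\<^esub>" using neg pq by (simp_all add: \<pi>_def \<kappa>_def)
    have hd: "hB i (f d) = (\<pi> \<otimes>\<^bsub>FB i\<^esub> \<alpha>) \<curlyvee>\<^bsub>FB i\<^esub> (\<kappa> \<otimes>\<^bsub>FB i\<^esub> \<beta>)"
      using c fc by (simp add: d_def f.fs hs f.A.closed f.B.closed \<alpha>_def \<beta>_def \<pi>_def \<kappa>_def)
    show ?thesis
      using or
    proof
      assume e: "hB i b = hB i (f a1)"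
      \<comment> \<open>An iterate with value 1 lies below \<open>\<pi>\<close>. Then the bound on
        the meet of \<open>\<pi>\<close> and \<open>\<kappa>\<close> puts \<open>\<kappa>\<close>
        below the implication from \<open>\<beta>\<close> to \<open>\<alpha>\<close>, so the second
        term of \<open>d\<close> is absorbed by the first, which is \<open>\<alpha>\<close>.\<close>
      have "\<pi> = \<one>\<^bsub>FB i\<^esub>"
        using hle[OF _ _ un] one[OF fc(1) e, of n] f.B.dpow_closed[OF f.B.eqv_closed[OF bc(1) fc(1)]] fc(3) pn(1) F.one_le_iff[of \<pi>] cl
        by (simp add: \<pi>_def)
      moreover from this have "\<kappa> \<preceq>\<^bsub>FB i\<^esub> imp_rl (FB i) \<beta> \<alpha>"
        using W pn cl F.le_absorb(2)[of \<kappa> "\<one>\<^bsub>FB i\<^esub>"] by (simp add: F.le_meet_iff F.closed)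
      then have "\<kappa> \<otimes>\<^bsub>FB i\<^esub> \<beta> \<preceq>\<^bsub>FB i\<^esub> \<alpha>" using F.le_imp_iff[of \<beta> \<alpha> \<kappa>] cl by simp
      ultimately show ?thesis using hd e cl F.le_absorb(4)[of "\<kappa> \<otimes>\<^bsub>FB i\<^esub> \<beta>" \<alpha>] by (simp add: \<alpha>_def)
    next
      assume e: "hB i b = hB i (f a2)"
      have "\<kappa> = \<one>\<^bsub>FB i\<^esub>"
        using hle[OF _ _ vm] one[OF fc(2) e, of m] f.B.dpow_closed[OF f.B.eqv_closed[OF bc(1) fc(2)]] fc(4) pn(2) F.one_le_iff[of \<kappa>] cl
        by (simp add: \<kappa>_def)
      moreover from this have "\<pi> \<preceq>\<^bsub>FB i\<^esub> imp_rl (FB i) \<alpha> \<beta>"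
        using W pn cl F.le_absorb(1)[of \<pi> "\<one>\<^bsub>FB i\<^esub>"] by (simp add: F.le_meet_iff F.closed)
      then have "\<pi> \<otimes>\<^bsub>FB i\<^esub> \<alpha> \<preceq>\<^bsub>FB i\<^esub> \<beta>" using F.le_imp_iff[of \<alpha> \<beta> \<pi>] cl by simp
      ultimately show ?thesis using hd e cl F.le_absorb(3)[of "\<pi> \<otimes>\<^bsub>FB i\<^esub> \<alpha>" \<beta>] by (simp add: \<beta>_def)
    qed
  qed
  then show ?thesis using that dc by blast
qed

text \<open>Each induction step merges the first two elements of the list into one that agrees with
  \<open>b\<close> wherever either of them did. With one element left, separation of points
  applies.\<close>

lemma joined_covered:
  assumes bc: "b \<in> carrier B" "c \<in> carrier C" "joined b c"
    and as: "set (a # as) \<subseteq> carrier A" "\<And>i. i \<in> IB \<Longrightarrow> \<exists>x \<in> set (a # as). hB i b = hB i (f x)"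
  shows "b \<in> f ` carrier A"
  using as
proof (induction as arbitrary: a)
  case Nil
  have "b = f a"
    by (rule f.B.separating) (use Nil bc f.fs(1) in auto)
  then show ?case using Nil by auto
next
  case (Cons a2 as)
  obtain d where d: "d \<in> carrier A"
    "\<And>i. \<lbrakk>i \<in> IB; hB i b = hB i (f a) \<or> hB i b = hB i (f a2)\<rbrakk> \<Longrightarrow> hB i b = hB i (f d)"
    using joined_combine[OF bc, of a a2] Cons.prems(1) by (metis insert_subset list.simps(15))
  show ?case
  proof (rule Cons.IH)
    show "set (d # as) \<subseteq> carrier A" using Cons.prems(1) d(1) by simp
    show "\<exists>x \<in> set (d # as). hB i b = hB i (f x)" if "i \<in> IB" for i
      using Cons.prems(2)[OF that] d(2)[OF that] by auto
  qed
qed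

text \<open>A compactness argument. \<open>S\<close> consists of the negative elements bounded, in
  each coordinate, by one of finitely many equivalences of \<open>b\<close> with images of
  \<open>A\<close>; joining lists makes it closed under joins. If 1 were not in \<open>S\<close>, a
  prime filter would avoid \<open>S\<close>, yet \<open>joined_locally\<close> puts into it such an
  equivalence, an element of \<open>S\<close> with a one-element list. So 1 is in \<open>S\<close>:
  finitely many elements of \<open>A\<close> cover all coordinates.\<close>

lemma joined_imp_mem:
  assumes bc: "b \<in> carrier B" "c \<in> carrier C" "joined b c"
  shows "b \<in> f ` carrier A"
proof -
  define S where "S = {x \<in> neg_cone B. \<exists>as. set as \<subseteq> carrier A \<and>
    (\<forall>i \<in> IB. \<exists>a \<in> set as. hB i x \<preceq>\<^bsub>FB i\<^esub> hB i (f.B.eqv b (f a)))}"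
  have "\<one>\<^bsub>B\<^esub> \<in> S"
  proof (rule ccontr)
    assume "\<one>\<^bsub>B\<^esub> \<notin> S"
    then have "{\<one>\<^bsub>B\<^esub>} \<inter> S = {}" by simp
    moreover have "x \<curlyvee>\<^bsub>B\<^esub> y \<in> S" if xy: "x \<in> S" "y \<in> S" for x y
    proof -
      obtain as bs where as: "set as \<subseteq> carrier A" "\<forall>i \<in> IB. \<exists>a \<in> set as. hB i x \<preceq>\<^bsub>FB i\<^esub> hB i (f.B.eqv b (f a))"
        and bs: "set bs \<subseteq> carrier A" "\<forall>i \<in> IB. \<exists>a \<in> set bs. hB i y \<preceq>\<^bsub>FB i\<^esub> hB i (f.B.eqv b (f a))"
        and n: "x \<in> neg_cone B" "y \<in> neg_cone B"
        using xy by (auto simp: S_def)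
      have "\<exists>a \<in> set (as @ bs). hB i (x \<curlyvee>\<^bsub>B\<^esub> y) \<preceq>\<^bsub>FB i\<^esub> hB i (f.B.eqv b (f a))" if i: "i \<in> IB" for i
      proof -
        have "hB i (x \<curlyvee>\<^bsub>B\<^esub> y) = hB i x \<or> hB i (x \<curlyvee>\<^bsub>B\<^esub> y) = hB i y"
          using n[THEN f.B.neg_coneD(1)] star_chain_rl.join_max[OF f.B.chain[OF i]] by (simp add: f.B.hs[OF i])
        moreover obtain a a' where "a \<in> set as" "hB i x \<preceq>\<^bsub>FB i\<^esub> hB i (f.B.eqv b (f a))"
          "a' \<in> set bs" "hB i y \<preceq>\<^bsub>FB i\<^esub> hB i (f.B.eqv b (f a'))"
          using bspec[OF as(2) i] bspec[OF bs(2) i] by auto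
        ultimately show ?thesis by (elim disjE) (auto intro: bexI[of _ a] bexI[of _ a'])
      qed
      then show ?thesis
        using as(1) bs(1) f.B.neg_cone_join[OF n] unfolding S_def by (auto intro!: exI[of _ "as @ bs"])
    qed
    moreover have "S \<subseteq> neg_cone B" by (auto simp: S_def)
    ultimately obtain P where P: "prime_filter B P" "P \<inter> S = {}"
      using f.B.prime_filter_exists[OF f.B.one_filter] by metis
    obtain a where a: "a \<in> carrier A" "f.B.eqv b (f a) \<in> P" using joined_locally[OF bc(3) P(1)] by blast
    have fa: "f a \<in> carrier B" using a f.fs(1) by simp
    have "hB i (f.B.eqv b (f a)) \<preceq>\<^bsub>FB i\<^esub> hB i (f.B.eqv b (f a))" if "i \<in> IB" for i
      using f.B.hom_le[OF f.B.hom[OF that]] f.B.le_refl f.B.eqv_closed[OF bc(1) fa] by simp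
    then have "f.B.eqv b (f a) \<in> S"
      using f.B.eqv_neg_cone[OF bc(1) fa] a(1) unfolding S_def by (auto intro!: exI[of _ "[a]"])
    then show False using a(2) P(2) by blast
  qed
  then obtain as where as: "set as \<subseteq> carrier A"
    "\<And>i. i \<in> IB \<Longrightarrow> \<exists>a \<in> set as. hB i \<one>\<^bsub>B\<^esub> \<preceq>\<^bsub>FB i\<^esub> hB i (f.B.eqv b (f a))"
    by (auto simp: S_def)
  \<comment> \<open>The list is empty if there are no coordinates; prepending the unit makes it
    nonempty.\<close>
  have "\<exists>x \<in> set (\<one>\<^bsub>A\<^esub> # as). hB i b = hB i (f x)" if i: "i \<in> IB" for i
  proof -
    obtain x where x: "x \<in> set as" "hB i \<one>\<^bsub>B\<^esub> \<preceq>\<^bsub>FB i\<^esub> hB i (f.B.eqv b (f x))" using as(2)[OF i] by blast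
    interpret F: star_chain_rl "FB i" by (rule f.B.chain[OF i])
    have fx: "f x \<in> carrier B" using x as(1) f.fs(1) by auto
    note hc = f.B.hs(1)[OF i bc(1)] f.B.hs(1)[OF i fx]
    have "\<one>\<^bsub>FB i\<^esub> \<preceq>\<^bsub>FB i\<^esub> imp_rl (FB i) (hB i b) (hB i (f x))" "\<one>\<^bsub>FB i\<^esub> \<preceq>\<^bsub>FB i\<^esub> imp_rl (FB i) (hB i (f x)) (hB i b)"
      using x(2) bc(1) fx hc by (simp_all add: f.B.eqv_def f.B.hs[OF i] f.B.closed F.le_meet_iff F.closed)
    then have "hB i b = hB i (f x)"
      using F.one_le_iff F.imp_le_one F.imp_eq_one F.le_antisym F.closed hc by metis
    then show ?thesis using x by auto
  qed
  then show ?thesis using joined_covered[OF bc, of "\<one>\<^bsub>A\<^esub>" as] as(1) by simp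
qed

end

lemma (in star_semilinear) separated_by_prime:
  assumes "x \<in> carrier L" "y \<in> carrier L" "x \<noteq> y"
  obtains P where "prime_filter L P" "eqv x y \<notin> P"
proof -
  have "eqv x y \<notin> {\<one>}" using assms eqv_one_iff by simp
  then show ?thesis using prime_avoiding[OF eqv_neg_cone one_filter] assms that by metis
qed

lemma star_involutive_strong_amalgamation:
  assumes inf: "infinite (UNIV :: 'u set)"
  shows "strong_amalgamation_property (star_involutive_rl :: 'u reslat set)"
  unfolding strong_amalgamation_property_def
proof (intro ballI)
  fix A B C :: "'u reslat" and f g
  assume K: "A \<in> star_involutive_rl" "B \<in> star_involutive_rl" "C \<in> star_involutive_rl"
    and fg: "f \<in> emb_rl A B" "g \<in> emb_rl A C"
  obtain IA :: "('u \<times> 'u) set" and FA :: "'u \<times> 'u \<Rightarrow> 'u reslat" and hA where A: "star_semilinear A IA FA hA" using star_involutive_separated[OF K(1)] .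
  obtain IB :: "('u \<times> 'u) set" and FB :: "'u \<times> 'u \<Rightarrow> 'u reslat" and hB where B: "star_semilinear B IB FB hB" using star_involutive_separated[OF K(2)] .
  obtain IC :: "('u \<times> 'u) set" and FC :: "'u \<times> 'u \<Rightarrow> 'u reslat" and hC where C: "star_semilinear C IC FC hC" using star_involutive_separated[OF K(3)] .
  interpret S: star_span A IA FA hA B IB FB hB f C IC FC hC g
    using A B C fg by (simp add: star_span_def star_embedding_def star_embedding_axioms_def)
  \<comment> \<open>The span with \<open>B\<close> and \<open>C\<close> exchanged, needed to find a
    partner in \<open>B\<close> for a prime of \<open>C\<close>.\<close>
  interpret T: star_span A IA FA hA C IC FC hC g B IB FB hB f ..
  have swap: "(P, Q) \<in> S.pairs \<longleftrightarrow> (Q, P) \<in> T.pairs" for P Q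
    by (auto simp: S.pairs_def T.pairs_def)
  define good where "good i t \<longleftrightarrow> (case t of (D :: ('u + 'u) reslat, jB, jC) \<Rightarrow>
    star_chain D \<and> jB \<in> hom_rl B D \<and> jC \<in> hom_rl C D \<and>
    (\<forall>a \<in> carrier A. jB (f a) = jC (g a)) \<and>
    (\<forall>b \<in> carrier B. \<forall>b' \<in> carrier B. jB b = jB b' \<longleftrightarrow> S.f.B.eqv b b' \<in> fst i) \<and>
    (\<forall>c \<in> carrier C. \<forall>c' \<in> carrier C. jC c = jC c' \<longleftrightarrow> S.g.B.eqv c c' \<in> snd i) \<and>
    (\<forall>b \<in> carrier B. \<forall>c \<in> carrier C. jB b = jC c \<longrightarrow>
      (\<exists>a \<in> carrier A. S.f.B.eqv b (f a) \<in> fst i \<and> S.g.B.eqv c (g a) \<in> snd i)))" for i t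
  have "\<exists>t. good i t" if "i \<in> S.pairs" for i
    using S.pair_chain[of "fst i" "snd i"] that by (simp add: S.pairs_def good_def case_prod_beta)
  then have "\<forall>i \<in> S.pairs. \<exists>t. good i t" by blast
  from bchoice[OF this] obtain t where t: "\<And>i. i \<in> S.pairs \<Longrightarrow> good i (t i)" by blast
  define D where "D i = fst (t i)" for i
  define jB where "jB i = fst (snd (t i))" for i
  define jC where "jC i = snd (snd (t i))" for i
  note props = t[unfolded good_def case_prod_beta, folded D_def jB_def jC_def]
  have D: "star_chain (D i)" and jB: "jB i \<in> hom_rl B (D i)" and jC: "jC i \<in> hom_rl C (D i)" if "i \<in> S.pairs" for i
    using props[OF that] by simp_all
  have glue: "jB i (f a) = jC i (g a)" if "i \<in> S.pairs" "a \<in> carrier A" for i a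
    using props[OF that(1)] that(2) by simp
  have eqB: "jB i b = jB i b' \<longleftrightarrow> S.f.B.eqv b b' \<in> fst i" if "i \<in> S.pairs" "b \<in> carrier B" "b' \<in> carrier B" for i b b'
    using props[OF that(1)] that(2,3) by simp
  have eqC: "jC i c = jC i c' \<longleftrightarrow> S.g.B.eqv c c' \<in> snd i" if "i \<in> S.pairs" "c \<in> carrier C" "c' \<in> carrier C" for i c c'
    using props[OF that(1)] that(2,3) by simp
  have eqBC: "\<exists>a \<in> carrier A. S.f.B.eqv b (f a) \<in> fst i \<and> S.g.B.eqv c (g a) \<in> snd i"
    if "i \<in> S.pairs" "b \<in> carrier B" "c \<in> carrier C" "jB i b = jC i c" for i b c
    using props[OF that(1)] that(2-4) by simp
  have rl: "residuated_lattice B" "residuated_lattice C"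
    using K by (auto simp: star_involutive_rl_def idempotent_rl_def)
  obtain M :: "'u reslat" and gB gC where M: "M \<in> star_involutive_rl"
    and gB: "gB \<in> hom_rl B M" and gC: "gC \<in> hom_rl C M"
    and gB_eq: "\<And>b b'. \<lbrakk>b \<in> carrier B; b' \<in> carrier B\<rbrakk> \<Longrightarrow> gB b = gB b' \<longleftrightarrow> (\<forall>i \<in> S.pairs. jB i b = jB i b')"
    and gC_eq: "\<And>c c'. \<lbrakk>c \<in> carrier C; c' \<in> carrier C\<rbrakk> \<Longrightarrow> gC c = gC c' \<longleftrightarrow> (\<forall>i \<in> S.pairs. jC i c = jC i c')"
    and g_eq: "\<And>b c. \<lbrakk>b \<in> carrier B; c \<in> carrier C\<rbrakk> \<Longrightarrow> gB b = gC c \<longleftrightarrow> (\<forall>i \<in> S.pairs. jB i b = jC i c)"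
    by (rule joint_amalgam[OF inf rl, of S.pairs D jB jC]) (use D jB jC in blast)+
  have "inj_on gB (carrier B)"
  proof (rule inj_onI, rule ccontr)
    \<comment> \<open>Every prime of \<open>B\<close> occurs in some pair, so the pairs separate the
      points of \<open>B\<close>.\<close>
    fix b b' assume b: "b \<in> carrier B" "b' \<in> carrier B" "gB b = gB b'" "b \<noteq> b'"
    obtain P where P: "prime_filter B P" "S.f.B.eqv b b' \<notin> P"
      using S.f.B.separated_by_prime[OF b(1,2,4)] by blast
    obtain Q where "(P, Q) \<in> S.pairs" using S.pair_over[OF P(1)] .
    then show False using b gB_eq eqB[of "(P, Q)"] P(2) by auto
  qed
  moreover have "inj_on gC (carrier C)"
  proof (rule inj_onI, rule ccontr)
    fix c c' assume c: "c \<in> carrier C" "c' \<in> carrier C" "gC c = gC c'" "c \<noteq> c'"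
    obtain Q where Q: "prime_filter C Q" "S.g.B.eqv c c' \<notin> Q"
      using S.g.B.separated_by_prime[OF c(1,2,4)] by blast
    obtain P where "(Q, P) \<in> T.pairs" using T.pair_over[OF Q(1)] .
    then have "(P, Q) \<in> S.pairs" by (simp add: swap)
    then show False using c gC_eq eqC[of "(P, Q)"] Q(2) by auto
  qed
  ultimately have emb: "gB \<in> emb_rl B M" "gC \<in> emb_rl C M" using gB gC by (auto simp: emb_rl_def)
  have agree: "gB (f a) = gC (g a)" if "a \<in> carrier A" for a
    using g_eq[of "f a" "g a"] glue that S.f.fs(1) S.g.fs(1) by blast
  have "gB ` carrier B \<inter> gC ` carrier C \<subseteq> (gB \<circ> f) ` carrier A"
  proof
    fix x assume "x \<in> gB ` carrier B \<inter> gC ` carrier C"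
    then obtain b c where bc: "b \<in> carrier B" "c \<in> carrier C" "x = gB b" "gB b = gC c" by auto
    have "S.joined b c"
      unfolding S.joined_def using g_eq[OF bc(1,2)] bc eqBC by fastforce
    then have "b \<in> f ` carrier A" using S.joined_imp_mem bc by blast
    then show "x \<in> (gB \<circ> f) ` carrier A" using bc(3) by auto
  qed
  moreover have "(gB \<circ> f) ` carrier A \<subseteq> gB ` carrier B \<inter> gC ` carrier C"
  proof (rule image_subsetI)
    fix a assume a: "a \<in> carrier A"
    have "gB (f a) \<in> gB ` carrier B" "gC (g a) \<in> gC ` carrier C"
      using S.f.fs(1)[OF a] S.g.fs(1)[OF a] by auto
    then show "(gB \<circ> f) a \<in> gB ` carrier B \<inter> gC ` carrier C" using agree[OF a] by simp
  qed
  ultimately have eq: "(gB \<circ> f) ` carrier A = gB ` carrier B \<inter> gC ` carrier C" by (rule equalityI[rotated])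
  show "\<exists>D \<in> (star_involutive_rl :: 'u reslat set). \<exists>gB \<in> emb_rl B D. \<exists>gC \<in> emb_rl C D.
      (\<forall>a \<in> carrier A. gB (f a) = gC (g a)) \<and> (gB \<circ> f) ` carrier A = gB ` carrier B \<inter> gC ` carrier C"
    by (intro bexI[of _ M] bexI[of _ gB] bexI[of _ gC] conjI ballI) (fact agree eq M emb)+
qed

lemma star_involutive_subalgebra:
  fixes B :: "'u reslat"
  assumes B: "B \<in> star_involutive_rl" and S: "S \<subseteq> carrier B" "closed_ops B S"
  shows "B\<lparr>carrier := S\<rparr> \<in> star_involutive_rl"
proof -
  obtain I :: "('u \<times> 'u) set" and F :: "'u \<times> 'u \<Rightarrow> 'u reslat" and h where "star_semilinear B I F h" using star_involutive_separated[OF B] .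
  then interpret B: star_semilinear B I F h .
  show ?thesis
  proof (rule star_involutive_of_homs)
    show "h i \<in> hom_rl (B\<lparr>carrier := S\<rparr>) (F i)" if "i \<in> I" for i
      using B.hom[OF that] S(1) by (auto simp: hom_rl_def hom_def subset_iff)
    show "star_chain (F i)" if "i \<in> I" for i using B.chains[OF that] .
    show "x = y" if "x \<in> carrier (B\<lparr>carrier := S\<rparr>)" "y \<in> carrier (B\<lparr>carrier := S\<rparr>)"
      "\<And>i. i \<in> I \<Longrightarrow> h i x = h i y" for x y
      using B.separating[OF subsetD[OF S(1)] subsetD[OF S(1)] that(3)] that(1,2) by simp
  qed (simp add: carrier_update_simps S)
qed

theorem theorem5p16:
  assumes "infinite (UNIV :: 'u set)"
  shows "strong_amalgamation_property (star_involutive_rl :: 'u reslat set)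
    \<and> ES_property (star_involutive_rl :: 'u reslat set)"
proof
  show sap: "strong_amalgamation_property (star_involutive_rl :: 'u reslat set)"
    using star_involutive_strong_amalgamation[OF assms] .
  show "ES_property (star_involutive_rl :: 'u reslat set)"
    unfolding ES_property_def
  proof (intro ballI allI impI)
    fix A B :: "'u reslat" and h
    assume A: "A \<in> star_involutive_rl" and B: "B \<in> star_involutive_rl"
      and epi: "epimorphism_in star_involutive_rl A B h"
    have h: "h \<in> hom_rl A B" using epi by (simp add: epimorphism_in_def)
    have rl: "residuated_lattice A" using A by (simp add: star_involutive_rl_def idempotent_rl_def)
    define H where "H = B\<lparr>carrier := h ` carrier A\<rparr>"
    have sub: "h ` carrier A \<subseteq> carrier B" using hom_rlD(1)[OF h] by auto
    have HK: "H \<in> star_involutive_rl"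
      unfolding H_def
      by (rule star_involutive_subalgebra[OF B sub hom_image_closed_ops[OF h residuated_lattice.closed_ops_carrier[OF rl]]])
    have id: "id \<in> emb_rl H B"
      using sub by (auto simp: emb_rl_def hom_rl_def hom_def H_def)
    obtain D :: "'u reslat" and gB gC where D: "D \<in> star_involutive_rl" "gB \<in> emb_rl B D" "gC \<in> emb_rl B D"
      and agree: "\<forall>a \<in> carrier H. gB (id a) = gC (id a)"
      and meet: "(gB \<circ> id) ` carrier H = gB ` carrier B \<inter> gC ` carrier B"
      using sap[unfolded strong_amalgamation_property_def, rule_format, OF HK B B id id] by blast
    have "\<forall>b \<in> carrier B. gB b = gC b"
      using epi D agree by (auto simp: epimorphism_in_def emb_rl_def H_def)
    \<comment> \<open>As \<open>gB\<close> and \<open>gC\<close> coincide on all of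
      \<open>B\<close>, the intersection in \<open>meet\<close> is the whole image of
      \<open>B\<close>.\<close>
    then have "gB ` carrier B = gB ` (h ` carrier A)" using meet by (auto simp: H_def)
    then show "h ` carrier A = carrier B"
      using D(2) sub inj_on_image_eq_iff[of gB "carrier B"] by (auto simp: emb_rl_def)
  qed
qed

end
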